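(* Let $k$ be an algebraically closed field and let $A=kQ/I$ be a finite dimensional (indecomposable) gentle $k$-algebra with graph $\Gamma_A$. Let $B$ be the Brauer graph algebra defined on $\Gamma_A$ with cyclic ordering induced by the maximal paths in $A$ and with multiplicity equal to one at every vertex. Then the trivial extension $T(A)$ of $A$ is isomorphic to $B$, and $G_{T(A)}=\Gamma_A$, where $G_{T(A)}$ is the graph of $T(A)$ as a symmetric special biserial algebra (with the same cyclic orderings of edges at each vertex).
   Context: Paths are composed left to right; $s(\cdot),t(\cdot)$ denote start and end. An algebra is gentle if it is Morita equivalent to $kQ/I$ ($Q$ finite connected, $I$ admissible) with: (S1) each vertex is the start of at most two arrows and the end of at most two arrows; (S2) for each arrow $\alpha$ at most one arrow $\beta$ with $\alpha\beta\notin I$ and at most one arrow $\gamma$ with $\gamma\alpha\notin I$; (S3) $I$ is generated by paths of length 2; (S4) for each arrow $\alpha$ at most one arrow $\delta$ with $\alpha\delta\in I$ and at most one arrow $\varepsilon$ with $\varepsilon\alpha\in I$. Trivial extension: $T(A)=A\ltimes D(A)$, where $D(A)=\mathrm{Hom}_k(A,k)$; as a vector space $A\oplus D(A)$ with $(a,f)(b,g)=(ab,ag+fb)$. Graph $\Gamma_A$: let $\mathcal M$ be the set of nontrivial maximal paths of $(Q,I)$ (paths not in $I$ that cannot be extended by an arrow on either side without lying in $I$). Let $\overline{\mathcal M}$ consist of $\mathcal M$ together with the trivial paths $e_i$ at those vertices $i$ that are a sink with a single incoming arrow, or a source with a single outgoing arrow, or have exactly one incoming arrow $\alpha$ and one outgoing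 arrow $\beta$ with $\alpha\beta\notin I$. Each vertex of $Q$ lies on exactly two elements of $\overline{\mathcal M}$. $\Gamma_A$ has one vertex $\nu(m)$ for each $m\in\overline{\mathcal M}$ and one edge $E_i$ for each vertex $i$ of $Q$, joining $\nu(m_i)$ and $\nu(n_i)$, where $m_i,n_i$ are the two elements of $\overline{\mathcal M}$ through $i$. Cyclic ordering induced by maximal paths: for $m=i_1\to i_2\to\cdots\to i_{n+1}$ in $\mathcal M$, the edges around $\nu(m)$ are ordered $E_{i_1}<E_{i_2}<\dots<E_{i_{n+1}}$ following $m$, closed up cyclically by letting $E_{i_1}$ follow $E_{i_{n+1}}$; a vertex $\nu(e_i)$ has the single edge $E_i$. Brauer graph algebra: for a Brauer graph $\Gamma$ (finite connected graph, loops/multiple edges allowed, with cyclic ordering of edges around each vertex and multiplicities $e(\nu)\ge1$), its quiver has a vertex $i$ per edge $E_i$ and an arrow $i\to j$ when $E_j$ directly follows $E_i$ around a common vertex (a loop at a leaf edge only if the leaf vertex has multiplicity $\ge2$). With $C_{\nu,i}$ the cycle of vertex $\nu$ starting at $i$, relations are $C_{\nu,i}^{e(\nu)}-C_{\nu',i}^{e(\nu')}$ for edges $E_i$ with endpoints $\nu,\nu'$ neither a leaf vertex of multiplicity one; $C_{\nu',i}\alpha$ ($\alpha$ the arrow of $C_{\nu',i}$ from $i$) when $\nu$ is a leaf vertex of multiplicity one; and $\alpha\beta$ for composable arrows on cycles of distinct vertices. Graph $G_\Lambda$ of a symmetric special biserial algebra $\Lambda=kQ/I$: at each vertex $i$ take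 the two maximal cyclic paths at $i$ (the paths $p,q$ with $P_i$ biserial given by $p-q\in I$, or the unique nontrivial maximal path $p$ from $i$ to $i$ together with $e_i$ if $P_i$ is uniserial); the vertices of $G_\Lambda$ are rotation classes of such paths; writing $p=p_0^m$ with $p_0$ a simple cycle through vertices $(i,i_1,\dots,i_k)$, the vertex carries germs labelled $i,i_1,\dots,i_k$ in this cyclic order and multiplicity $m$; the two germs labelled by each vertex $i$ of $Q$ are joined to an edge.
   Formalization: At loops of the Brauer graph, the relations αβ are imposed whenever β does not directly follow α on its cycle (not only for cycles of distinct vertices), as otherwise B can be infinite-dimensional; Q is assumed to have an arrow, since for A = k the graph Γ_A is undefined. *)

theory Defs
  imports "HOL-Computational_Algebra.Polynomial"
begin

section \<open>Fields\<close>

definition alg_closed :: "'k::field itself \<Rightarrow> bool" where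
  "alg_closed _ = (\<forall>p :: 'k poly. 0 < degree p \<longrightarrow> (\<exists>x. poly p x = 0))"

section \<open>k-algebras (concretely: carrier with operations)\<close>

record ('e, 'k) kalg =
  acarrier :: "'e set"
  azero :: 'e
  aone :: 'e
  aadd :: "'e \<Rightarrow> 'e \<Rightarrow> 'e"
  amul :: "'e \<Rightarrow> 'e \<Rightarrow> 'e"
  asmul :: "'k \<Rightarrow> 'e \<Rightarrow> 'e"

text \<open>Isomorphism of k-algebras: a k-linear, multiplicative, unital bijection.\<close>
definition kalg_iso :: "('e, 'k) kalg \<Rightarrow> ('f, 'k) kalg \<Rightarrow> bool" where
  "kalg_iso A B = (\<exists>\<phi>. bij_betw \<phi> (acarrier A) (acarrier B) \<and> \<phi> (aone A) = aone B \<and>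
     (\<forall>x\<in>acarrier A. \<forall>y\<in>acarrier A.
        \<phi> (aadd A x y) = aadd B (\<phi> x) (\<phi> y) \<and> \<phi> (amul A x y) = amul B (\<phi> x) (\<phi> y)) \<and>
     (\<forall>c. \<forall>x\<in>acarrier A. \<phi> (asmul A c x) = asmul B c (\<phi> x)))"

text \<open>Two-sided ideals and the ideal generated by a set.\<close>
definition is_ideal :: "('e, 'k) kalg \<Rightarrow> 'e set \<Rightarrow> bool" where
  "is_ideal A J = (J \<subseteq> acarrier A \<and> azero A \<in> J \<and>
     (\<forall>x\<in>J. \<forall>y\<in>J. aadd A x y \<in> J) \<and> (\<forall>c. \<forall>x\<in>J. asmul A c x \<in> J) \<and>
     (\<forall>a\<in>acarrier A. \<forall>x\<in>J. amul A a x \<in> J \<and> amul A x a \<in> J))"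

definition ideal_gen :: "('e, 'k) kalg \<Rightarrow> 'e set \<Rightarrow> 'e set" where
  "ideal_gen A S = \<Inter> {J. S \<subseteq> J \<and> is_ideal A J}"

text \<open>Quotient algebra A/J (elements are cosets).\<close>
definition qcls :: "('e, 'k::field) kalg \<Rightarrow> 'e set \<Rightarrow> 'e \<Rightarrow> 'e set" where
  "qcls A J x = {y \<in> acarrier A. aadd A y (asmul A (-1) x) \<in> J}"

definition qrep :: "'e set \<Rightarrow> 'e" where
  "qrep X = (SOME x. x \<in> X)"

definition quot_alg :: "('e, 'k::field) kalg \<Rightarrow> 'e set \<Rightarrow> ('e set, 'k) kalg" where
  "quot_alg A J =
     \<lparr> acarrier = qcls A J ` acarrier A,
       azero = qcls A J (azero A),
       aone = qcls A J (aone A),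
       aadd = (\<lambda>X Y. qcls A J (aadd A (qrep X) (qrep Y))),
       amul = (\<lambda>X Y. qcls A J (amul A (qrep X) (qrep Y))),
       asmul = (\<lambda>c X. qcls A J (asmul A c (qrep X))) \<rparr>"

text \<open>Trivial extension T(A) = A \<ltimes> D(A), D(A) = Hom_k(A,k), with
  (a,f)(b,g) = (ab, ag + fb), where (a g)(x) = g(x a) and (f b)(x) = f(b x).\<close>
definition lin_functional :: "('e, 'k::field) kalg \<Rightarrow> ('e \<Rightarrow> 'k) \<Rightarrow> bool" where
  "lin_functional A f = ((\<forall>x\<in>acarrier A. \<forall>y\<in>acarrier A. f (aadd A x y) = f x + f y) \<and>
     (\<forall>c. \<forall>x\<in>acarrier A. f (asmul A c x) = c * f x) \<and> (\<forall>x. x \<notin> acarrier A \<longrightarrow> f x = 0))"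

definition triv_ext :: "('e, 'k::field) kalg \<Rightarrow> ('e \<times> ('e \<Rightarrow> 'k), 'k) kalg" where
  "triv_ext A =
     \<lparr> acarrier = {(a, f). a \<in> acarrier A \<and> lin_functional A f},
       azero = (azero A, \<lambda>_. 0),
       aone = (aone A, \<lambda>_. 0),
       aadd = (\<lambda>(a, f) (b, g). (aadd A a b, \<lambda>x. f x + g x)),
       amul = (\<lambda>(a, f) (b, g). (amul A a b,
                 \<lambda>x. if x \<in> acarrier A then g (amul A x a) + f (amul A b x) else 0)),
       asmul = (\<lambda>c (a, f). (asmul A c a, \<lambda>x. c * f x)) \<rparr>"

section \<open>Quivers, paths, path algebras (paths composed left to right)\<close>

text \<open>A path is (start vertex, list of arrows); the trivial path e_v is (v, []).\<close>
type_synonym ('v, 'a) path = "'v \<times> 'a list"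

definition valid_path :: "'v set \<Rightarrow> 'a set \<Rightarrow> ('a \<Rightarrow> 'v) \<Rightarrow> ('a \<Rightarrow> 'v) \<Rightarrow> ('v, 'a) path \<Rightarrow> bool" where
  "valid_path V Arr s t p = (fst p \<in> V \<and> set (snd p) \<subseteq> Arr \<and>
     (snd p \<noteq> [] \<longrightarrow> s (hd (snd p)) = fst p) \<and>
     (\<forall>j. Suc j < length (snd p) \<longrightarrow> t (snd p ! j) = s (snd p ! Suc j)))"

definition pend :: "('a \<Rightarrow> 'v) \<Rightarrow> ('v, 'a) path \<Rightarrow> 'v" where
  "pend t p = (if snd p = [] then fst p else t (last (snd p)))"

text \<open>The basis element of the path algebra given by a path.\<close>
definition pelem :: "('v, 'a) path \<Rightarrow> (('v, 'a) path \<Rightarrow> 'k::field)" where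
  "pelem p = (\<lambda>q. if q = p then 1 else 0)"

definition path_alg :: "'v set \<Rightarrow> 'a set \<Rightarrow> ('a \<Rightarrow> 'v) \<Rightarrow> ('a \<Rightarrow> 'v) \<Rightarrow>
    ((('v, 'a) path \<Rightarrow> 'k::field), 'k) kalg" where
  "path_alg V Arr s t =
     \<lparr> acarrier = {x. finite {p. x p \<noteq> 0} \<and> (\<forall>p. x p \<noteq> 0 \<longrightarrow> valid_path V Arr s t p)},
       azero = (\<lambda>_. 0),
       aone = (\<lambda>p. if snd p = [] \<and> fst p \<in> V then 1 else 0),
       aadd = (\<lambda>x y p. x p + y p),
       amul = (\<lambda>x y r. \<Sum>(p, q) \<in> {(p, q). x p \<noteq> 0 \<and> y q \<noteq> 0 \<and> pend t p = fst q \<and>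
                                     (fst p, snd p @ snd q) = r}. x p * y q),
       asmul = (\<lambda>c x p. c * x p) \<rparr>"

definition quiver :: "'v set \<Rightarrow> 'a set \<Rightarrow> ('a \<Rightarrow> 'v) \<Rightarrow> ('a \<Rightarrow> 'v) \<Rightarrow> bool" where
  "quiver V Arr s t = (finite V \<and> finite Arr \<and> (\<forall>a\<in>Arr. s a \<in> V \<and> t a \<in> V))"

definition quiver_connected :: "'v set \<Rightarrow> 'a set \<Rightarrow> ('a \<Rightarrow> 'v) \<Rightarrow> ('a \<Rightarrow> 'v) \<Rightarrow> bool" where
  "quiver_connected V Arr s t = (V \<noteq> {} \<and>
     (\<forall>u\<in>V. \<forall>v\<in>V. (u, v) \<in> ({(s a, t a) | a. a \<in> Arr} \<union> {(t a, s a) | a. a \<in> Arr})\<^sup>*))"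

text \<open>Admissible ideal: J^N \<subseteq> I \<subseteq> J^2 (J the arrow ideal).\<close>
definition admissible :: "'v set \<Rightarrow> 'a set \<Rightarrow> ('a \<Rightarrow> 'v) \<Rightarrow> ('a \<Rightarrow> 'v) \<Rightarrow>
    (('v, 'a) path \<Rightarrow> 'k::field) set \<Rightarrow> bool" where
  "admissible V Arr s t I = (is_ideal (path_alg V Arr s t) I \<and>
     (\<forall>x\<in>I. \<forall>p. x p \<noteq> 0 \<longrightarrow> 2 \<le> length (snd p)) \<and>
     (\<exists>N. 2 \<le> N \<and> (\<forall>p. valid_path V Arr s t p \<and> N \<le> length (snd p) \<longrightarrow> pelem p \<in> I)))"

text \<open>Gentle bound quiver (Q, I), conditions (S1)-(S4).\<close>
definition gentle :: "'v set \<Rightarrow> 'a set \<Rightarrow> ('a \<Rightarrow> 'v) \<Rightarrow> ('a \<Rightarrow> 'v) \<Rightarrow>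
    (('v, 'a) path \<Rightarrow> 'k::field) set \<Rightarrow> bool" where
  "gentle V Arr s t I = (quiver V Arr s t \<and> admissible V Arr s t I \<and>
     (\<forall>v\<in>V. card {a\<in>Arr. s a = v} \<le> 2 \<and> card {a\<in>Arr. t a = v} \<le> 2) \<and>
     (\<forall>\<alpha>\<in>Arr. card {\<beta>\<in>Arr. s \<beta> = t \<alpha> \<and> pelem (s \<alpha>, [\<alpha>, \<beta>]) \<notin> I} \<le> 1 \<and>
              card {\<gamma>\<in>Arr. t \<gamma> = s \<alpha> \<and> pelem (s \<gamma>, [\<gamma>, \<alpha>]) \<notin> I} \<le> 1) \<and>
     (\<exists>P. (\<forall>p\<in>P. valid_path V Arr s t p \<and> length (snd p) = 2) \<and>
          I = ideal_gen (path_alg V Arr s t) (pelem ` P)) \<and>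
     (\<forall>\<alpha>\<in>Arr. card {\<delta>\<in>Arr. s \<delta> = t \<alpha> \<and> pelem (s \<alpha>, [\<alpha>, \<delta>]) \<in> I} \<le> 1 \<and>
              card {\<epsilon>\<in>Arr. t \<epsilon> = s \<alpha> \<and> pelem (s \<epsilon>, [\<epsilon>, \<alpha>]) \<in> I} \<le> 1))"

section \<open>The graph \<Gamma>_A (as a ribbon graph: germs with vertex, edge and cyclic successor)\<close>

definition maxpath :: "'v set \<Rightarrow> 'a set \<Rightarrow> ('a \<Rightarrow> 'v) \<Rightarrow> ('a \<Rightarrow> 'v) \<Rightarrow>
    (('v, 'a) path \<Rightarrow> 'k::field) set \<Rightarrow> ('v, 'a) path \<Rightarrow> bool" where
  "maxpath V Arr s t I p = (valid_path V Arr s t p \<and> snd p \<noteq> [] \<and> pelem p \<notin> I \<and>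
     (\<forall>a\<in>Arr. t a = fst p \<longrightarrow> pelem (s a, a # snd p) \<in> I) \<and>
     (\<forall>a\<in>Arr. s a = pend t p \<longrightarrow> pelem (fst p, snd p @ [a]) \<in> I))"

definition Mbar :: "'v set \<Rightarrow> 'a set \<Rightarrow> ('a \<Rightarrow> 'v) \<Rightarrow> ('a \<Rightarrow> 'v) \<Rightarrow>
    (('v, 'a) path \<Rightarrow> 'k::field) set \<Rightarrow> ('v, 'a) path set" where
  "Mbar V Arr s t I = {p. maxpath V Arr s t I p} \<union>
     {(i, []) | i. i \<in> V \<and>
        (({a\<in>Arr. s a = i} = {} \<and> card {a\<in>Arr. t a = i} = 1) \<or>
         ({a\<in>Arr. t a = i} = {} \<and> card {a\<in>Arr. s a = i} = 1) \<or>
         (\<exists>\<alpha> \<beta>. {a\<in>Arr. t a = i} = {\<alpha>} \<and> {a\<in>Arr. s a = i} = {\<beta>} \<and>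
                 pelem (s \<alpha>, [\<alpha>, \<beta>]) \<notin> I))}"

text \<open>Vertices i_1, ..., i_{n+1} visited by a path.\<close>
definition pverts :: "('a \<Rightarrow> 'v) \<Rightarrow> ('v, 'a) path \<Rightarrow> 'v list" where
  "pverts t p = fst p # map t (snd p)"

text \<open>Germs of \<Gamma>_A: (m, j) is the j-th position on m \<in> Mbar; its vertex is \<nu>(m) (= m),
  its edge is E_{i_j} (labelled by the vertex i_j of Q), and its successor in the
  cyclic order around \<nu>(m) is the next position, closed up cyclically.\<close>
definition gammaH :: "'v set \<Rightarrow> 'a set \<Rightarrow> ('a \<Rightarrow> 'v) \<Rightarrow> ('a \<Rightarrow> 'v) \<Rightarrow>
    (('v, 'a) path \<Rightarrow> 'k::field) set \<Rightarrow> (('v, 'a) path \<times> nat) set" where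
  "gammaH V Arr s t I = {(m, j). m \<in> Mbar V Arr s t I \<and> j \<le> length (snd m)}"

definition gammaE :: "('a \<Rightarrow> 'v) \<Rightarrow> ('v, 'a) path \<times> nat \<Rightarrow> 'v" where
  "gammaE t h = pverts t (fst h) ! snd h"

definition gammaS :: "('v, 'a) path \<times> nat \<Rightarrow> ('v, 'a) path \<times> nat" where
  "gammaS h = (fst h, Suc (snd h) mod Suc (length (snd (fst h))))"

section \<open>Brauer graph algebras (Brauer graph given by germs H, vertex map, edge map,
  cyclic successor, multiplicity)\<close>

definition valency :: "'h set \<Rightarrow> ('h \<Rightarrow> 'n) \<Rightarrow> 'n \<Rightarrow> nat" where
  "valency H vert \<nu> = card {g\<in>H. vert g = \<nu>}"

definition leaf1 :: "'h set \<Rightarrow> ('h \<Rightarrow> 'n) \<Rightarrow> ('n \<Rightarrow> nat) \<Rightarrow> 'n \<Rightarrow> bool" where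
  "leaf1 H vert mu \<nu> = (valency H vert \<nu> = 1 \<and> mu \<nu> = 1)"

text \<open>Arrows: one per germ h (from edge h to the edge of succ h), except at leaves of multiplicity one.\<close>
definition brauer_arrows :: "'h set \<Rightarrow> ('h \<Rightarrow> 'n) \<Rightarrow> ('n \<Rightarrow> nat) \<Rightarrow> 'h set" where
  "brauer_arrows H vert mu = {h\<in>H. \<not> leaf1 H vert mu (vert h)}"

text \<open>The cycle C_{vert h, edge h} as the list of its arrows, starting with h.\<close>
definition bcyc :: "'h set \<Rightarrow> ('h \<Rightarrow> 'n) \<Rightarrow> ('h \<Rightarrow> 'h) \<Rightarrow> 'h \<Rightarrow> 'h list" where
  "bcyc H vert succ h = map (\<lambda>j. (succ ^^ j) h) [0..<valency H vert (vert h)]"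

definition brauer_pathalg :: "'e set \<Rightarrow> 'h set \<Rightarrow> ('h \<Rightarrow> 'n) \<Rightarrow> ('h \<Rightarrow> 'e) \<Rightarrow> ('h \<Rightarrow> 'h) \<Rightarrow>
    ('n \<Rightarrow> nat) \<Rightarrow> ((('e, 'h) path \<Rightarrow> 'k::field), 'k) kalg" where
  "brauer_pathalg E H vert edge succ mu =
     path_alg E (brauer_arrows H vert mu) edge (\<lambda>h. edge (succ h))"

definition brauer_rels :: "'e set \<Rightarrow> 'h set \<Rightarrow> ('h \<Rightarrow> 'n) \<Rightarrow> ('h \<Rightarrow> 'e) \<Rightarrow> ('h \<Rightarrow> 'h) \<Rightarrow>
    ('n \<Rightarrow> nat) \<Rightarrow> (('e, 'h) path \<Rightarrow> 'k::field) set" where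
  "brauer_rels E H vert edge succ mu =
     (let P = (brauer_pathalg E H vert edge succ mu :: ((('e, 'h) path \<Rightarrow> 'k), 'k) kalg);
          BA = brauer_arrows H vert mu;
          Cp = (\<lambda>h. concat (replicate (mu (vert h)) (bcyc H vert succ h))) in
       {aadd P (pelem (edge h, Cp h)) (asmul P (-1) (pelem (edge h', Cp h'))) | h h'.
          h \<in> H \<and> h' \<in> H \<and> h \<noteq> h' \<and> edge h = edge h' \<and>
          \<not> leaf1 H vert mu (vert h) \<and> \<not> leaf1 H vert mu (vert h')}
       \<union> {pelem (edge h', bcyc H vert succ h' @ [h']) | h h'.
          h \<in> H \<and> h' \<in> H \<and> h \<noteq> h' \<and> edge h = edge h' \<and>
          leaf1 H vert mu (vert h) \<and> \<not> leaf1 H vert mu (vert h')}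
       \<union> {pelem (edge h, [h, g]) | h g.
          h \<in> BA \<and> g \<in> BA \<and> edge (succ h) = edge g \<and> g \<noteq> succ h})"

definition brauer_ideal :: "'e set \<Rightarrow> 'h set \<Rightarrow> ('h \<Rightarrow> 'n) \<Rightarrow> ('h \<Rightarrow> 'e) \<Rightarrow> ('h \<Rightarrow> 'h) \<Rightarrow>
    ('n \<Rightarrow> nat) \<Rightarrow> (('e, 'h) path \<Rightarrow> 'k::field) set" where
  "brauer_ideal E H vert edge succ mu =
     ideal_gen (brauer_pathalg E H vert edge succ mu) (brauer_rels E H vert edge succ mu)"

definition brauer_alg :: "'e set \<Rightarrow> 'h set \<Rightarrow> ('h \<Rightarrow> 'n) \<Rightarrow> ('h \<Rightarrow> 'e) \<Rightarrow> ('h \<Rightarrow> 'h) \<Rightarrow>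
    ('n \<Rightarrow> nat) \<Rightarrow> ((('e, 'h) path \<Rightarrow> 'k::field) set, 'k) kalg" where
  "brauer_alg E H vert edge succ mu =
     quot_alg (brauer_pathalg E H vert edge succ mu) (brauer_ideal E H vert edge succ mu)"

section \<open>The graph G_\<Lambda> of a symmetric special biserial algebra \<Lambda> = kQ/I\<close>

definition maxfrom :: "'v set \<Rightarrow> 'a set \<Rightarrow> ('a \<Rightarrow> 'v) \<Rightarrow> ('a \<Rightarrow> 'v) \<Rightarrow>
    (('v, 'a) path \<Rightarrow> 'k::field) set \<Rightarrow> 'v \<Rightarrow> ('v, 'a) path set" where
  "maxfrom V Arr s t I i = {p. valid_path V Arr s t p \<and> fst p = i \<and> snd p \<noteq> [] \<and>
     pelem p \<notin> I \<and> (\<forall>a\<in>Arr. s a = pend t p \<longrightarrow> pelem (fst p, snd p @ [a]) \<in> I)}"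

text \<open>The two maximal cyclic paths at i (p and q, or p and e_i if P_i is uniserial).\<close>
definition cpaths :: "'v set \<Rightarrow> 'a set \<Rightarrow> ('a \<Rightarrow> 'v) \<Rightarrow> ('a \<Rightarrow> 'v) \<Rightarrow>
    (('v, 'a) path \<Rightarrow> 'k::field) set \<Rightarrow> 'v \<Rightarrow> ('v, 'a) path set" where
  "cpaths V Arr s t I i = (if card (maxfrom V Arr s t I i) = 1
      then insert (i, []) (maxfrom V Arr s t I i) else maxfrom V Arr s t I i)"

text \<open>Rotation of a cyclic path by one arrow.\<close>
fun rotp :: "('a \<Rightarrow> 'v) \<Rightarrow> ('v, 'a) path \<Rightarrow> ('v, 'a) path" where
  "rotp t (v, []) = (v, [])"
| "rotp t (v, a # xs) = (t a, xs @ [a])"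

definition rotclass :: "('a \<Rightarrow> 'v) \<Rightarrow> ('v, 'a) path \<Rightarrow> ('v, 'a) path set" where
  "rotclass t p = range (\<lambda>j. (rotp t ^^ j) p)"

text \<open>Germs of G_\<Lambda>: (i, p) with p one of the two maximal cyclic paths at i; the vertex
  is the rotation class of p, the edge is labelled i, the cyclic successor is the germ
  at the next vertex on p.\<close>
definition GH :: "'v set \<Rightarrow> 'a set \<Rightarrow> ('a \<Rightarrow> 'v) \<Rightarrow> ('a \<Rightarrow> 'v) \<Rightarrow>
    (('v, 'a) path \<Rightarrow> 'k::field) set \<Rightarrow> ('v \<times> ('v, 'a) path) set" where
  "GH V Arr s t I = {(i, p). i \<in> V \<and> p \<in> cpaths V Arr s t I i}"

definition Gvert :: "('a \<Rightarrow> 'v) \<Rightarrow> 'v \<times> ('v, 'a) path \<Rightarrow> ('v, 'a) path set" where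
  "Gvert t g = rotclass t (snd g)"

definition Gsucc :: "('a \<Rightarrow> 'v) \<Rightarrow> 'v \<times> ('v, 'a) path \<Rightarrow> 'v \<times> ('v, 'a) path" where
  "Gsucc t g = (fst (rotp t (snd g)), rotp t (snd g))"

text \<open>Multiplicity m of a vertex: p = p_0^m with p_0 primitive (m = 1 for a trivial path).\<close>
definition Gmult :: "('v, 'a) path set \<Rightarrow> nat" where
  "Gmult \<nu> = (if \<exists>p\<in>\<nu>. snd p = [] then 1
     else GREATEST m. \<exists>p\<in>\<nu>. \<exists>q. q \<noteq> [] \<and> snd p = concat (replicate m q))"

section \<open>Isomorphism of Brauer graphs (germ bijection respecting edge labels, vertices,
  cyclic orderings and multiplicities)\<close>

definition ribbon_iso ::
  "'h1 set \<Rightarrow> ('h1 \<Rightarrow> 'n1) \<Rightarrow> ('h1 \<Rightarrow> 'e) \<Rightarrow> ('h1 \<Rightarrow> 'h1) \<Rightarrow> ('n1 \<Rightarrow> nat) \<Rightarrow>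
   'h2 set \<Rightarrow> ('h2 \<Rightarrow> 'n2) \<Rightarrow> ('h2 \<Rightarrow> 'e) \<Rightarrow> ('h2 \<Rightarrow> 'h2) \<Rightarrow> ('n2 \<Rightarrow> nat) \<Rightarrow> bool" where
  "ribbon_iso H1 vert1 edge1 succ1 mu1 H2 vert2 edge2 succ2 mu2 =
     (\<exists>\<phi>. bij_betw \<phi> H1 H2 \<and>
        (\<forall>h\<in>H1. edge2 (\<phi> h) = edge1 h \<and> \<phi> (succ1 h) = succ2 (\<phi> h) \<and>
                 mu2 (vert2 (\<phi> h)) = mu1 (vert1 h) \<and>
                 (\<forall>h'\<in>H1. vert1 h = vert1 h' \<longleftrightarrow> vert2 (\<phi> h) = vert2 (\<phi> h'))))"

end

theory Submission
  imports Defs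
begin

text \<open>
  The paths of \<open>Q\<close> outside \<open>I\<close> form a basis of \<open>A\<close>; together with the dual basis they form a
  basis of \<open>T(A)\<close> on which the product of two elements is again a basis element or zero. In the
  Brauer graph algebra, the germ \<open>(m, j)\<close> is an arrow: for \<open>j\<close> below the length of \<open>m\<close> it is sent to
  the \<open>j\<close>-th arrow of \<open>m\<close>, and the last germ, which closes \<open>m\<close> up to a cycle, is sent to \<open>m\<^sup>*\<close>.
  A subpath of the cycle of \<open>m\<close> through the closing arrow is then of the form \<open>p m\<^sup>* q = z\<^sup>*\<close> with
  \<open>m = q z p\<close>, and full turns at a vertex \<open>i\<close> give \<open>e\<^sub>i\<^sup>*\<close>, whichever of the maximal paths through
  \<open>i\<close> is used. Hence the Brauer relations hold, and a path not killed by them is determined by its value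
  up to exchanging the full turns at a vertex, so that the kernel is exactly the Brauer ideal.
  The same normal form shows that the maximal cyclic paths at \<open>i\<close> are the full turns.
\<close>

section \<open>Path algebras and their quotients\<close>

text \<open>Both algebras are compared with \<open>TX\<close>, whose structure constants are the
  partial composition \<open>M\<close> on two copies of the good paths. A zero product is modelled
  by the absence of a value, so \<open>M\<close> and \<open>ev\<close> are relations and no zero is
  adjoined to the basis. The kernel of \<open>\<psi>\<close> is found not by counting dimensions but
  by shrinking the support of an element. Two facts suffice for this: a path without value lies in
  the Brauer ideal, and two paths of equal value differ by an element of it. The obstacle is the
  full turn. The commutativity relation exists only where two nontrivial germs share an edge, and
  the relation that kills a full turn followed by its first arrow only at an edge with a leaf. Which
  one is available is decided by \<open>trivial_Mbar_iff_unique_germ\<close>: the leaf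
  \<open>(i, [])\<close> is present exactly when a single nontrivial germ lies over
  \<open>i\<close>. The same dichotomy governs the uniserial case in \<open>cpaths\<close>. The
  existence of an arrow excludes the quiver with one vertex and no arrows, where the germ set of
  \<Gamma> is empty while \<open>T(A)\<close> has dimension two.\<close>

lemma kalg_iso_trans:
  assumes "kalg_iso A B" "kalg_iso B C"
  shows "kalg_iso A C"
proof -
  obtain f where f: "bij_betw f (acarrier A) (acarrier B)" "f (aone A) = aone B"
    "\<forall>x\<in>acarrier A. \<forall>y\<in>acarrier A. f (aadd A x y) = aadd B (f x) (f y) \<and> f (amul A x y) = amul B (f x) (f y)"
    "\<forall>c. \<forall>x\<in>acarrier A. f (asmul A c x) = asmul B c (f x)"
    using assms(1) unfolding kalg_iso_def by blast
  obtain g where g: "bij_betw g (acarrier B) (acarrier C)" "g (aone B) = aone C"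
    "\<forall>x\<in>acarrier B. \<forall>y\<in>acarrier B. g (aadd B x y) = aadd C (g x) (g y) \<and> g (amul B x y) = amul C (g x) (g y)"
    "\<forall>c. \<forall>x\<in>acarrier B. g (asmul B c x) = asmul C c (g x)"
    using assms(2) unfolding kalg_iso_def by blast
  have m: "f x \<in> acarrier B" if "x \<in> acarrier A" for x
    using f(1) that by (auto simp: bij_betw_def)
  show ?thesis
    unfolding kalg_iso_def
  proof (intro exI[of _ "g \<circ> f"] conjI ballI allI)
    show "bij_betw (g \<circ> f) (acarrier A) (acarrier C)"
      using bij_betw_trans[OF f(1) g(1)] .
  qed (simp_all add: f(2-) g(2-) m)
qed

text \<open>The homomorphism theorem, read from \<open>R\<close> to the quotient: an element goes to
  its fibre under \<open>\<psi>\<close>. By \<open>ker\<close> the coset of \<open>x\<close> is the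
  fibre through \<open>\<psi> x\<close>, so operations computed on the representatives chosen by
  \<open>qrep\<close> end in the right fibre.\<close>

lemma kalg_iso_quot_kernel:
  fixes P :: "('e, 'k::field) kalg" and R :: "('f, 'k) kalg"
  assumes onto: "\<psi> ` acarrier P = acarrier R"
    and closed: "aone P \<in> acarrier P"
      "\<And>x y. x \<in> acarrier P \<Longrightarrow> y \<in> acarrier P \<Longrightarrow> aadd P x y \<in> acarrier P"
      "\<And>x y. x \<in> acarrier P \<Longrightarrow> y \<in> acarrier P \<Longrightarrow> amul P x y \<in> acarrier P"
      "\<And>c x. x \<in> acarrier P \<Longrightarrow> asmul P c x \<in> acarrier P"
    and one: "\<psi> (aone P) = aone R"
    and add: "\<And>x y. x \<in> acarrier P \<Longrightarrow> y \<in> acarrier P \<Longrightarrow> \<psi> (aadd P x y) = aadd R (\<psi> x) (\<psi> y)"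
    and mul: "\<And>x y. x \<in> acarrier P \<Longrightarrow> y \<in> acarrier P \<Longrightarrow> \<psi> (amul P x y) = amul R (\<psi> x) (\<psi> y)"
    and smul: "\<And>c x. x \<in> acarrier P \<Longrightarrow> \<psi> (asmul P c x) = asmul R c (\<psi> x)"
    and ker: "\<And>x y. x \<in> acarrier P \<Longrightarrow> y \<in> acarrier P \<Longrightarrow>
                aadd P y (asmul P (-1) x) \<in> J \<longleftrightarrow> \<psi> y = \<psi> x"
  shows "kalg_iso R (quot_alg P J)"
proof -
  define F where "F \<xi> = {y \<in> acarrier P. \<psi> y = \<xi>}" for \<xi>
  have cls: "qcls P J x = F (\<psi> x)" if "x \<in> acarrier P" for x
    using ker[OF that] by (auto simp: qcls_def F_def)
  have rep: "qrep (F \<xi>) \<in> acarrier P \<and> \<psi> (qrep (F \<xi>)) = \<xi>" if "\<xi> \<in> acarrier R" for \<xi>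
  proof -
    have "\<xi> \<in> \<psi> ` acarrier P" using onto that by simp
    then obtain x where "x \<in> F \<xi>" by (auto simp: F_def)
    then have "qrep (F \<xi>) \<in> F \<xi>" unfolding qrep_def by (rule someI)
    then show ?thesis by (simp add: F_def)
  qed
  have "inj_on F (acarrier R)"
    by (intro inj_onI) (metis rep)
  moreover have "F ` acarrier R = acarrier (quot_alg P J)"
    by (simp add: quot_alg_def onto[symmetric] image_image cls)
  ultimately have "bij_betw F (acarrier R) (acarrier (quot_alg P J))"
    by (simp add: bij_betw_def)
  then show ?thesis
    unfolding kalg_iso_def
    by (intro exI[of _ F] conjI ballI allI) (simp_all add: quot_alg_def cls closed one add mul smul rep)
qed

text \<open>A relation between three paths, because it is read in two directions: as the product of
  \<open>p\<close> and \<open>q\<close>, and as a factorisation of a given \<open>r\<close>. The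
  second reading describes the action of paths on dual basis elements.\<close>

definition pcomp :: "('a \<Rightarrow> 'v) \<Rightarrow> ('v, 'a) path \<Rightarrow> ('v, 'a) path \<Rightarrow> ('v, 'a) path \<Rightarrow> bool" where
  "pcomp t p q r \<longleftrightarrow> pend t p = fst q \<and> (fst p, snd p @ snd q) = r"

lemma pend_simps [simp]:
  "pend t (v, []) = v"
  "pend t (v, a # xs) = pend t (t a, xs)"
  "pend t (v, xs @ ys) = pend t (pend t (v, xs), ys)"
  by (auto simp: pend_def)

lemma pcomp_Pair [simp]:
  "pcomp t (u, xs) (v, ys) (w, zs) \<longleftrightarrow> pend t (u, xs) = v \<and> w = u \<and> zs = xs @ ys"
  by (auto simp: pcomp_def)

section \<open>Valid paths and the path algebra of a finite quiver\<close>

locale fin_quiver =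
  fixes V :: "'v set" and Arr :: "'a set" and s t :: "'a \<Rightarrow> 'v"
  assumes quiv: "quiver V Arr s t"
begin

abbreviation valid :: "('v, 'a) path \<Rightarrow> bool" where
  "valid \<equiv> valid_path V Arr s t"

abbreviation kQ :: "((('v, 'a) path \<Rightarrow> 'k::field), 'k) kalg" where
  "kQ \<equiv> path_alg V Arr s t"

lemma valid_Nil [simp]: "valid (v, []) \<longleftrightarrow> v \<in> V"
  by (simp add: valid_path_def)

lemma valid_Cons [simp]:
  "valid (v, a # xs) \<longleftrightarrow> v = s a \<and> a \<in> Arr \<and> valid (t a, xs)"
proof -
  have "(\<forall>j. Suc j < length (a # xs) \<longrightarrow> t ((a # xs) ! j) = s ((a # xs) ! Suc j)) \<longleftrightarrow>
     (xs \<noteq> [] \<longrightarrow> s (hd xs) = t a) \<and> (\<forall>j. Suc j < length xs \<longrightarrow> t (xs ! j) = s (xs ! Suc j))"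
    by (cases xs) (auto simp: All_less_Suc2 nth_Cons split: nat.split)
  then show ?thesis
    using quiv unfolding valid_path_def quiver_def by auto
qed

lemma valid_start: "valid (v, xs) \<Longrightarrow> v \<in> V"
  by (simp add: valid_path_def)

lemma valid_append [simp]:
  "valid (v, xs @ ys) \<longleftrightarrow> valid (v, xs) \<and> valid (pend t (v, xs), ys)"
  using quiv by (induction xs arbitrary: v) (auto dest: valid_start)

lemma valid_pcomp: "pcomp t p q r \<Longrightarrow> valid r \<longleftrightarrow> valid p \<and> valid q"
  by (cases p; cases q; cases r) auto

lemma carrier_iff:
  "x \<in> acarrier kQ \<longleftrightarrow> finite {p. x p \<noteq> 0} \<and> (\<forall>p. x p \<noteq> 0 \<longrightarrow> valid p)"
  by (simp add: path_alg_def)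

lemma carrier_valid: "x \<in> acarrier kQ \<Longrightarrow> x p \<noteq> 0 \<Longrightarrow> valid p"
  unfolding carrier_iff by blast

lemma amul_kQ:
  "amul kQ x y r = (\<Sum>(p, q) \<in> {(p, q). x p \<noteq> 0 \<and> y q \<noteq> 0 \<and> pcomp t p q r}. x p * y q)"
  by (simp add: path_alg_def pcomp_def)

lemma aadd_kQ [simp]: "aadd kQ x y = (\<lambda>p. x p + y p)"
  and asmul_kQ [simp]: "asmul kQ c x = (\<lambda>p. c * x p)"
  and azero_kQ [simp]: "azero kQ = (\<lambda>_. 0)"
  and aone_kQ: "aone kQ = (\<lambda>p. if snd p = [] \<and> fst p \<in> V then 1 else 0)"
  by (simp_all add: path_alg_def)

text \<open>Pairs outside the support of the product contribute zero. The summation range can thus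
  be chosen freely, for instance as a product of good paths that does not depend on the
  factors.\<close>

lemma amul_sum_superset:
  assumes "finite S" "\<And>p q. x p \<noteq> 0 \<Longrightarrow> y q \<noteq> 0 \<Longrightarrow> pcomp t p q r \<Longrightarrow> (p, q) \<in> S"
  shows "amul kQ x y r = (\<Sum>(p, q) \<in> S. if pcomp t p q r then x p * y q else 0)"
proof -
  have "(\<Sum>(p, q) \<in> S. if pcomp t p q r then x p * y q else 0) =
        (\<Sum>(p, q) \<in> {(p, q). x p \<noteq> 0 \<and> y q \<noteq> 0 \<and> pcomp t p q r}. if pcomp t p q r then x p * y q else 0)"
    using assms by (intro sum.mono_neutral_right) (auto split: if_splits)
  also have "\<dots> = amul kQ x y r"
    unfolding amul_kQ by (intro sum.cong) auto
  finally show ?thesis by simp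
qed

lemma zero_carrier: "(\<lambda>_. 0) \<in> acarrier kQ"
  and add_carrier: "x \<in> acarrier kQ \<Longrightarrow> y \<in> acarrier kQ \<Longrightarrow> (\<lambda>p. x p + y p) \<in> acarrier kQ"
  and smul_carrier: "x \<in> acarrier kQ \<Longrightarrow> (\<lambda>p. c * x p) \<in> acarrier kQ"
proof -
  show "(\<lambda>_. 0) \<in> acarrier kQ" by (simp add: carrier_iff)
  show "(\<lambda>p. x p + y p) \<in> acarrier kQ" if "x \<in> acarrier kQ" "y \<in> acarrier kQ"
  proof -
    have "{p. x p + y p \<noteq> 0} \<subseteq> {p. x p \<noteq> 0} \<union> {p. y p \<noteq> 0}" by auto
    then show ?thesis using that unfolding carrier_iff by (auto intro: finite_subset)
  qed
  show "(\<lambda>p. c * x p) \<in> acarrier kQ" if "x \<in> acarrier kQ"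
    using that unfolding carrier_iff by (auto elim: rev_finite_subset)
qed

lemma one_carrier: "aone kQ \<in> acarrier kQ"
proof -
  have "finite (V \<times> {[] :: 'a list})"
    using quiv by (simp add: quiver_def)
  then show ?thesis
    unfolding carrier_iff by (auto simp: aone_kQ elim!: rev_finite_subset)
qed

lemma mul_nonzeroE:
  assumes "amul kQ x y r \<noteq> 0"
  obtains p q where "x p \<noteq> 0" "y q \<noteq> 0" "pcomp t p q r"
proof -
  have "{(p, q). x p \<noteq> 0 \<and> y q \<noteq> 0 \<and> pcomp t p q r} \<noteq> {}"
    using assms unfolding amul_kQ by (intro notI) simp
  then show thesis using that by auto
qed

lemma mul_carrier:
  assumes x: "x \<in> acarrier kQ" and y: "y \<in> acarrier kQ"
  shows "amul kQ x y \<in> acarrier kQ"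
proof -
  have "{r. amul kQ x y r \<noteq> 0} \<subseteq> (\<lambda>(p, q). (fst p, snd p @ snd q)) ` ({p. x p \<noteq> 0} \<times> {q. y q \<noteq> 0})"
  proof
    fix r assume "r \<in> {r. amul kQ x y r \<noteq> 0}"
    then obtain p q where "x p \<noteq> 0" "y q \<noteq> 0" "pcomp t p q r"
      by (auto elim: mul_nonzeroE)
    then show "r \<in> (\<lambda>(p, q). (fst p, snd p @ snd q)) ` ({p. x p \<noteq> 0} \<times> {q. y q \<noteq> 0})"
      by (force simp: pcomp_def)
  qed
  then have "finite {r. amul kQ x y r \<noteq> 0}"
    using x y unfolding carrier_iff by (auto elim: finite_subset)
  moreover have "valid r" if "amul kQ x y r \<noteq> 0" for r
    using that x y unfolding carrier_iff by (auto elim!: mul_nonzeroE simp: valid_pcomp)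
  ultimately show ?thesis unfolding carrier_iff by blast
qed

lemma pelem_carrier: "valid p \<Longrightarrow> pelem p \<in> acarrier kQ"
  by (simp add: carrier_iff pelem_def)

lemma pelem_mul:
  assumes "pcomp t p q r"
  shows "amul kQ (pelem p) (pelem q) = pelem r"
proof
  fix r'
  have "amul kQ (pelem p) (pelem q) r' =
      (\<Sum>(p', q') \<in> {(p, q)}. if pcomp t p' q' r' then pelem p p' * pelem q q' else 0)"
    by (intro amul_sum_superset) (auto simp: pelem_def split: if_splits)
  then show "amul kQ (pelem p) (pelem q) r' = pelem r r'"
    using assms by (auto simp: pelem_def pcomp_def)
qed

section \<open>Ideals of a path algebra\<close>

lemma ideal_pcomp:
  assumes J: "is_ideal kQ J" and "pcomp t p q r" "valid r" "pelem p \<in> J \<or> pelem q \<in> J"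
  shows "pelem r \<in> J"
proof -
  have "pelem p \<in> acarrier kQ" "pelem q \<in> acarrier kQ"
    using assms valid_pcomp pelem_carrier by blast+
  then show ?thesis
    using J assms(4) unfolding pelem_mul[OF assms(2), symmetric] is_ideal_def by blast
qed

lemma ideal_contains_supported:
  fixes x :: "('v, 'a) path \<Rightarrow> 'k::field"
  assumes J: "is_ideal kQ J" and fin: "finite {p. x p \<noteq> 0}"
    and supp: "\<And>p. x p \<noteq> 0 \<Longrightarrow> pelem p \<in> J"
  shows "x \<in> J"
proof -
  have "(\<lambda>p. if p \<in> F then x p else 0) \<in> J" if "finite F" "F \<subseteq> {p. x p \<noteq> 0}" for F
    using that
  proof (induction F rule: finite_induct)
    case empty
    then show ?case using J by (simp add: is_ideal_def)
  next
    case (insert p F)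
    have "(\<lambda>q. x p * pelem p q) \<in> J"
      using J supp insert.prems unfolding is_ideal_def by auto
    moreover have "(\<lambda>p. if p \<in> F then x p else 0) \<in> J" using insert by simp
    ultimately have "(\<lambda>q. x p * pelem p q + (if q \<in> F then x q else 0)) \<in> J"
      using J unfolding is_ideal_def by auto
    moreover have "(\<lambda>q. x p * pelem p q + (if q \<in> F then x q else 0)) =
       (\<lambda>q. if q \<in> insert p F then x q else 0)"
      using insert by (auto simp: pelem_def fun_eq_iff)
    ultimately show ?case by simp
  qed
  from this[OF fin] have "(\<lambda>p. if x p \<noteq> 0 then x p else 0) \<in> J" by simp
  moreover have "(\<lambda>p. if x p \<noteq> 0 then x p else 0) = x" by auto
  ultimately show ?thesis by simp
qed

lemma ideal_add:
  assumes "is_ideal kQ J" "x \<in> J" "y \<in> J"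
  shows "(\<lambda>p. x p + y p) \<in> J"
proof -
  have "aadd kQ x y \<in> J" using assms unfolding is_ideal_def by blast
  then show ?thesis by simp
qed

lemma ideal_smul:
  assumes "is_ideal kQ J" "x \<in> J"
  shows "(\<lambda>p. c * x p) \<in> J"
proof -
  have "asmul kQ c x \<in> J" using assms unfolding is_ideal_def by blast
  then show ?thesis by simp
qed

lemma ideal_mul_right: "is_ideal kQ J \<Longrightarrow> x \<in> J \<Longrightarrow> a \<in> acarrier kQ \<Longrightarrow> amul kQ x a \<in> J"
  unfolding is_ideal_def by blast

text \<open>\<open>ideal_gen\<close> intersects all ideals that contain \<open>S\<close>. The
  assumption makes the whole carrier one of them, which keeps the intersection inside the
  carrier.\<close>

lemma is_ideal_gen:
  assumes "S \<subseteq> acarrier kQ"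
  shows "is_ideal kQ (ideal_gen kQ S)"
proof -
  have "is_ideal kQ (acarrier kQ)"
    unfolding is_ideal_def by (simp add: zero_carrier add_carrier smul_carrier mul_carrier)
  then have sub: "ideal_gen kQ S \<subseteq> acarrier kQ" using assms unfolding ideal_gen_def by blast
  show ?thesis
    unfolding is_ideal_def
  proof (intro conjI ballI allI sub)
    show "azero kQ \<in> ideal_gen kQ S" unfolding ideal_gen_def is_ideal_def by blast
    show "aadd kQ x y \<in> ideal_gen kQ S" if "x \<in> ideal_gen kQ S" "y \<in> ideal_gen kQ S" for x y
      using that unfolding ideal_gen_def is_ideal_def by blast
    show "asmul kQ c x \<in> ideal_gen kQ S" if "x \<in> ideal_gen kQ S" for x c
      using that unfolding ideal_gen_def is_ideal_def by blast
    show "amul kQ a x \<in> ideal_gen kQ S" "amul kQ x a \<in> ideal_gen kQ S"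
      if "a \<in> acarrier kQ" "x \<in> ideal_gen kQ S" for a x
      using that unfolding ideal_gen_def is_ideal_def by blast+
  qed
qed

lemma pelem_diff_mul:
  assumes "pcomp t p c r" "pcomp t p' c r'"
  shows "amul kQ (\<lambda>u. pelem p u + - 1 * pelem p' u) (pelem c) = (\<lambda>u. pelem r u + - 1 * (pelem r' u))"
proof
  fix u
  \<comment> \<open>Right cancellation: if \<open>p = p'\<close>, the two-element index set below
    collapses and both sides vanish together.\<close>
  have rr: "r = r' \<longleftrightarrow> p = p'" using assms by (auto simp: pcomp_def prod_eq_iff dest!: sym[of "_ @ _"])
  have "amul kQ (\<lambda>u. pelem p u + - 1 * pelem p' u) (pelem c) u =
      (\<Sum>(a, b) \<in> {(p, c), (p', c)}. if pcomp t a b u then (pelem p a + - 1 * pelem p' a) * pelem c b else 0)"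
    by (intro amul_sum_superset) (auto simp: pelem_def split: if_splits)
  also have "\<dots> = pelem r u + - 1 * pelem r' u"
    using assms rr by (cases "p = p'") (auto simp: pelem_def pcomp_def)
  finally show "amul kQ (\<lambda>u. pelem p u + - 1 * pelem p' u) (pelem c) u = pelem r u + - 1 * pelem r' u" .
qed

end

section \<open>The trivial extension as a monomial algebra\<close>

text \<open>The algebra with basis \<open>X\<close> in which \<open>\<xi> \<eta> = \<zeta>\<close> if \<open>M \<xi> \<eta> \<zeta>\<close>, and \<open>\<xi> \<eta> = 0\<close> if there is no such \<open>\<zeta>\<close>;
  its unit is the sum of the elements of \<open>U\<close>.\<close>
definition conv_alg :: "'x set \<Rightarrow> 'x set \<Rightarrow> ('x \<Rightarrow> 'x \<Rightarrow> 'x \<Rightarrow> bool) \<Rightarrow> ('x \<Rightarrow> 'k::field, 'k) kalg" where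
  "conv_alg X U M =
     \<lparr> acarrier = {c. \<forall>\<xi>. \<xi> \<notin> X \<longrightarrow> c \<xi> = 0},
       azero = (\<lambda>_. 0),
       aone = (\<lambda>\<xi>. if \<xi> \<in> U then 1 else 0),
       aadd = (\<lambda>c d \<xi>. c \<xi> + d \<xi>),
       amul = (\<lambda>c d \<zeta>. \<Sum>\<xi>\<in>X. \<Sum>\<eta>\<in>X. if M \<xi> \<eta> \<zeta> then c \<xi> * d \<eta> else 0),
       asmul = (\<lambda>a c \<xi>. a * c \<xi>) \<rparr>"

section \<open>Paths outside the ideal of a gentle algebra\<close>

locale gentle_alg = fin_quiver V Arr s t
  for V :: "'v set" and Arr :: "'a set" and s t :: "'a \<Rightarrow> 'v" +
  fixes I :: "(('v, 'a) path \<Rightarrow> 'k::field) set"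
  assumes gent: "gentle V Arr s t I"
begin

text \<open>Holds trivially for arrows that do not compose, since \<open>I\<close> contains only
  combinations of valid paths. Composability is supplied by \<open>valid\<close> in
  \<open>good\<close> and separately in \<open>step\<close>.\<close>

definition nz :: "'a \<Rightarrow> 'a \<Rightarrow> bool" where
  "nz a b \<longleftrightarrow> pelem (s a, [a, b]) \<notin> I"

definition good :: "('v, 'a) path set" where
  "good = {p. valid p \<and> successively nz (snd p)}"

lemma ideal_I: "is_ideal kQ I"
  using gent by (simp add: gentle_def admissible_def)

lemma good_valid: "p \<in> good \<Longrightarrow> valid p"
  by (simp add: good_def)

lemma good_pcomp: "pcomp t p q r \<Longrightarrow> r \<in> good \<Longrightarrow> p \<in> good \<and> q \<in> good"
  by (auto simp: good_def valid_pcomp) (auto simp: pcomp_def successively_append_iff)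

text \<open>Some consecutive pair of arrows lies in \<open>I\<close>, and the path is a multiple of
  it; the induction moves along the path to the first such pair.\<close>

lemma not_good_in_I:
  assumes "valid p" "p \<notin> good"
  shows "pelem p \<in> I"
proof -
  obtain v xs where p: "p = (v, xs)" by (cases p)
  have "\<not> successively nz xs" using assms by (simp add: good_def p)
  then show ?thesis
    using assms(1) unfolding p
  proof (induction xs arbitrary: v rule: induct_list012)
    case (3 a b xs)
    show ?case
    proof (cases "nz a b")
      case True
      then have "pelem (t a, b # xs) \<in> I" using 3 by auto
      then show ?thesis
        using 3 by (intro ideal_pcomp[OF ideal_I, of "(v, [a])" "(t a, b # xs)"]) auto
    next
      case False
      then show ?thesis
        using 3 by (intro ideal_pcomp[OF ideal_I, of "(v, [a, b])" "(t b, xs)"]) (auto simp: nz_def)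
    qed
  qed auto
qed

text \<open>This is where (S3) enters. Factors of a good path are good, so the elements vanishing on
  all good paths form an ideal; it contains the generators of length two. Conversely every path that
  is not good lies in \<open>I\<close>. Hence \<open>I\<close> is monomial and the good paths give a
  basis of the quotient.\<close>

lemma I_eq: "I = {x \<in> acarrier kQ. \<forall>p\<in>good. x p = 0}"
proof
  let ?K = "{x \<in> acarrier kQ. \<forall>p\<in>good. x p = (0::'k)}"
  obtain P where P: "\<forall>p\<in>P. valid p \<and> length (snd p) = 2" "I = ideal_gen kQ (pelem ` P)"
    using gent unfolding gentle_def by blast
  have sub: "pelem ` P \<subseteq> I" unfolding P(2) ideal_gen_def by blast
  have "pelem p \<in> ?K" if p: "p \<in> P" for p
  proof -
    have v: "valid p" "length (snd p) = 2" using P(1) p by auto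
    then obtain a b where ab: "p = (s a, [a, b])"
      by (cases p) (auto simp: length_Suc_conv numeral_2_eq_2)
    have "\<not> nz a b" using sub p by (auto simp: nz_def ab)
    then have "p \<notin> good" by (simp add: good_def ab)
    then show ?thesis using pelem_carrier[OF v(1)] by (auto simp: pelem_def)
  qed
  moreover have "is_ideal kQ ?K"
  proof -
    have "amul kQ a x \<in> ?K \<and> amul kQ x a \<in> ?K" if "a \<in> acarrier kQ" "x \<in> ?K" for a x
    proof -
      have x: "x p = 0" if "p \<in> good" for p using \<open>x \<in> ?K\<close> that by simp
      have "amul kQ a x r = 0" "amul kQ x a r = 0" if "r \<in> good" for r
        using good_pcomp[OF _ that] x by (metis mul_nonzeroE)+
      then show ?thesis using that by (simp add: mul_carrier)
    qed
    then show ?thesis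
      by (simp add: is_ideal_def zero_carrier add_carrier smul_carrier)
  qed
  ultimately show "I \<subseteq> ?K" unfolding P(2) ideal_gen_def by blast
  show "?K \<subseteq> I"
  proof
    fix x assume x: "x \<in> ?K"
    have "finite {p. x p \<noteq> 0}" using x by (simp add: carrier_iff)
    moreover have "pelem p \<in> I" if "x p \<noteq> 0" for p
    proof (rule not_good_in_I)
      show "valid p" using x that by (auto dest: carrier_valid)
      show "p \<notin> good" using x that by auto
    qed
    ultimately show "x \<in> I" by (rule ideal_contains_supported[OF ideal_I])
  qed
qed

lemma in_I_iff: "x \<in> I \<longleftrightarrow> x \<in> acarrier kQ \<and> (\<forall>p\<in>good. x p = 0)"
proof -
  have "x \<in> I \<longleftrightarrow> x \<in> {x \<in> acarrier kQ. \<forall>p\<in>good. x p = 0}" by (rule arg_cong[OF I_eq])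
  then show ?thesis by simp
qed

lemma pelem_in_I_iff: "valid p \<Longrightarrow> pelem p \<in> I \<longleftrightarrow> p \<notin> good"
  by (auto simp: in_I_iff pelem_carrier) (auto simp: pelem_def)

text \<open>Finite dimensionality of \<open>A\<close>: by admissibility all sufficiently long paths
  lie in \<open>I\<close>.\<close>

lemma finite_good: "finite good"
proof -
  obtain N where N: "\<forall>p. valid p \<and> N \<le> length (snd p) \<longrightarrow> pelem p \<in> I"
    using gent unfolding gentle_def admissible_def by blast
  have "good \<subseteq> V \<times> {xs. set xs \<subseteq> Arr \<and> length xs \<le> N}"
  proof
    fix p assume p: "p \<in> good"
    then have v: "valid p" by (rule good_valid)
    moreover have "length (snd p) \<le> N"
      using N v p pelem_in_I_iff[OF v] by (meson le_cases)
    ultimately show "p \<in> V \<times> {xs. set xs \<subseteq> Arr \<and> length xs \<le> N}"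
      by (cases p) (simp add: valid_path_def)
  qed
  moreover have "finite V" "finite Arr" using quiv by (auto simp: quiver_def)
  ultimately show ?thesis 
    by (metis finite_SigmaI finite_lists_length_le finite_subset)
qed

section \<open>Coordinates on the quotient algebra, its dual and the trivial extension\<close>

abbreviation A :: "((('v, 'a) path \<Rightarrow> 'k) set, 'k) kalg" where
  "A \<equiv> quot_alg kQ I"

abbreviation cls :: "(('v, 'a) path \<Rightarrow> 'k) \<Rightarrow> (('v, 'a) path \<Rightarrow> 'k) set" where
  "cls \<equiv> qcls kQ I"

lemma cls_eq: "x \<in> acarrier kQ \<Longrightarrow> cls x = {y \<in> acarrier kQ. \<forall>p\<in>good. y p = x p}"
  using add_carrier[OF _ smul_carrier[of x "-1"]] by (auto simp: qcls_def in_I_iff)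

lemma cls_cong: "x \<in> acarrier kQ \<Longrightarrow> y \<in> acarrier kQ \<Longrightarrow> (\<And>p. p \<in> good \<Longrightarrow> x p = y p) \<Longrightarrow> cls x = cls y"
  by (simp add: cls_eq)

lemma carrier_A: "acarrier A = cls ` acarrier kQ"
  by (simp add: quot_alg_def)

lemma qrep_cls:
  assumes "x \<in> acarrier kQ"
  shows "qrep (cls x) \<in> acarrier kQ" "p \<in> good \<Longrightarrow> qrep (cls x) p = x p"
proof -
  have "x \<in> cls x" using assms by (simp add: cls_eq)
  then have "qrep (cls x) \<in> cls x" unfolding qrep_def by (rule someI[of "\<lambda>y. y \<in> cls x"])
  then show "qrep (cls x) \<in> acarrier kQ" "p \<in> good \<Longrightarrow> qrep (cls x) p = x p"
    using assms by (simp_all add: cls_eq)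
qed

lemma mul_good:
  assumes "x \<in> acarrier kQ" "y \<in> acarrier kQ" "r \<in> good"
  shows "amul kQ x y r = (\<Sum>p\<in>good. \<Sum>q\<in>good. if pcomp t p q r then x p * y q else 0)"
proof -
  have "amul kQ x y r = (\<Sum>(p, q) \<in> good \<times> good. if pcomp t p q r then x p * y q else 0)"
    using finite_good good_pcomp[OF _ assms(3)] by (intro amul_sum_superset) blast+
  then show ?thesis by (simp add: sum.cartesian_product)
qed

lemma A_ops:
  assumes "x \<in> acarrier kQ" "y \<in> acarrier kQ"
  shows "aadd A (cls x) (cls y) = cls (\<lambda>p. x p + y p)"
    and "amul A (cls x) (cls y) = cls (amul kQ x y)"
proof -
  note q = qrep_cls[OF assms(1)] qrep_cls[OF assms(2)]
  show "aadd A (cls x) (cls y) = cls (\<lambda>p. x p + y p)"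
    unfolding quot_alg_def by (simp, rule cls_cong) (simp_all add: add_carrier assms q)
  show "amul A (cls x) (cls y) = cls (amul kQ x y)"
    unfolding quot_alg_def
    by (simp, rule cls_cong) (simp_all add: mul_carrier mul_good assms q cong: sum.cong if_cong)
qed

lemma A_smul: "x \<in> acarrier kQ \<Longrightarrow> asmul A c (cls x) = cls (\<lambda>p. c * x p)"
  unfolding quot_alg_def by (simp, rule cls_cong) (simp_all add: smul_carrier qrep_cls)

text \<open>Linearity over a finite set of good paths, added one at a time. The remaining terms of
  \<open>x\<close> lie in \<open>I\<close> and do not change the class.\<close>

lemma lin_functional_expand:
  assumes f: "lin_functional A f" and x: "x \<in> acarrier kQ"
  shows "f (cls x) = (\<Sum>p\<in>good. x p * f (cls (pelem p)))"
proof -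
  define r where "r F = (\<lambda>p. if p \<in> F then x p else 0)" for F
  have rc: "r F \<in> acarrier kQ" for F
  proof -
    have "{p. r F p \<noteq> 0} \<subseteq> {p. x p \<noteq> 0}" by (auto simp: r_def)
    then show ?thesis using x unfolding carrier_iff by (auto simp: r_def intro: finite_subset)
  qed
  have fadd: "f (cls (\<lambda>p. y p + z p)) = f (cls y) + f (cls z)"
    and fsm: "f (cls (\<lambda>p. c * y p)) = c * f (cls y)"
    if "y \<in> acarrier kQ" "z \<in> acarrier kQ" for y z c
    using f that unfolding lin_functional_def by (auto simp: carrier_A A_ops[symmetric] A_smul[symmetric])
  have "f (cls (r F)) = (\<Sum>p\<in>F. x p * f (cls (pelem p)))" if "finite F" "F \<subseteq> good" for F
    using that
  proof (induction F rule: finite_induct)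
    case empty
    \<comment> \<open>The value at zero is obtained by scaling with the constant 0.\<close>
    then show ?case using fsm[OF rc rc, of 0 "{}"] by (simp add: r_def)
  next
    case (insert p F)
    have pc: "pelem p \<in> acarrier kQ" using insert.prems by (auto intro: pelem_carrier good_valid)
    have "r (insert p F) = (\<lambda>q. x p * pelem p q + r F q)"
      using insert by (auto simp: r_def pelem_def)
    then have "f (cls (r (insert p F))) = x p * f (cls (pelem p)) + f (cls (r F))"
      using fadd[OF smul_carrier[OF pc] rc] fsm[OF pc pc] by simp
    then show ?case using insert by simp
  qed
  then have "f (cls (r good)) = (\<Sum>p\<in>good. x p * f (cls (pelem p)))" using finite_good by blast
  moreover have "cls (r good) = cls x" by (intro cls_cong rc x) (simp add: r_def)
  ultimately show ?thesis by simp
qed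

definition X :: "(('v, 'a) path + ('v, 'a) path) set" where
  "X = good <+> good"

text \<open>\<open>Inr y\<close> stands for the dual basis element of the good path \<open>y\<close>, on which paths act by
  cancelling at the opposite end: \<open>p \<cdot> (z p)\<^sup>* = z\<^sup>*\<close> and \<open>(q z)\<^sup>* \<cdot> q = z\<^sup>*\<close>.\<close>
fun M :: "('v, 'a) path + ('v, 'a) path \<Rightarrow> ('v, 'a) path + ('v, 'a) path \<Rightarrow>
    ('v, 'a) path + ('v, 'a) path \<Rightarrow> bool" where
  "M (Inl p) (Inl q) (Inl r) \<longleftrightarrow> r \<in> good \<and> pcomp t p q r"
| "M (Inl p) (Inr y) (Inr z) \<longleftrightarrow> y \<in> good \<and> pcomp t z p y"
| "M (Inr y) (Inl q) (Inr z) \<longleftrightarrow> y \<in> good \<and> pcomp t q z y"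
| "M _ _ _ \<longleftrightarrow> False"

definition U :: "(('v, 'a) path + ('v, 'a) path) set" where
  "U = {Inl (v, []) | v. v \<in> V}"

abbreviation TX :: "((('v, 'a) path + ('v, 'a) path) \<Rightarrow> 'k, 'k) kalg" where
  "TX \<equiv> conv_alg X U M"

lemma finite_X: "finite X"
  by (simp add: X_def finite_good)

lemma sum_X: "sum g X = (\<Sum>p\<in>good. g (Inl p)) + (\<Sum>p\<in>good. g (Inr p))"
  by (simp add: X_def sum.Plus[OF finite_good finite_good])

lemma TX_mul_Inl:
  assumes "r \<in> good"
  shows "amul TX c d (Inl r) = (\<Sum>p\<in>good. \<Sum>q\<in>good. if pcomp t p q r then c (Inl p) * d (Inl q) else 0)"
  using assms by (simp add: conv_alg_def sum_X)

lemma TX_mul_Inr: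
  assumes "z \<in> good"
  shows "amul TX c d (Inr z) =
    (\<Sum>p\<in>good. \<Sum>y\<in>good. if pcomp t z p y then c (Inl p) * d (Inr y) else 0) +
    (\<Sum>y\<in>good. \<Sum>q\<in>good. if pcomp t q z y then c (Inr y) * d (Inl q) else 0)"
  using assms by (simp add: conv_alg_def sum_X cong: sum.cong if_cong)

lemma sum_delta_pelem:
  assumes "y \<in> good"
  shows "(\<Sum>p\<in>good. if P p then pelem y p * g p else 0) = (if P y then g y else (0::'k))"
    "(\<Sum>p\<in>good. if P p then g p * pelem y p else 0) = (if P y then g y else (0::'k))"
proof -
  have "(\<Sum>p\<in>good. if P p then pelem y p * g p else 0) = (\<Sum>p\<in>good. if p = y then (if P y then g y else 0) else 0)"
    by (intro sum.cong) (auto simp: pelem_def)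
  then show "(\<Sum>p\<in>good. if P p then pelem y p * g p else 0) = (if P y then g y else (0::'k))"
    using assms finite_good by simp
  then show "(\<Sum>p\<in>good. if P p then g p * pelem y p else 0) = (if P y then g y else (0::'k))"
    by (simp only: mult.commute)
qed

text \<open>The coordinate at \<open>Inl p\<close> is the coefficient of the good path
  \<open>p\<close>; the coordinate at \<open>Inr y\<close> is the value of the functional on the
  class of \<open>y\<close>, that is, the coefficient of \<open>y\<^sup>*\<close>. The rule
  \<open>(a g)(z) = g(z a)\<close> collects the pairs with \<open>y = z p\<close>, and
  \<open>(f b)(z) = f(b z)\<close> those with \<open>y = q z\<close>; these are the two mixed
  clauses of \<open>M\<close>.\<close>

lemma triv_ext_iso: "kalg_iso (triv_ext A) TX"
proof -
  define \<Phi> :: "(('v, 'a) path \<Rightarrow> 'k) set \<times> ((('v, 'a) path \<Rightarrow> 'k) set \<Rightarrow> 'k) \<Rightarrow> ('v, 'a) path + ('v, 'a) path \<Rightarrow> 'k"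
    where "\<Phi> = (\<lambda>(C, f) \<xi>. case \<xi> of Inl p \<Rightarrow> if p \<in> good then qrep C p else 0
                 | Inr y \<Rightarrow> if y \<in> good then f (cls (pelem y)) else 0)"
  have \<Phi>I: "\<Phi> (C, f) (Inl p) = (if p \<in> good then qrep C p else 0)"
    "\<Phi> (C, f) (Inr p) = (if p \<in> good then f (cls (pelem p)) else 0)" for C f p
    by (simp_all add: \<Phi>_def)
  have carT: "acarrier (triv_ext A) = {(cls x, f) | x f. x \<in> acarrier kQ \<and> lin_functional A f}"
    by (auto simp: triv_ext_def carrier_A)
  have pc: "pelem p \<in> acarrier kQ" "cls (pelem p) \<in> acarrier A" if "p \<in> good" for p
    using that by (auto simp: carrier_A intro: pelem_carrier good_valid)
  have "inj_on \<Phi> (acarrier (triv_ext A))"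
  proof (rule inj_onI)
    fix a b assume ab: "a \<in> acarrier (triv_ext A)" "b \<in> acarrier (triv_ext A)" "\<Phi> a = \<Phi> b"
    obtain x f where a: "a = (cls x, f)" "x \<in> acarrier kQ" "lin_functional A f"
      using ab(1) unfolding carT by blast
    obtain y g where b: "b = (cls y, g)" "y \<in> acarrier kQ" "lin_functional A g"
      using ab(2) unfolding carT by blast
    have "x p = y p" "f (cls (pelem p)) = g (cls (pelem p))" if "p \<in> good" for p
      using that fun_cong[OF ab(3), of "Inl p"] fun_cong[OF ab(3), of "Inr p"] a b
      by (simp_all add: \<Phi>I qrep_cls)
    note eq = this
    have fg: "f (cls z) = g (cls z)" if "z \<in> acarrier kQ" for z
      by (simp add: lin_functional_expand[OF _ that] a(3) b(3) eq(2) cong: sum.cong)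
    have "f = g"
    proof
      fix C show "f C = g C"
      proof (cases "C \<in> acarrier A")
        case True
        then show ?thesis using fg by (auto simp: carrier_A)
      next
        case False
        then show ?thesis using a(3) b(3) by (simp add: lin_functional_def)
      qed
    qed
    moreover have "cls x = cls y" using a(2) b(2) eq(1) by (rule cls_cong)
    ultimately show "a = b" using a b by simp
  qed
  moreover have "\<Phi> ` acarrier (triv_ext A) = acarrier TX"
  proof (intro equalityI subsetI)
    fix c assume "c \<in> \<Phi> ` acarrier (triv_ext A)"
    then show "c \<in> acarrier TX"
      by (auto simp: conv_alg_def X_def \<Phi>_def split: sum.split)
  next
    fix c assume c: "c \<in> acarrier TX"
    define x where "x p = (if p \<in> good then c (Inl p) else 0)" for p
    \<comment> \<open>The functional with prescribed values on the good paths, set to 0 off the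
      carrier as \<open>lin_functional\<close> requires.\<close>
    define f where "f C = (if C \<in> acarrier A then \<Sum>p\<in>good. qrep C p * c (Inr p) else 0)" for C
    have x: "x \<in> acarrier kQ"
      using finite_good by (auto simp: carrier_iff x_def good_valid)
    have f_cls: "f (cls y) = (\<Sum>p\<in>good. y p * c (Inr p))" if "y \<in> acarrier kQ" for y
      using that by (simp add: f_def carrier_A qrep_cls)
    have "lin_functional A f"
      unfolding lin_functional_def
      by (auto simp: carrier_A A_ops A_smul f_cls add_carrier smul_carrier distrib_right sum.distrib sum_distrib_left mult.assoc)
        (simp add: f_def carrier_A)
    then have "(cls x, f) \<in> acarrier (triv_ext A)" using x by (auto simp: carT)
    moreover have "\<Phi> (cls x, f) \<xi> = c \<xi>" for \<xi>
    proof (cases \<xi>)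
      case (Inl p)
      then show ?thesis using c x by (auto simp: \<Phi>I qrep_cls x_def conv_alg_def X_def)
    next
      case (Inr y)
      then show ?thesis
        using c sum_delta_pelem(1)[of y "\<lambda>_. True" "\<lambda>p. c (Inr p)"]
        by (auto simp: \<Phi>I f_cls pc conv_alg_def X_def)
    qed
    ultimately show "c \<in> \<Phi> ` acarrier (triv_ext A)" by (metis ext image_eqI)
  qed
  ultimately have "bij_betw \<Phi> (acarrier (triv_ext A)) (acarrier TX)" by (simp add: bij_betw_def)
  moreover have "\<Phi> (aone (triv_ext A)) = aone TX"
  proof
    fix \<xi>
    have "(v, []) \<in> good \<longleftrightarrow> v \<in> V" for v by (simp add: good_def)
    then show "\<Phi> (aone (triv_ext A)) \<xi> = aone TX \<xi>"
      using qrep_cls[OF one_carrier]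
      by (cases \<xi>) (auto simp: triv_ext_def \<Phi>I conv_alg_def U_def quot_alg_def aone_kQ split: prod.splits)
  qed
  moreover have "\<Phi> (aadd (triv_ext A) a b) = aadd TX (\<Phi> a) (\<Phi> b) \<and>
      \<Phi> (amul (triv_ext A) a b) = amul TX (\<Phi> a) (\<Phi> b)"
    if ab: "a \<in> acarrier (triv_ext A)" "b \<in> acarrier (triv_ext A)" for a b
  proof -
    obtain x f where a: "a = (cls x, f)" "x \<in> acarrier kQ" "lin_functional A f"
      using ab(1) unfolding carT by blast
    obtain y g where b: "b = (cls y, g)" "y \<in> acarrier kQ" "lin_functional A g"
      using ab(2) unfolding carT by blast
    have "\<Phi> (aadd (triv_ext A) a b) \<xi> = aadd TX (\<Phi> a) (\<Phi> b) \<xi>" for \<xi>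
      using a b by (cases \<xi>) (simp_all add: triv_ext_def conv_alg_def \<Phi>I A_ops qrep_cls add_carrier)
    moreover have "\<Phi> (amul (triv_ext A) a b) (Inl r) = amul TX (\<Phi> a) (\<Phi> b) (Inl r)" for r
    proof (cases "r \<in> good")
      case True
      then show ?thesis
        using a b by (simp add: TX_mul_Inl triv_ext_def \<Phi>I A_ops qrep_cls mul_carrier mul_good cong: sum.cong if_cong)
    next
      case False
      then show ?thesis using a b by (simp add: triv_ext_def \<Phi>I conv_alg_def sum_X)
    qed
    moreover have "\<Phi> (amul (triv_ext A) a b) (Inr z) = amul TX (\<Phi> a) (\<Phi> b) (Inr z)" for z
    proof (cases "z \<in> good")
      case True
      have "g (cls (amul kQ (pelem z) x)) =
          (\<Sum>r\<in>good. amul kQ (pelem z) x r * g (cls (pelem r)))"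
        using lin_functional_expand[OF b(3) mul_carrier[OF pc(1)[OF True] a(2)]] .
      also have "\<dots> = (\<Sum>r\<in>good. \<Sum>p\<in>good. if pcomp t z p r then x p * g (cls (pelem r)) else 0)"
      proof (intro sum.cong refl)
        fix r assume r: "r \<in> good"
        have "amul kQ (pelem z) x r = (\<Sum>p\<in>good. \<Sum>q\<in>good. if pcomp t q p r then pelem z q * x p else 0)"
          unfolding mul_good[OF pc(1)[OF True] a(2) r] by (rule sum.swap)
        also have "\<dots> = (\<Sum>p\<in>good. if pcomp t z p r then x p else 0)"
          using True by (simp add: sum_delta_pelem(1))
        finally show "amul kQ (pelem z) x r * g (cls (pelem r)) =
            (\<Sum>p\<in>good. if pcomp t z p r then x p * g (cls (pelem r)) else 0)"
          by (simp add: sum_distrib_right if_distrib[of "\<lambda>u. u * _"] cong: if_cong)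
      qed
      also have "\<dots> = (\<Sum>p\<in>good. \<Sum>r\<in>good. if pcomp t z p r then x p * g (cls (pelem r)) else 0)"
        by (rule sum.swap)
      finally have g: "g (cls (amul kQ (pelem z) x)) = \<dots>" .
      have "f (cls (amul kQ y (pelem z))) =
          (\<Sum>r\<in>good. amul kQ y (pelem z) r * f (cls (pelem r)))"
        using lin_functional_expand[OF a(3) mul_carrier[OF b(2) pc(1)[OF True]]] .
      also have "\<dots> = (\<Sum>r\<in>good. \<Sum>q\<in>good. if pcomp t q z r then f (cls (pelem r)) * y q else 0)"
      proof (intro sum.cong refl)
        fix r assume r: "r \<in> good"
        have "amul kQ y (pelem z) r = (\<Sum>q\<in>good. if pcomp t q z r then y q else 0)"
          unfolding mul_good[OF b(2) pc(1)[OF True] r] using True by (simp add: sum_delta_pelem(2))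
        then show "amul kQ y (pelem z) r * f (cls (pelem r)) =
            (\<Sum>q\<in>good. if pcomp t q z r then f (cls (pelem r)) * y q else 0)"
          by (simp add: sum_distrib_left mult.commute[of _ "f _"] if_distrib[of "\<lambda>u. _ * u"] cong: if_cong)
      qed
      finally have f: "f (cls (amul kQ y (pelem z))) = \<dots>" .
      have "\<Phi> (amul (triv_ext A) a b) (Inr z) =
          g (cls (amul kQ (pelem z) x)) + f (cls (amul kQ y (pelem z)))"
        using True a b by (simp add: triv_ext_def \<Phi>I A_ops pc)
      moreover have "amul TX (\<Phi> a) (\<Phi> b) (Inr z) =
        (\<Sum>p\<in>good. \<Sum>r\<in>good. if pcomp t z p r then x p * g (cls (pelem r)) else 0) +
        (\<Sum>r\<in>good. \<Sum>q\<in>good. if pcomp t q z r then f (cls (pelem r)) * y q else 0)"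
        using a b by (simp add: TX_mul_Inr[OF True] \<Phi>I qrep_cls cong: sum.cong if_cong)
      ultimately show ?thesis using f g by simp
    next
      case False
      \<comment> \<open>A path that is not good is no factor of a good path, so no term of the
        product reaches this coordinate.\<close>
      have "\<not> pcomp t z p y" "\<not> pcomp t p z y" if "y \<in> good" for p y
        using good_pcomp[OF _ that] False by blast+
      then show ?thesis
        using False a b by (simp add: triv_ext_def \<Phi>I conv_alg_def sum_X cong: sum.cong if_cong)
    qed
    ultimately show ?thesis by (auto simp: fun_eq_iff split_sum_all)
  qed
  moreover have "\<Phi> (asmul (triv_ext A) c a) = asmul TX c (\<Phi> a)" if aT: "a \<in> acarrier (triv_ext A)" for c a
  proof
    fix \<xi>
    obtain x f where "a = (cls x, f)" "x \<in> acarrier kQ"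
      using aT unfolding carT by blast
    then show "\<Phi> (asmul (triv_ext A) c a) \<xi> = asmul TX c (\<Phi> a) \<xi>"
      by (cases \<xi>) (simp_all add: triv_ext_def conv_alg_def \<Phi>I A_smul qrep_cls smul_carrier)
  qed
  ultimately show ?thesis unfolding kalg_iso_def by blast
qed

end

section \<open>Maximal paths\<close>

text \<open>Positions count vertices: on a path of length n they run from 0 to n, matching the
  second components of germs. Equal positions give the trivial path at that vertex.\<close>

definition seg :: "('a \<Rightarrow> 'v) \<Rightarrow> ('v, 'a) path \<Rightarrow> nat \<Rightarrow> nat \<Rightarrow> ('v, 'a) path" where
  "seg t m l j = (pverts t m ! l, drop l (take j (snd m)))"

lemma pverts_0 [simp]: "pverts t m ! 0 = fst m"
  and pverts_Suc: "j < length (snd m) \<Longrightarrow> pverts t m ! Suc j = t (snd m ! j)"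
  by (simp_all add: pverts_def)

lemma seg_full [simp]: "seg t m 0 (length (snd m)) = m"
  by (simp add: seg_def)

lemma seg_trivial [simp]: "seg t m j j = (pverts t m ! j, [])"
  by (simp add: seg_def)

lemma length_seg [simp]: "j \<le> length (snd m) \<Longrightarrow> length (snd (seg t m l j)) = j - l"
  by (simp add: seg_def)

lemma pend_seg:
  assumes "l \<le> j" "j \<le> length (snd m)"
  shows "pend t (seg t m l j) = pverts t m ! j"
proof (cases "l = j")
  case False
  then obtain k where j: "j = Suc k" using assms by (cases j) auto
  have "drop l (take j (snd m)) \<noteq> []" using False assms by simp
  then have "last (drop l (take j (snd m))) = last (take j (snd m))"
    using False assms by (intro last_drop) simp
  also have "\<dots> = snd m ! k" using assms j by (simp add: take_Suc_conv_app_nth)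
  finally show ?thesis using False assms j by (simp add: pend_def seg_def pverts_Suc)
qed simp

lemma pcomp_seg:
  assumes "l \<le> j" "j \<le> k" "k \<le> length (snd m)"
  shows "pcomp t (seg t m l j) (seg t m j k) (seg t m l k)"
proof -
  define ys where "ys = take k (snd m)"
  have ys: "length ys = k" "take j (snd m) = take j ys" using assms by (simp_all add: ys_def min_def)
  have "drop l ys = drop l (take j ys @ drop j ys)" by simp
  also have "\<dots> = drop l (take j (snd m)) @ drop j ys"
    by (subst drop_append) (use assms ys in simp)
  finally show ?thesis using assms pend_seg[of l j m t] by (simp add: seg_def ys_def)
qed

context gentle_alg
begin

definition step :: "'a \<Rightarrow> 'a \<Rightarrow> bool" where
  "step a b \<longleftrightarrow> a \<in> Arr \<and> b \<in> Arr \<and> t a = s b \<and> nz a b"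

text \<open>The first half of (S2). The bound on the cardinality becomes uniqueness because the set
  of candidates is finite; the next lemma does the same for the second half.\<close>

lemma step_right_unique:
  assumes "step a b" "step a c" shows "b = c"
proof -
  have "a \<in> Arr" using assms by (simp add: step_def)
  then have "card {\<beta>\<in>Arr. s \<beta> = t a \<and> pelem (s a, [a, \<beta>]) \<notin> I} \<le> Suc 0"
    using gent \<open>a \<in> Arr\<close> by (simp add: gentle_def)
  moreover have "finite {\<beta>\<in>Arr. s \<beta> = t a \<and> pelem (s a, [a, \<beta>]) \<notin> I}"
    using quiv by (simp add: quiver_def)
  ultimately show ?thesis
    using assms unfolding step_def nz_def by (auto simp: card_le_Suc0_iff_eq)
qed

lemma step_left_unique:
  assumes "step b a" "step c a" shows "b = c"
proof -
  have "a \<in> Arr" using assms by (simp add: step_def)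
  then have "card {\<gamma>\<in>Arr. t \<gamma> = s a \<and> pelem (s \<gamma>, [\<gamma>, a]) \<notin> I} \<le> Suc 0"
    using gent \<open>a \<in> Arr\<close> by (simp add: gentle_def)
  moreover have "finite {\<gamma>\<in>Arr. t \<gamma> = s a \<and> pelem (s \<gamma>, [\<gamma>, a]) \<notin> I}"
    using quiv by (simp add: quiver_def)
  ultimately show ?thesis
    using assms unfolding step_def nz_def by (auto simp: card_le_Suc0_iff_eq)
qed

lemma good_Nil [simp]: "(v, []) \<in> good \<longleftrightarrow> v \<in> V"
  by (simp add: good_def)

lemma good_single [simp]: "(v, [a]) \<in> good \<longleftrightarrow> a \<in> Arr \<and> v = s a"
  using quiv by (auto simp: good_def quiver_def)

lemma good_Cons: "xs \<noteq> [] \<Longrightarrow> (v, a # xs) \<in> good \<longleftrightarrow> v = s a \<and> step a (hd xs) \<and> (t a, xs) \<in> good"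
  by (cases xs) (auto simp: good_def step_def)

lemma good_snoc:
  "xs \<noteq> [] \<Longrightarrow> (v, xs @ [a]) \<in> good \<longleftrightarrow> step (last xs) a \<and> (v, xs) \<in> good"
proof (induction xs arbitrary: v)
  case (Cons b xs)
  then show ?case using quiv by (cases "xs = []") (auto simp: good_Cons step_def quiver_def)
qed simp

lemma good_nth_step:
  assumes "p \<in> good" "Suc j < length (snd p)"
  shows "step (snd p ! j) (snd p ! Suc j)"
  using assms unfolding good_def step_def
  by (auto simp: valid_path_def successively_conv_nth)

lemma good_hd: "p \<in> good \<Longrightarrow> snd p \<noteq> [] \<Longrightarrow> fst p = s (hd (snd p))"
  by (auto simp: good_def valid_path_def)

lemma good_nth_Arr: "p \<in> good \<Longrightarrow> j < length (snd p) \<Longrightarrow> snd p ! j \<in> Arr"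
  by (auto simp: good_def valid_path_def)

lemma good_seg:
  assumes "m \<in> good" "l \<le> j" "j \<le> length (snd m)"
  shows "seg t m l j \<in> good"
proof -
  have "pcomp t (seg t m 0 l) (seg t m l (length (snd m))) m"
    using pcomp_seg[of 0 l "length (snd m)" m t] assms by simp
  then have "seg t m l (length (snd m)) \<in> good" using good_pcomp assms(1) by blast
  then show ?thesis using pcomp_seg[of l j "length (snd m)" m t] assms good_pcomp by blast
qed

lemma pverts_in_V: "m \<in> good \<Longrightarrow> j \<le> length (snd m) \<Longrightarrow> pverts t m ! j \<in> V"
  using good_seg[of m j j] by simp

lemma pverts_nth: "m \<in> good \<Longrightarrow> j < length (snd m) \<Longrightarrow> pverts t m ! j = s (snd m ! j)"
  using good_hd[OF good_seg[of m j "Suc j"]] by (simp add: seg_def hd_drop_conv_nth)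

lemma seg_single:
  assumes "m \<in> good" "j < length (snd m)"
  shows "seg t m j (Suc j) = (s (snd m ! j), [snd m ! j])"
  using assms pverts_nth[OF assms] by (simp add: seg_def take_Suc_conv_app_nth)

abbreviation maxp :: "('v, 'a) path \<Rightarrow> bool" where
  "maxp \<equiv> maxpath V Arr s t I"

text \<open>Since \<open>I\<close> is generated in length two, whether a good path can be prolonged
  at an end depends only on the arrow at that end.\<close>

lemma maxp_iff:
  "maxp m \<longleftrightarrow> m \<in> good \<and> snd m \<noteq> [] \<and> (\<forall>a. \<not> step a (hd (snd m))) \<and> (\<forall>a. \<not> step (last (snd m)) a)"
proof (cases "m \<in> good \<and> snd m \<noteq> []")
  case True
  obtain v xs where m: "m = (v, xs)" by (cases m)
  have v: "valid (v, xs)" "xs \<noteq> []" and g: "(v, xs) \<in> good" using True by (auto simp: m good_valid)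
  have hd: "v = s (hd xs)" using good_hd[OF g] v by simp
  have "pelem (s a, a # xs) \<in> I \<longleftrightarrow> \<not> step a (hd xs)" if "a \<in> Arr" "t a = v" for a
    using that v g by (subst pelem_in_I_iff) (auto simp: good_Cons)
  moreover have "t a = v" "a \<in> Arr" if "step a (hd xs)" for a
    using that hd by (auto simp: step_def)
  moreover have "pelem (v, xs @ [a]) \<in> I \<longleftrightarrow> \<not> step (last xs) a" if "a \<in> Arr" "s a = pend t (v, xs)" for a
    using that v g quiv by (subst pelem_in_I_iff) (auto simp: good_snoc quiver_def)
  moreover have "s a = pend t (v, xs)" "a \<in> Arr" if "step (last xs) a" for a
    using that v by (auto simp: step_def pend_def)
  moreover have "pelem (v, xs) \<notin> I" using pelem_in_I_iff v g by blast
  ultimately show ?thesis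
    using v g unfolding maxpath_def m by (simp) blast
next
  case False
  then show ?thesis unfolding maxpath_def using pelem_in_I_iff[of m] by blast
qed

lemma maxp_good: "maxp m \<Longrightarrow> m \<in> good"
  and maxp_nonempty: "maxp m \<Longrightarrow> snd m \<noteq> []"
  by (simp_all add: maxp_iff)

text \<open>Predecessors under \<open>step\<close> are unique, so the two paths agree backwards from
  the common arrow. The first arrow of a maximal path has no predecessor, hence both starts are
  reached simultaneously. Unique successors then make the paths agree forwards to the end. In
  particular a maximal path never repeats an arrow.\<close>

lemma maxp_unique:
  assumes m: "maxp m" "maxp m'" and "j < length (snd m)" "j' < length (snd m')"
    and "snd m ! j = snd m' ! j'"
  shows "m = m' \<and> j = j'"
proof -
  have first: "\<not> step a (snd p ! 0)" if "maxp p" for p a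
    using that by (metis hd_conv_nth maxp_iff)
  have "j = j' \<and> snd m ! 0 = snd m' ! 0"
    using assms(3-)
  proof (induction j arbitrary: j')
    case 0
    show ?case
    proof (cases j')
      case (Suc k)
      then have "step (snd m' ! k) (snd m ! 0)"
        using good_nth_step[OF maxp_good[OF m(2)], of k] 0 by simp
      then show ?thesis using first[OF m(1)] by blast
    qed (use 0 in simp)
  next
    case (Suc j)
    have st: "step (snd m ! j) (snd m ! Suc j)"
      using maxp_good[OF m(1)] Suc.prems(1) by (rule good_nth_step)
    show ?case
    proof (cases j')
      case 0
      then show ?thesis using st first[OF m(2)] Suc.prems by simp
    next
      case (Suc k)
      then have "step (snd m' ! k) (snd m ! Suc j)"
        using good_nth_step[OF maxp_good[OF m(2)], of k] Suc.prems by simp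
      then have "snd m ! j = snd m' ! k" using st step_left_unique by blast
      then show ?thesis using Suc.IH[of k] Suc.prems Suc by simp
    qed
  qed
  then have j: "j = j'" and hd: "snd m ! 0 = snd m' ! 0" by auto
  \<comment> \<open>Forward comparison from a common first arrow: \<open>q\<close> cannot stop
    earlier than \<open>p\<close>, as the next arrow of \<open>p\<close> would prolong it.\<close>
  have run: "i < length (snd q) \<and> snd p ! i = snd q ! i"
    if p: "maxp p" "maxp q" "snd p ! 0 = snd q ! 0" "i < length (snd p)" for p q i
    using that(4)
  proof (induction i)
    case 0
    then show ?case using p by (simp add: maxp_iff)
  next
    case (Suc i)
    then have IH: "i < length (snd q)" "snd p ! i = snd q ! i" by auto
    have st: "step (snd q ! i) (snd p ! Suc i)"
      using good_nth_step[OF maxp_good[OF p(1)] Suc.prems] IH by simp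
    have "Suc i < length (snd q)"
    proof (rule ccontr)
      assume "\<not> Suc i < length (snd q)"
      then have "length (snd q) = Suc i" using IH by simp
      then have "last (snd q) = snd q ! i" by (simp add: last_conv_nth maxp_nonempty[OF p(2)])
      then show False using p(2) st by (simp add: maxp_iff)
    qed
    then show ?case
      using st good_nth_step[OF maxp_good[OF p(2)]] step_right_unique by blast
  qed
  have "length (snd p) \<le> length (snd q)" if "maxp p" "maxp q" "snd p ! 0 = snd q ! 0" for p q
    using run[OF that, of "length (snd p) - 1"] maxp_nonempty[OF that(1)] by (cases "length (snd p)") auto
  from this[OF m hd] this[OF m(2,1) hd[symmetric]]
  have "length (snd m) = length (snd m')" by simp
  then have "snd m = snd m'" using run[OF m hd] by (intro nth_equalityI) auto
  moreover from this have "fst m = fst m'"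
    using good_hd maxp_good m maxp_nonempty by metis
  ultimately show ?thesis using j by (simp add: prod_eq_iff)
qed

text \<open>Among the finitely many good paths containing \<open>y\<close>, a longest one is
  maximal: a prolongation would again be a good path containing \<open>y\<close>.\<close>

lemma maxp_through:
  assumes y: "y \<in> good" "snd y \<noteq> []"
  obtains m l where "maxp m" "l + length (snd y) \<le> length (snd m)" "seg t m l (l + length (snd y)) = y"
proof -
  define S where "S = {p \<in> good. \<exists>us ws. snd p = us @ snd y @ ws}"
  have "finite S" "y \<in> S" using y finite_good by (auto simp: S_def intro: exI[of _ "[]"])
  then obtain p where p: "p \<in> S" "\<And>q. q \<in> S \<Longrightarrow> length (snd q) \<le> length (snd p)"
    using Max_in[of "(\<lambda>q. length (snd q)) ` S"] Max_ge[of "(\<lambda>q. length (snd q)) ` S"] by fastforce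
  then obtain us ws where uw: "snd p = us @ snd y @ ws" and pg: "p \<in> good" by (auto simp: S_def)
  have ne: "snd p \<noteq> []" using uw y by simp
  have "\<not> step a (hd (snd p))" for a
  proof
    assume st: "step a (hd (snd p))"
    then have "t a = fst p" using good_hd[OF pg ne] by (simp add: step_def)
    then have "(s a, a # snd p) \<in> good" using st ne pg by (simp add: good_Cons)
    then have "(s a, a # snd p) \<in> S" using uw by (auto simp: S_def intro: exI[of _ "a # us"])
    then show False using p(2) by fastforce
  qed
  moreover have "\<not> step (last (snd p)) a" for a
  proof
    assume st: "step (last (snd p)) a"
    then have "(fst p, snd p @ [a]) \<in> good" using ne pg by (simp add: good_snoc)
    then have "(fst p, snd p @ [a]) \<in> S" using uw by (auto simp: S_def)
    then show False using p(2) by fastforce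
  qed
  ultimately have mp: "maxp p" using pg ne by (simp add: maxp_iff)
  let ?q = "seg t p (length us) (length us + length (snd y))"
  have "snd ?q = snd y" by (simp add: seg_def uw)
  moreover have "?q \<in> good" using pg uw by (intro good_seg) auto
  ultimately have "?q = y" using good_hd y by (metis prod_eq_iff)
  then show thesis using that[of p "length us"] mp uw by simp
qed

lemma arrow_in_maxp:
  assumes "a \<in> Arr"
  obtains m j where "maxp m" "j < length (snd m)" "snd m ! j = a"
proof -
  have "(s a, [a]) \<in> good" using assms by simp
  then obtain m j where m: "maxp m" "j + length (snd (s a, [a])) \<le> length (snd m)"
    "seg t m j (j + length (snd (s a, [a]))) = (s a, [a])"
    by (rule maxp_through) simp
  then show thesis using that[of m j] seg_single[OF maxp_good[OF m(1)], of j] by simp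
qed

text \<open>A nontrivial segment is located by its first arrow. Strictness of \<open>l < j\<close>
  matters: a trivial segment may occur at two germs over the same vertex, and this is the source of
  the commutativity relations.\<close>

lemma seg_unique:
  assumes m: "maxp m" "maxp m'" and lj: "l < j" "j \<le> length (snd m)" "l' \<le> j'" "j' \<le> length (snd m')"
    and eq: "seg t m l j = seg t m' l' j'"
  shows "m = m' \<and> l = l' \<and> j = j'"
proof -
  have "length (snd (seg t m l j)) = length (snd (seg t m' l' j'))" using eq by simp
  then have len: "j - l = j' - l'" using lj by simp
  have "snd (seg t m l j) ! 0 = snd (seg t m' l' j') ! 0" using eq by simp
  then have "snd m ! l = snd m' ! l'" using lj len by (simp add: seg_def)
  then have "m = m'" "l = l'" using maxp_unique[OF m, of l l'] lj len by auto
  then show ?thesis using lj len by linarith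
qed

text \<open>The germs that become arrows of the Brauer quiver (\<open>brauer_arrows_eq\<close>): a
  trivial element of \<open>Mbar\<close> is a leaf of multiplicity one and contributes none.\<close>

definition nonleaf :: "(('v, 'a) path \<times> nat) set" where
  "nonleaf = {(m, j). maxp m \<and> j \<le> length (snd m)}"

lemma germ_at_in_arrow:
  assumes "a \<in> Arr"
  obtains m j where "(m, Suc j) \<in> nonleaf" "gammaE t (m, Suc j) = t a" "j < length (snd m)" "snd m ! j = a"
proof -
  obtain m j where "maxp m" "j < length (snd m)" "snd m ! j = a" using arrow_in_maxp[OF assms] .
  then show thesis using that[of m j] by (simp add: nonleaf_def gammaE_def pverts_Suc)
qed

lemma germ_at_out_arrow:
  assumes "a \<in> Arr"
  obtains m j where "(m, j) \<in> nonleaf" "gammaE t (m, j) = s a" "j < length (snd m)" "snd m ! j = a"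
proof -
  obtain m j where "maxp m" "j < length (snd m)" "snd m ! j = a" using arrow_in_maxp[OF assms] .
  then show thesis using that[of m j] by (simp add: nonleaf_def gammaE_def pverts_nth maxp_good)
qed

text \<open>The three alternatives in \<open>Mbar\<close> are the ways to have at most one incoming
  and at most one outgoing arrow but not neither, with nonzero product if both occur. The merged
  form avoids repeating this case distinction later.\<close>

lemma trivial_Mbar_iff:
  "(i, []) \<in> Mbar V Arr s t I \<longleftrightarrow> i \<in> V \<and> (\<exists>a\<in>Arr. s a = i \<or> t a = i) \<and>
     (\<forall>a\<in>Arr. \<forall>b\<in>Arr. s a = i \<and> s b = i \<longrightarrow> a = b) \<and> (\<forall>a\<in>Arr. \<forall>b\<in>Arr. t a = i \<and> t b = i \<longrightarrow> a = b) \<and>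
     (\<forall>a\<in>Arr. \<forall>b\<in>Arr. t a = i \<and> s b = i \<longrightarrow> nz a b)" (is "?L \<longleftrightarrow> ?R")
proof
  assume L: ?L
  have single: "{a\<in>Arr. P a} = {x} \<longleftrightarrow> x \<in> Arr \<and> (\<forall>a\<in>Arr. P a \<longleftrightarrow> a = x)" for x P
    by auto
  have "\<not> maxp (i, [])" by (simp add: maxpath_def)
  then have "i \<in> V" and "(\<forall>a\<in>Arr. s a \<noteq> i) \<and> (\<exists>x\<in>Arr. \<forall>a\<in>Arr. t a = i \<longleftrightarrow> a = x) \<or>
      (\<forall>a\<in>Arr. t a \<noteq> i) \<and> (\<exists>x\<in>Arr. \<forall>a\<in>Arr. s a = i \<longleftrightarrow> a = x) \<or>
      (\<exists>x\<in>Arr. \<exists>y\<in>Arr. (\<forall>a\<in>Arr. t a = i \<longleftrightarrow> a = x) \<and> (\<forall>a\<in>Arr. s a = i \<longleftrightarrow> a = y) \<and> nz x y)"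
    using L unfolding Mbar_def nz_def by (simp_all add: card_1_singleton_iff single) blast
  then show ?R by (elim disjE conjE bexE) (simp_all, blast)
next
  assume R: ?R
  have so: "{a\<in>Arr. s a = i} = {b}" if "b \<in> Arr" "s b = i" for b using R that by auto
  have si: "{a\<in>Arr. t a = i} = {b}" if "b \<in> Arr" "t b = i" for b using R that by auto
  consider b where "b \<in> Arr" "s b = i" "{a\<in>Arr. t a = i} = {}"
    | b where "b \<in> Arr" "t b = i" "{a\<in>Arr. s a = i} = {}"
    | a b where "a \<in> Arr" "t a = i" "b \<in> Arr" "s b = i"
    using R by blast
  then show ?L
  proof cases
    case 1 then show ?thesis using R so by (auto simp: Mbar_def)
  next
    case 2 then show ?thesis using R si by (auto simp: Mbar_def)
  next
    case 3
    then have "nz a b" using R by blast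
    then show ?thesis using R so[OF 3(3,4)] si[OF 3(1,2)] by (auto simp: Mbar_def nz_def)
  qed
qed

text \<open>Takes the place of the fact that every vertex lies on two elements of
  \<open>Mbar\<close>. An incoming and an outgoing arrow with nonzero product meet at one position
  of one maximal path. Two incoming arrows, two outgoing ones, or a pair with zero product sit at
  different germs over \<open>i\<close>.\<close>

lemma trivial_Mbar_iff_unique_germ:
  assumes i: "i \<in> V"
  shows "(i, []) \<in> Mbar V Arr s t I \<longleftrightarrow> (\<exists>!h. h \<in> nonleaf \<and> gammaE t h = i)"
proof
  assume L: "(i, []) \<in> Mbar V Arr s t I"
  then have "\<exists>h. h \<in> nonleaf \<and> gammaE t h = i"
    unfolding trivial_Mbar_iff by (metis germ_at_in_arrow germ_at_out_arrow)
  moreover have "h = h'" if h: "h \<in> nonleaf" "gammaE t h = i" "h' \<in> nonleaf" "gammaE t h' = i" for h h'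
  proof -
    have arr_in: "snd m ! k \<in> Arr \<and> t (snd m ! k) = i"
      if "(m, Suc k) \<in> nonleaf" "gammaE t (m, Suc k) = i" for m k
      using that by (auto simp: nonleaf_def gammaE_def pverts_Suc intro: good_nth_Arr maxp_good)
    have arr_out: "snd m ! k \<in> Arr \<and> s (snd m ! k) = i"
      if "(m, k) \<in> nonleaf" "gammaE t (m, k) = i" "k < length (snd m)" for m k
      using that by (auto simp: nonleaf_def gammaE_def pverts_nth maxp_good intro: good_nth_Arr)
    \<comment> \<open>A start and an end of maximal paths over \<open>i\<close> cannot both occur:
      the last arrow of one followed by the first of the other would be nonzero, against
      maximality.\<close>
    have mixed: False if "(m, 0) \<in> nonleaf" "gammaE t (m, 0) = i" "(m', length (snd m')) \<in> nonleaf"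
      "gammaE t (m', length (snd m')) = i" for m m'
    proof -
      have ne: "snd m \<noteq> []" "snd m' \<noteq> []" using that by (auto simp: nonleaf_def dest: maxp_nonempty)
      then obtain k where k: "length (snd m') = Suc k" by (metis length_0_conv not0_implies_Suc)
      have "nz (snd m' ! k) (snd m ! 0)"
        using L arr_in[of m' k] arr_out[of m 0] that ne k unfolding trivial_Mbar_iff by simp
      then have "step (snd m' ! k) (snd m ! 0)"
        using arr_in[of m' k] arr_out[of m 0] that ne k by (simp add: step_def)
      then show False
        using that ne k by (auto simp: nonleaf_def maxp_iff hd_conv_nth last_conv_nth)
    qed
    obtain m j m' j' where hh: "h = (m, j)" "h' = (m', j')" by (cases h, cases h')
    have mm: "maxp m" "maxp m'" using h hh by (auto simp: nonleaf_def)
    \<comment> \<open>A germ has an incoming arrow unless it is at position 0, and an outgoing one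
      unless it is at the end; a nontrivial path has at least one of them at every position. So the
      two germs share a kind of arrow or sit at opposite extremes.\<close>
    consider k k' where "j = Suc k" "j' = Suc k'" | "j < length (snd m)" "j' < length (snd m')"
      | "j = 0" "j' = length (snd m')" | "j' = 0" "j = length (snd m)"
      using h hh maxp_nonempty[OF mm(1)] maxp_nonempty[OF mm(2)]
      by (cases j; cases j') (auto simp: nonleaf_def le_less)
    then show ?thesis
    proof cases
      case 1
      then have "snd m ! k = snd m' ! k'"
        using L h hh arr_in[of m k] arr_in[of m' k'] unfolding trivial_Mbar_iff by blast
      then show ?thesis using maxp_unique[OF mm, of k k'] h hh 1 by (auto simp: nonleaf_def)
    next
      case 2
      then have "snd m ! j = snd m' ! j'"
        using L h hh arr_out[of m j] arr_out[of m' j'] unfolding trivial_Mbar_iff by blast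
      then show ?thesis using maxp_unique[OF mm, of j j'] hh 2 by simp
    next
      case 3 then show ?thesis using mixed[of m m'] h hh by simp
    next
      case 4 then show ?thesis using mixed[of m' m] h hh by simp
    qed
  qed
  ultimately show "\<exists>!h. h \<in> nonleaf \<and> gammaE t h = i" by blast
next
  assume "\<exists>!h. h \<in> nonleaf \<and> gammaE t h = i"
  then obtain m j where mj: "(m, j) \<in> nonleaf" "gammaE t (m, j) = i"
    and uniq: "\<And>h. h \<in> nonleaf \<Longrightarrow> gammaE t h = i \<Longrightarrow> h = (m, j)" by (metis surj_pair)
  have "\<exists>a\<in>Arr. s a = i \<or> t a = i"
  proof (cases "j < length (snd m)")
    case True
    then show ?thesis
      using mj good_nth_Arr[of m j] by (auto simp: nonleaf_def gammaE_def pverts_nth maxp_good)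
  next
    case False
    then obtain k where "j = Suc k" "k < length (snd m)"
      using mj maxp_nonempty[of m] by (cases j) (auto simp: nonleaf_def)
    then show ?thesis
      using mj good_nth_Arr[of m k] by (auto simp: nonleaf_def gammaE_def pverts_Suc maxp_good)
  qed
  moreover have "a = b" if "a \<in> Arr" "b \<in> Arr" "s a = i" "s b = i" for a b
    using germ_at_out_arrow[OF that(1)] germ_at_out_arrow[OF that(2)] uniq that by (metis prod.inject)
  moreover have "a = b" if "a \<in> Arr" "b \<in> Arr" "t a = i" "t b = i" for a b
    using germ_at_in_arrow[OF that(1)] germ_at_in_arrow[OF that(2)] uniq that
    by (metis prod.inject nat.inject)
  moreover have "nz a b" if ab: "a \<in> Arr" "b \<in> Arr" "t a = i" "s b = i" for a b
  proof -
    obtain p k where p: "(p, Suc k) \<in> nonleaf" "gammaE t (p, Suc k) = t a" "k < length (snd p)" "snd p ! k = a"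
      using germ_at_in_arrow[OF ab(1)] .
    obtain q l where q: "(q, l) \<in> nonleaf" "gammaE t (q, l) = s b" "l < length (snd q)" "snd q ! l = b"
      using germ_at_out_arrow[OF ab(2)] .
    \<comment> \<open>The germ after \<open>a\<close> and the germ before \<open>b\<close> coincide
      by uniqueness, hence \<open>a\<close> and \<open>b\<close> are consecutive on one maximal
      path.\<close>
    have "p = q" "Suc k = l" using uniq[OF p(1)] uniq[OF q(1)] p q ab by auto
    then show ?thesis
      using good_nth_step[of p k] p q by (auto simp: nonleaf_def maxp_good step_def)
  qed
  ultimately show "(i, []) \<in> Mbar V Arr s t I"
    unfolding trivial_Mbar_iff using i by blast
qed

end

section \<open>The Brauer quiver of the maximal paths\<close>

text \<open>An isolated vertex lies on no element of \<open>Mbar\<close>, so its edge would be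
  missing from the graph; \<open>incident\<close> rules this out and provides a germ over every
  vertex.\<close>

locale gentle_conn = gentle_alg V Arr s t I
  for V :: "'v set" and Arr :: "'a set" and s t :: "'a \<Rightarrow> 'v"
    and I :: "(('v, 'a) path \<Rightarrow> 'k::field) set" +
  assumes incident: "i \<in> V \<Longrightarrow> \<exists>a\<in>Arr. s a = i \<or> t a = i"
begin

abbreviation H :: "(('v, 'a) path \<times> nat) set" where
  "H \<equiv> gammaH V Arr s t I"

abbreviation E :: "('v, 'a) path \<times> nat \<Rightarrow> 'v" where
  "E \<equiv> gammaE t"

abbreviation tB :: "('v, 'a) path \<times> nat \<Rightarrow> 'v" where
  "tB \<equiv> \<lambda>h. gammaE t (gammaS h)"

text \<open>The walk of \<open>k\<close> arrows around one vertex of the graph. No bound on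
  \<open>k\<close> is imposed; more than one full turn will turn out to lie in the ideal.\<close>

definition bpath :: "('v, 'a) path \<times> nat \<Rightarrow> nat \<Rightarrow> ('v, ('v, 'a) path \<times> nat) path" where
  "bpath h k = (E h, map (\<lambda>i. (gammaS ^^ i) h) [0..<k])"

lemma gammaS_funpow:
  "j \<le> length (snd m) \<Longrightarrow> (gammaS ^^ k) (m, j) = (m, (j + k) mod Suc (length (snd m)))"
  by (induction k) (simp_all add: gammaS_def mod_Suc_eq)

lemma gammaS_nonleaf: "h \<in> nonleaf \<Longrightarrow> gammaS h \<in> nonleaf"
  by (auto simp: nonleaf_def gammaS_def less_Suc_eq_le[symmetric])

lemma gammaS_funpow_nonleaf: "h \<in> nonleaf \<Longrightarrow> (gammaS ^^ k) h \<in> nonleaf"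
  by (induction k) (auto intro: gammaS_nonleaf)

lemma E_in_V: "h \<in> nonleaf \<Longrightarrow> E h \<in> V"
  by (cases h) (auto simp: nonleaf_def gammaE_def intro!: pverts_in_V maxp_good)

lemma finite_nonleaf: "finite nonleaf"
proof -
  have "nonleaf \<subseteq> (SIGMA m:good. {..length (snd m)})" by (auto simp: nonleaf_def maxp_good)
  then show ?thesis using finite_good by (auto intro: finite_subset)
qed

sublocale B: fin_quiver V nonleaf "gammaE t" "\<lambda>h. gammaE t (gammaS h)"
  using quiv finite_nonleaf gammaS_nonleaf by unfold_locales (auto simp: quiver_def E_in_V)

lemma Mbar_cases: "m \<in> Mbar V Arr s t I \<Longrightarrow> maxp m \<or> snd m = []"
  by (auto simp: Mbar_def)

lemma valency_H:
  assumes "m \<in> Mbar V Arr s t I"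
  shows "valency H fst m = Suc (length (snd m))"
proof -
  have "{g \<in> H. fst g = m} = {m} \<times> {..length (snd m)}"
    using assms by (auto simp: gammaH_def)
  then show ?thesis by (simp add: valency_def)
qed

lemma leaf1_H: "m \<in> Mbar V Arr s t I \<Longrightarrow> mu m = 1 \<Longrightarrow> leaf1 H fst mu m \<longleftrightarrow> snd m = []"
  by (simp add: leaf1_def valency_H)

lemma maxp_Mbar: "maxp m \<Longrightarrow> m \<in> Mbar V Arr s t I"
  by (simp add: Mbar_def)

lemma nonleaf_iff: "h \<in> nonleaf \<longleftrightarrow> h \<in> H \<and> snd (fst h) \<noteq> []"
  using Mbar_cases[of "fst h"] by (cases h) (auto simp: gammaH_def nonleaf_def maxp_Mbar dest: maxp_nonempty)

lemma brauer_arrows_eq: "brauer_arrows H fst (\<lambda>_. 1) = nonleaf"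
proof -
  have "leaf1 H fst (\<lambda>_. 1) (fst h) \<longleftrightarrow> snd (fst h) = []" if "h \<in> H" for h
    using that by (intro leaf1_H) (auto simp: gammaH_def)
  then show ?thesis unfolding brauer_arrows_def by (auto simp: nonleaf_iff)
qed

lemma bcyc_eq: "h \<in> nonleaf \<Longrightarrow> bcyc H fst gammaS h = snd (bpath h (Suc (length (snd (fst h)))))"
  by (auto simp: bcyc_def bpath_def nonleaf_def valency_H maxp_Mbar)

abbreviation J :: "(('v, ('v, 'a) path \<times> nat) path \<Rightarrow> 'k) set" where
  "J \<equiv> brauer_ideal V H fst (gammaE t) gammaS (\<lambda>_. 1)"

abbreviation rels :: "(('v, ('v, 'a) path \<times> nat) path \<Rightarrow> 'k) set" where
  "rels \<equiv> brauer_rels V H fst (gammaE t) gammaS (\<lambda>_. 1)"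

abbreviation full :: "('v, 'a) path \<times> nat \<Rightarrow> ('v, ('v, 'a) path \<times> nat) path" where
  "full h \<equiv> bpath h (Suc (length (snd (fst h))))"

lemma fst_bpath [simp]: "fst (bpath h k) = E h"
  by (simp add: bpath_def)

lemma pair_bpath [simp]: "(E h, snd (bpath h k)) = bpath h k"
  by (simp add: bpath_def)

text \<open>Leaves are eliminated from the relations: the only leaf germ over an edge
  \<open>i\<close> is \<open>((i, []), 0)\<close>, so its presence is membership of
  \<open>(i, [])\<close> in \<open>Mbar\<close>. The terms keep the factor \<open>- 1\<close> in the
  form produced by \<open>asmul\<close>.\<close>

lemma rels_eq: "rels =
   {\<lambda>p. pelem (full h) p + - 1 * pelem (full h') p | h h'.
      h \<in> nonleaf \<and> h' \<in> nonleaf \<and> h \<noteq> h' \<and> E h = E h'}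
   \<union> {pelem (E h', snd (full h') @ [h']) | h'. h' \<in> nonleaf \<and> (E h', []) \<in> Mbar V Arr s t I}
   \<union> {pelem (E h, [h, g]) | h g. h \<in> nonleaf \<and> g \<in> nonleaf \<and> tB h = E g \<and> g \<noteq> gammaS h}"
  (is "_ = ?R1 \<union> ?R2 \<union> ?R3")
proof -
  have nb: "h \<in> nonleaf \<longleftrightarrow> h \<in> H \<and> \<not> leaf1 H fst (\<lambda>_. 1) (fst h)" for h
    unfolding brauer_arrows_eq[symmetric] brauer_arrows_def by simp
  have leafE: "h = ((E h, []), 0) \<and> (E h, []) \<in> Mbar V Arr s t I" if "h \<in> H" "leaf1 H fst (\<lambda>_. 1) (fst h)" for h
  proof -
    have mb: "fst h \<in> Mbar V Arr s t I" "snd h \<le> length (snd (fst h))"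
      using that(1) by (auto simp: gammaH_def)
    then have "snd (fst h) = []" using leaf1_H[OF mb(1)] that(2) by simp
    then show ?thesis
      using mb by (cases h, cases "fst h") (simp add: gammaE_def pverts_def)
  qed
  have leafI: "((i, []), 0) \<in> H \<and> leaf1 H fst (\<lambda>_. 1) (i, []) \<and> ((i, []), 0) \<notin> nonleaf \<and> E ((i, []), 0) = i"
    if "(i, []) \<in> Mbar V Arr s t I" for i
    using that leaf1_H[OF that] by (simp add: nonleaf_iff gammaH_def gammaE_def pverts_def)
  have c1: "h \<in> H \<and> h' \<in> H \<and> h \<noteq> h' \<and> E h = E h' \<and> \<not> leaf1 H fst (\<lambda>_. 1) (fst h) \<and>
      \<not> leaf1 H fst (\<lambda>_. 1) (fst h') \<longleftrightarrow> h \<in> nonleaf \<and> h' \<in> nonleaf \<and> h \<noteq> h' \<and> E h = E h'" for h h'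
    using nb by blast
  have c2: "(\<exists>h. h \<in> H \<and> h' \<in> H \<and> h \<noteq> h' \<and> E h = E h' \<and> leaf1 H fst (\<lambda>_. 1) (fst h) \<and>
      \<not> leaf1 H fst (\<lambda>_. 1) (fst h')) \<longleftrightarrow> h' \<in> nonleaf \<and> (E h', []) \<in> Mbar V Arr s t I" (is "?l = ?r") for h'
  proof
    assume ?l then show ?r using leafE nb by metis
  next
    assume r: ?r
    note l = leafI[OF conjunct2[OF r]]
    then have "((E h', []), 0) \<noteq> h'" using r by metis
    then show ?l using l r nb[of h'] by (intro exI[of _ "((E h', []), 0)"]) simp
  qed
  have cyc: "(E h, concat (replicate 1 (bcyc H fst gammaS h))) = full h" if "h \<in> nonleaf" for h
    using bcyc_eq[OF that] by simp
  have R1: "{aadd B.kQ (pelem (E h, concat (replicate 1 (bcyc H fst gammaS h))))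
      (asmul B.kQ (-1) (pelem (E h', concat (replicate 1 (bcyc H fst gammaS h'))))) | h h'.
      h \<in> H \<and> h' \<in> H \<and> h \<noteq> h' \<and> E h = E h' \<and> \<not> leaf1 H fst (\<lambda>_. 1) (fst h) \<and>
      \<not> leaf1 H fst (\<lambda>_. 1) (fst h')} = ?R1"
    unfolding c1
  proof (intro Collect_cong ex_cong1 rev_conj_cong refl)
    fix x h h' assume "h \<in> nonleaf \<and> h' \<in> nonleaf \<and> h \<noteq> h' \<and> E h = E h'"
    then have "h \<in> nonleaf" "h' \<in> nonleaf" by auto
    from cyc[OF this(1)] cyc[OF this(2)]
    show "(x = aadd B.kQ (pelem (E h, concat (replicate 1 (bcyc H fst gammaS h))))
      (asmul B.kQ (-1) (pelem (E h', concat (replicate 1 (bcyc H fst gammaS h')))))) =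
      (x = (\<lambda>p. pelem (full h) p + - 1 * pelem (full h') p))"
      by (simp only: B.aadd_kQ B.asmul_kQ)
  qed
  have "{pelem (E h', bcyc H fst gammaS h' @ [h']) | h h'.
          h \<in> H \<and> h' \<in> H \<and> h \<noteq> h' \<and> E h = E h' \<and>
          leaf1 H fst (\<lambda>_. 1) (fst h) \<and> \<not> leaf1 H fst (\<lambda>_. 1) (fst h')} =
      {pelem (E h', bcyc H fst gammaS h' @ [h']) :: _ \<Rightarrow> 'k | h'.
          \<exists>h. h \<in> H \<and> h' \<in> H \<and> h \<noteq> h' \<and> E h = E h' \<and>
          leaf1 H fst (\<lambda>_. 1) (fst h) \<and> \<not> leaf1 H fst (\<lambda>_. 1) (fst h')}"
    by (intro Collect_cong) metis
  also have "\<dots> = ?R2"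
    unfolding c2 by (simp add: bcyc_eq cong: rev_conj_cong)
  finally have R2: "{pelem (E h', bcyc H fst gammaS h' @ [h']) | h h'.
          h \<in> H \<and> h' \<in> H \<and> h \<noteq> h' \<and> E h = E h' \<and>
          leaf1 H fst (\<lambda>_. 1) (fst h) \<and> \<not> leaf1 H fst (\<lambda>_. 1) (fst h')} = ?R2" .
  show ?thesis
    unfolding brauer_rels_def brauer_pathalg_def brauer_arrows_eq Let_def R1 R2 ..
qed

lemma J_gen: "J = ideal_gen B.kQ rels"
  unfolding brauer_ideal_def brauer_pathalg_def brauer_arrows_eq ..

end

section \<open>Evaluating paths of the Brauer quiver\<close>

context gentle_alg
begin

text \<open>Duality reverses direction: \<open>p y\<^sup>*\<close> is nonzero only if
  \<open>y\<close> ends with \<open>p\<close>, so \<open>y\<^sup>*\<close> runs from the end of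
  \<open>y\<close> to its start.\<close>

fun src :: "('v, 'a) path + ('v, 'a) path \<Rightarrow> 'v" where
  "src (Inl p) = fst p" | "src (Inr y) = pend t y"

fun tgt :: "('v, 'a) path + ('v, 'a) path \<Rightarrow> 'v" where
  "tgt (Inl p) = pend t p" | "tgt (Inr y) = fst y"

section \<open>The partial product on the basis of the trivial extension\<close>

lemma M_cases:
  assumes "M \<xi> \<eta> \<zeta>"
  obtains p q r where "\<xi> = Inl p" "\<eta> = Inl q" "\<zeta> = Inl r" "r \<in> good" "pcomp t p q r"
  | p y z where "\<xi> = Inl p" "\<eta> = Inr y" "\<zeta> = Inr z" "y \<in> good" "pcomp t z p y"
  | y q z where "\<xi> = Inr y" "\<eta> = Inl q" "\<zeta> = Inr z" "y \<in> good" "pcomp t q z y"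
  using assms by (cases \<xi>; cases \<eta>; cases \<zeta>) auto

lemma pcomp_ends: "pcomp t p q r \<Longrightarrow> pend t p = fst q \<and> fst r = fst p \<and> pend t r = pend t q"
  by (cases p; cases q; cases r) auto

lemma M_X: "M \<xi> \<eta> \<zeta> \<Longrightarrow> \<xi> \<in> X \<and> \<eta> \<in> X \<and> \<zeta> \<in> X"
  by (erule M_cases) (auto simp: X_def dest: good_pcomp)

lemma M_ends: "M \<xi> \<eta> \<zeta> \<Longrightarrow> tgt \<xi> = src \<eta> \<and> src \<zeta> = src \<xi> \<and> tgt \<zeta> = tgt \<eta>"
  by (erule M_cases) (auto dest: pcomp_ends)

lemma M_functional: "M \<xi> \<eta> \<zeta> \<Longrightarrow> M \<xi> \<eta> \<zeta>' \<Longrightarrow> \<zeta> = \<zeta>'"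
  by (cases \<xi>; cases \<eta>; cases \<zeta>; cases \<zeta>') (auto simp: pcomp_def prod_eq_iff)

lemma pcomp_assoc:
  "pcomp t a b u \<Longrightarrow> pcomp t u c d \<Longrightarrow> \<exists>v. pcomp t b c v \<and> pcomp t a v d"
  "pcomp t b c v \<Longrightarrow> pcomp t a v d \<Longrightarrow> \<exists>u. pcomp t a b u \<and> pcomp t u c d"
  by (cases a; cases b; cases c; cases d; cases u; cases v; auto)+

text \<open>A nonzero triple product has at most one dual factor. In each case both bracketings say
  that the same path splits into the same three consecutive pieces, and \<open>pcomp_assoc\<close>
  regroups them.\<close>

lemma M_assoc: "(\<exists>u. M a b u \<and> M u c d) \<longleftrightarrow> (\<exists>v. M b c v \<and> M a v d)"
proof
  assume "\<exists>u. M a b u \<and> M u c d"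
  then obtain u where u: "M a b u" "M u c d" by blast
  show "\<exists>v. M b c v \<and> M a v d"
    using u(1)
  proof (cases rule: M_cases)
    case (1 p q r)
    show ?thesis
    proof (cases c)
      case (Inl c')
      then obtain d' where d: "d = Inl d'" "pcomp t r c' d'" "d' \<in> good" using u(2) 1 by (cases d) auto
      then obtain v where "pcomp t q c' v" "pcomp t p v d'" using pcomp_assoc(1) 1 by blast
      then show ?thesis using 1 Inl d good_pcomp by (intro exI[of _ "Inl v"]) auto
    next
      case (Inr y)
      then obtain z where d: "d = Inr z" "pcomp t z r y" "y \<in> good" using u(2) 1 by (cases d) auto
      then obtain v where "pcomp t z p v" "pcomp t v q y" using pcomp_assoc(2) 1 by blast
      then show ?thesis using 1 Inr d good_pcomp by (intro exI[of _ "Inr v"]) auto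
    qed
  next
    case (2 p y z)
    then obtain q w where c: "c = Inl q" "d = Inr w" "pcomp t q w z"
      using u(2) by (cases c; cases d) auto
    then obtain v where "pcomp t w p v" "pcomp t q v y" using pcomp_assoc(1) 2 by blast
    then show ?thesis using 2 c good_pcomp by (intro exI[of _ "Inr v"]) auto
  next
    case (3 y q z)
    then obtain q' w where c: "c = Inl q'" "d = Inr w" "pcomp t q' w z"
      using u(2) by (cases c; cases d) auto
    then obtain v where "pcomp t q q' v" "pcomp t v w y" using pcomp_assoc(2) 3 by blast
    then show ?thesis using 3 c good_pcomp by (intro exI[of _ "Inl v"]) auto
  qed
next
  assume "\<exists>v. M b c v \<and> M a v d"
  then obtain v where v: "M b c v" "M a v d" by blast
  show "\<exists>u. M a b u \<and> M u c d"
    using v(1)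
  proof (cases rule: M_cases)
    case (1 p q r)
    show ?thesis
    proof (cases a)
      case (Inl a')
      then obtain d' where d: "d = Inl d'" "pcomp t a' r d'" "d' \<in> good" using v(2) 1 by (cases d) auto
      then obtain u where "pcomp t a' p u" "pcomp t u q d'" using pcomp_assoc(2) 1 by blast
      then show ?thesis using 1 Inl d good_pcomp by (intro exI[of _ "Inl u"]) auto
    next
      case (Inr y)
      then obtain z where d: "d = Inr z" "pcomp t r z y" "y \<in> good" using v(2) 1 by (cases d) auto
      then obtain u where "pcomp t q z u" "pcomp t p u y" using pcomp_assoc(1) 1 by blast
      then show ?thesis using 1 Inr d good_pcomp by (intro exI[of _ "Inr u"]) auto
    qed
  next
    case (2 p y z)
    then obtain q w where c: "a = Inl q" "d = Inr w" "pcomp t w q z"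
      using v(2) by (cases a; cases d) auto
    then obtain u where "pcomp t q p u" "pcomp t w u y" using pcomp_assoc(1) 2 by blast
    then show ?thesis using 2 c good_pcomp by (intro exI[of _ "Inl u"]) auto
  next
    case (3 y q z)
    then obtain p w where c: "a = Inl p" "d = Inr w" "pcomp t w p z"
      using v(2) by (cases a; cases d) auto
    then obtain u where "pcomp t q w u" "pcomp t u p y" using pcomp_assoc(2) 3 by blast
    then show ?thesis using 3 c good_pcomp by (intro exI[of _ "Inr u"]) auto
  qed
qed

lemma M_unit_left: "M (Inl (v, [])) \<eta> \<zeta> \<longleftrightarrow> \<eta> \<in> X \<and> v = src \<eta> \<and> \<zeta> = \<eta>"
  by (cases \<eta>; cases \<zeta>) (auto simp: X_def pcomp_def)

lemma M_unit_right: "M \<xi> (Inl (v, [])) \<zeta> \<longleftrightarrow> \<xi> \<in> X \<and> v = tgt \<xi> \<and> \<zeta> = \<xi>"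
  by (cases \<xi>; cases \<zeta>) (auto simp: X_def pcomp_def)

end

context gentle_conn
begin

fun germ_val :: "('v, 'a) path \<times> nat \<Rightarrow> ('v, 'a) path + ('v, 'a) path" where
  "germ_val (m, j) = (if j < length (snd m) then Inl (seg t m j (Suc j)) else Inr m)"

text \<open>A path without a value evaluates to zero.\<close>
fun evl :: "'v \<Rightarrow> (('v, 'a) path \<times> nat) list \<Rightarrow> ('v, 'a) path + ('v, 'a) path \<Rightarrow> bool" where
  "evl v [] \<xi> \<longleftrightarrow> \<xi> = Inl (v, [])"
| "evl v (h # hs) \<zeta> \<longleftrightarrow> (\<exists>\<xi>. evl (tB h) hs \<xi> \<and> M (germ_val h) \<xi> \<zeta>)"

abbreviation ev :: "('v, ('v, 'a) path \<times> nat) path \<Rightarrow> ('v, 'a) path + ('v, 'a) path \<Rightarrow> bool" where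
  "ev r \<equiv> evl (fst r) (snd r)"

lemma germ_val_X:
  assumes "h \<in> nonleaf"
  shows "germ_val h \<in> X" "src (germ_val h) = E h" "tgt (germ_val h) = tB h"
proof -
  obtain m j where h: "h = (m, j)" "maxp m" "j \<le> length (snd m)" using assms by (auto simp: nonleaf_def)
  have g: "m \<in> good" using h maxp_good by blast
  have "j = length (snd m)" if "\<not> j < length (snd m)" using h that by simp
  then show "germ_val h \<in> X" "src (germ_val h) = E h" "tgt (germ_val h) = tB h"
    using g h pend_seg[of j "Suc j" m t] pend_seg[of 0 "length (snd m)" m t]
    by (auto simp: X_def gammaE_def gammaS_def intro: good_seg) (simp_all add: seg_def)
qed

lemma evl_X:
  "B.valid (v, hs) \<Longrightarrow> evl v hs \<xi> \<Longrightarrow> \<xi> \<in> X \<and> src \<xi> = v \<and> tgt \<xi> = pend tB (v, hs)"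
proof (induction hs arbitrary: v \<xi>)
  case Nil
  then show ?case by (auto simp: X_def)
next
  case (Cons h hs)
  then obtain \<eta> where \<eta>: "evl (tB h) hs \<eta>" "M (germ_val h) \<eta> \<xi>" by auto
  have h: "h \<in> nonleaf" "v = E h" "B.valid (tB h, hs)" using Cons.prems(1) by auto
  show ?case
    using Cons.IH[OF h(3) \<eta>(1)] germ_val_X[OF h(1)] M_X[OF \<eta>(2)] M_ends[OF \<eta>(2)] h(2) by simp
qed

lemma evl_unique: "evl v hs \<xi> \<Longrightarrow> evl v hs \<eta> \<Longrightarrow> \<xi> = \<eta>"
  by (induction hs arbitrary: v \<xi> \<eta>) (auto dest: M_functional)

text \<open>\<open>evl\<close> multiplies from the right end; associativity of \<open>M\<close>
  permits cutting the product anywhere.\<close>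

lemma evl_append:
  "B.valid (v, xs @ ys) \<Longrightarrow>
    evl v (xs @ ys) \<zeta> \<longleftrightarrow> (\<exists>\<xi> \<eta>. evl v xs \<xi> \<and> evl (pend tB (v, xs)) ys \<eta> \<and> M \<xi> \<eta> \<zeta>)"
proof (induction xs arbitrary: v \<zeta>)
  case Nil
  then show ?case using evl_X by (auto simp: M_unit_left)
next
  case (Cons h xs)
  have "evl v ((h # xs) @ ys) \<zeta> \<longleftrightarrow>
      (\<exists>\<xi> \<eta>. evl (tB h) xs \<xi> \<and> evl (pend tB (tB h, xs)) ys \<eta> \<and> (\<exists>u. M \<xi> \<eta> u \<and> M (germ_val h) u \<zeta>))"
    using Cons by auto
  also have "\<dots> \<longleftrightarrow>
      (\<exists>\<xi> \<eta>. evl (tB h) xs \<xi> \<and> evl (pend tB (tB h, xs)) ys \<eta> \<and> (\<exists>u. M (germ_val h) \<xi> u \<and> M u \<eta> \<zeta>))"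
    by (simp only: M_assoc)
  also have "\<dots> \<longleftrightarrow> (\<exists>\<xi> \<eta>. evl v (h # xs) \<xi> \<and> evl (pend tB (v, h # xs)) ys \<eta> \<and> M \<xi> \<eta> \<zeta>)"
    by auto
  finally show ?case .
qed

text \<open>Values carry the endpoints of their paths. Hence, when two paths do not compose, their
  values have no product either, and multiplicativity holds including the zero case.\<close>

lemma ev_pcomp:
  assumes "B.valid p" "B.valid q"
  shows "(\<exists>r. pcomp tB p q r \<and> ev r \<zeta>) \<longleftrightarrow> (\<exists>\<xi> \<eta>. ev p \<xi> \<and> ev q \<eta> \<and> M \<xi> \<eta> \<zeta>)"
proof (cases "pend tB p = fst q")
  case True
  have "B.valid (fst p, snd p @ snd q)" using assms True by simp
  then show ?thesis using evl_append[of "fst p" "snd p" "snd q" \<zeta>] True by (simp add: pcomp_def)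
next
  case False
  then show ?thesis
    using evl_X[of "fst p" "snd p"] evl_X[of "fst q" "snd q"] M_ends assms
    by (metis pcomp_def prod.collapse)
qed

lemma evl_single: "h \<in> nonleaf \<Longrightarrow> evl v [h] \<xi> \<longleftrightarrow> \<xi> = germ_val h"
  using germ_val_X[of h] by (auto simp: M_unit_right)

text \<open>The linear extension of \<open>ev\<close>, one coordinate at a time; paths without value
  contribute nowhere.\<close>

definition \<psi> :: "(('v, ('v, 'a) path \<times> nat) path \<Rightarrow> 'k) \<Rightarrow> ('v, 'a) path + ('v, 'a) path \<Rightarrow> 'k" where
  "\<psi> x \<xi> = (\<Sum>r | x r \<noteq> 0 \<and> ev r \<xi>. x r)"

section \<open>Linearity and multiplicativity of \<open>\<psi>\<close>\<close>

lemma \<psi>_superset: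
  assumes "finite F" "{r. x r \<noteq> 0} \<subseteq> F"
  shows "\<psi> x \<xi> = (\<Sum>r\<in>F. if ev r \<xi> then x r else 0)"
proof -
  have "(\<Sum>r\<in>F. if ev r \<xi> then x r else 0) = (\<Sum>r | x r \<noteq> 0 \<and> ev r \<xi>. if ev r \<xi> then x r else 0)"
    using assms by (intro sum.mono_neutral_right) auto
  also have "\<dots> = \<psi> x \<xi>" unfolding \<psi>_def by (intro sum.cong) auto
  finally show ?thesis by simp
qed

lemma \<psi>_pelem: "\<psi> (pelem r) \<xi> = (if ev r \<xi> then 1 else 0)"
  by (subst \<psi>_superset[of "{r}"]) (auto simp: pelem_def)

lemma \<psi>_carrier:
  assumes "x \<in> acarrier B.kQ"
  shows "\<psi> x \<in> acarrier TX"
proof -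
  have "\<psi> x \<xi> = 0" if "\<xi> \<notin> X" for \<xi>
  proof -
    have "\<not> ev r \<xi>" if "x r \<noteq> 0" for r
      using evl_X[of "fst r" "snd r" \<xi>] B.carrier_valid[OF assms that] \<open>\<xi> \<notin> X\<close> by auto
    then show ?thesis unfolding \<psi>_def by (intro sum.neutral) blast
  qed
  then show ?thesis by (simp add: conv_alg_def)
qed

lemma \<psi>_add:
  assumes "x \<in> acarrier B.kQ" "y \<in> acarrier B.kQ"
  shows "\<psi> (\<lambda>r. x r + y r) \<xi> = \<psi> x \<xi> + \<psi> y \<xi>"
proof -
  let ?F = "{r. x r \<noteq> 0} \<union> {r. y r \<noteq> 0}"
  have "finite ?F" using assms by (simp add: B.carrier_iff)
  then have "\<psi> z \<xi> = (\<Sum>r\<in>?F. if ev r \<xi> then z r else 0)" if "{r. z r \<noteq> 0} \<subseteq> ?F" for z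
    using that by (rule \<psi>_superset)
  note eq = this
  have "\<psi> (\<lambda>r. x r + y r) \<xi> = (\<Sum>r\<in>?F. if ev r \<xi> then x r + y r else 0)" by (rule eq) auto
  also have "\<dots> = (\<Sum>r\<in>?F. (if ev r \<xi> then x r else 0) + (if ev r \<xi> then y r else 0))"
    by (intro sum.cong) auto
  also have "\<dots> = \<psi> x \<xi> + \<psi> y \<xi>" by (subst (1 2) eq) (auto simp: sum.distrib)
  finally show ?thesis .
qed

lemma \<psi>_smul:
  assumes "x \<in> acarrier B.kQ"
  shows "\<psi> (\<lambda>r. c * x r) \<xi> = c * \<psi> x \<xi>"
proof -
  have "finite {r. x r \<noteq> 0}" using assms by (simp add: B.carrier_iff)
  then show ?thesis
    by (subst (1 2) \<psi>_superset[of "{r. x r \<noteq> 0}"]) (auto simp: sum_distrib_left intro!: sum.cong)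
qed

lemma \<psi>_one: "\<psi> (aone B.kQ) = aone TX"
proof
  fix \<xi>
  have fin: "finite V" using quiv by (simp add: quiver_def)
  have "\<psi> (aone B.kQ) \<xi> = (\<Sum>r\<in>(\<lambda>v. (v, [])) ` V. if ev r \<xi> then aone B.kQ r else 0)"
    using fin by (intro \<psi>_superset) (auto simp: B.aone_kQ)
  also have "\<dots> = (\<Sum>v\<in>V. if \<xi> = Inl (v, []) then 1 else 0)"
    by (subst sum.reindex) (auto simp: B.aone_kQ inj_on_def intro!: sum.cong)
  also have "\<dots> = (if \<xi> \<in> U then 1 else 0)"
  proof (cases "\<xi> \<in> U")
    case True
    then obtain u where "\<xi> = Inl (u, [])" "u \<in> V" by (auto simp: U_def)
    then show ?thesis using fin True by simp
  qed (auto simp: U_def intro!: sum.neutral)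
  finally show "\<psi> (aone B.kQ) \<xi> = aone TX \<xi>" by (simp add: conv_alg_def)
qed

text \<open>Both sides are brought to a sum over pairs of paths from the two supports, here called
  \<open>A\<close> and \<open>C\<close>. On the left these pairs arise by splitting composites, on
  the right by sorting paths according to their values.\<close>

lemma \<psi>_mul:
  assumes x: "x \<in> acarrier B.kQ" and y: "y \<in> acarrier B.kQ"
  shows "\<psi> (amul B.kQ x y) = amul TX (\<psi> x) (\<psi> y)"
proof
  fix \<zeta>
  define A where "A = {p. x p \<noteq> 0}"
  define C where "C = {q. y q \<noteq> 0}"
  define S where "S = {(p, q) \<in> A \<times> C. pend tB p = fst q}"
  define cat where "cat = (\<lambda>(p, q). (fst p :: 'v, snd p @ snd (q :: ('v, ('v, 'a) path \<times> nat) path)))"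
  have fin: "finite A" "finite C" using x y by (auto simp: A_def C_def B.carrier_iff)
  have finS: "finite S" unfolding S_def by (rule finite_subset[of _ "A \<times> C"]) (use fin in auto)
  have val: "B.valid p" if "p \<in> A" for p using that B.carrier_valid[OF x] by (simp add: A_def)
  have val': "B.valid q" if "q \<in> C" for q using that B.carrier_valid[OF y] by (simp add: C_def)
  have mul: "amul B.kQ x y r = (\<Sum>pq\<in>{pq\<in>S. cat pq = r}. x (fst pq) * y (snd pq))" for r
    unfolding B.amul_kQ by (intro sum.cong) (auto simp: S_def A_def C_def cat_def pcomp_def)
  have "{r. amul B.kQ x y r \<noteq> 0} \<subseteq> cat ` S"
  proof
    fix r assume "r \<in> {r. amul B.kQ x y r \<noteq> 0}"
    then obtain p q where "x p \<noteq> 0" "y q \<noteq> 0" "pcomp tB p q r" by (auto elim: B.mul_nonzeroE)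
    then show "r \<in> cat ` S" by (force simp: S_def A_def C_def cat_def pcomp_def)
  qed
  then have "\<psi> (amul B.kQ x y) \<zeta> = (\<Sum>r\<in>cat ` S. if ev r \<zeta> then amul B.kQ x y r else 0)"
    using finS by (intro \<psi>_superset) auto
  also have "\<dots> = (\<Sum>r\<in>cat ` S. \<Sum>pq\<in>{pq\<in>S. cat pq = r}. if ev (cat pq) \<zeta> then x (fst pq) * y (snd pq) else 0)"
    by (intro sum.cong refl) (auto simp: mul intro!: sum.cong sum.neutral)
  also have "\<dots> = (\<Sum>pq\<in>S. if ev (cat pq) \<zeta> then x (fst pq) * y (snd pq) else 0)"
    using finS by (intro sum.group) auto
  \<comment> \<open>The passage from composable pairs to all pairs is harmless: the values of a pair
    that does not compose have no product.\<close>
  also have "\<dots> = (\<Sum>pq\<in>A \<times> C. if (\<exists>\<xi> \<eta>. ev (fst pq) \<xi> \<and> ev (snd pq) \<eta> \<and> M \<xi> \<eta> \<zeta>)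
        then x (fst pq) * y (snd pq) else 0)"
  proof (intro sum.mono_neutral_cong_left ballI)
    show "finite (A \<times> C)" "S \<subseteq> A \<times> C" using fin by (auto simp: S_def)
  next
    fix pq assume "pq \<in> A \<times> C - S"
    then show "(if (\<exists>\<xi> \<eta>. ev (fst pq) \<xi> \<and> ev (snd pq) \<eta> \<and> M \<xi> \<eta> \<zeta>)
        then x (fst pq) * y (snd pq) else 0) = 0"
      using ev_pcomp[of "fst pq" "snd pq" \<zeta>] val val' by (auto simp: S_def pcomp_def)
  next
    fix pq assume "pq \<in> S"
    then show "(if ev (cat pq) \<zeta> then x (fst pq) * y (snd pq) else 0) =
      (if (\<exists>\<xi> \<eta>. ev (fst pq) \<xi> \<and> ev (snd pq) \<eta> \<and> M \<xi> \<eta> \<zeta>) then x (fst pq) * y (snd pq) else 0)"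
      using ev_pcomp[of "fst pq" "snd pq" \<zeta>] val val' by (auto simp: S_def pcomp_def cat_def)
  qed
  also have "\<dots> = (\<Sum>pq\<in>A \<times> C. \<Sum>\<xi>\<eta>\<in>X \<times> X. if M (fst \<xi>\<eta>) (snd \<xi>\<eta>) \<zeta> \<and> ev (fst pq) (fst \<xi>\<eta>) \<and> ev (snd pq) (snd \<xi>\<eta>)
        then x (fst pq) * y (snd pq) else 0)"
  proof (intro sum.cong refl)
    fix pq assume pq: "pq \<in> A \<times> C"
    let ?P = "\<lambda>\<xi>\<eta>. M (fst \<xi>\<eta>) (snd \<xi>\<eta>) \<zeta> \<and> ev (fst pq) (fst \<xi>\<eta>) \<and> ev (snd pq) (snd \<xi>\<eta>)"
    show "(if (\<exists>\<xi> \<eta>. ev (fst pq) \<xi> \<and> ev (snd pq) \<eta> \<and> M \<xi> \<eta> \<zeta>) then x (fst pq) * y (snd pq) else 0) =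
      (\<Sum>\<xi>\<eta>\<in>X \<times> X. if ?P \<xi>\<eta> then x (fst pq) * y (snd pq) else 0)"
    proof (cases "\<exists>\<xi> \<eta>. ev (fst pq) \<xi> \<and> ev (snd pq) \<eta> \<and> M \<xi> \<eta> \<zeta>")
      case True
      then obtain \<xi> \<eta> where e: "ev (fst pq) \<xi>" "ev (snd pq) \<eta>" "M \<xi> \<eta> \<zeta>" by blast
      \<comment> \<open>Values are unique, so each pair of paths is counted for exactly one pair of
        basis elements.\<close>
      have "?P \<xi>\<eta> \<longleftrightarrow> \<xi>\<eta> = (\<xi>, \<eta>)" for \<xi>\<eta>
        using e evl_unique by (cases \<xi>\<eta>) auto
      then show ?thesis using True M_X[OF e(3)] finite_X by simp
    next
      case False
      then have "(if ?P \<xi>\<eta> then x (fst pq) * y (snd pq) else 0) = 0" for \<xi>\<eta> by auto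
      then show ?thesis by (simp only: False if_False sum.neutral_const)
    qed
  qed
  also have "\<dots> = (\<Sum>\<xi>\<eta>\<in>X \<times> X. \<Sum>pq\<in>A \<times> C. if M (fst \<xi>\<eta>) (snd \<xi>\<eta>) \<zeta> \<and> ev (fst pq) (fst \<xi>\<eta>) \<and> ev (snd pq) (snd \<xi>\<eta>)
        then x (fst pq) * y (snd pq) else 0)"
    by (rule sum.swap)
  also have "\<dots> = (\<Sum>\<xi>\<eta>\<in>X \<times> X. if M (fst \<xi>\<eta>) (snd \<xi>\<eta>) \<zeta> then \<psi> x (fst \<xi>\<eta>) * \<psi> y (snd \<xi>\<eta>) else 0)"
  proof (intro sum.cong refl)
    fix \<xi>\<eta> :: "(('v, 'a) path + ('v, 'a) path) \<times> (('v, 'a) path + ('v, 'a) path)"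
    have "\<psi> x (fst \<xi>\<eta>) * \<psi> y (snd \<xi>\<eta>) =
      (\<Sum>p\<in>A. if ev p (fst \<xi>\<eta>) then x p else 0) * (\<Sum>q\<in>C. if ev q (snd \<xi>\<eta>) then y q else 0)"
      using fin by (simp add: \<psi>_superset[of A] \<psi>_superset[of C] A_def C_def)
    also have "\<dots> = (\<Sum>pq\<in>A \<times> C. if ev (fst pq) (fst \<xi>\<eta>) \<and> ev (snd pq) (snd \<xi>\<eta>) then x (fst pq) * y (snd pq) else 0)"
      by (auto simp: sum_product sum.cartesian_product intro!: sum.cong)
    finally show "(\<Sum>pq\<in>A \<times> C. if M (fst \<xi>\<eta>) (snd \<xi>\<eta>) \<zeta> \<and> ev (fst pq) (fst \<xi>\<eta>) \<and> ev (snd pq) (snd \<xi>\<eta>)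
        then x (fst pq) * y (snd pq) else 0) =
        (if M (fst \<xi>\<eta>) (snd \<xi>\<eta>) \<zeta> then \<psi> x (fst \<xi>\<eta>) * \<psi> y (snd \<xi>\<eta>) else 0)"
      by simp
  qed
  also have "\<dots> = amul TX (\<psi> x) (\<psi> y) \<zeta>"
    by (simp add: conv_alg_def sum.cartesian_product case_prod_unfold)
  finally show "\<psi> (amul B.kQ x y) \<zeta> = amul TX (\<psi> x) (\<psi> y) \<zeta>" .
qed

end

section \<open>The kernel is the Brauer ideal\<close>

context gentle_conn
begin

section \<open>Walks around a maximal path and their values\<close>

lemma bpath_0 [simp]: "bpath h 0 = (E h, [])"
  and bpath_Suc: "bpath h (Suc k) = (E h, snd (bpath h k) @ [(gammaS ^^ k) h])"
  and length_bpath [simp]: "length (snd (bpath h k)) = k"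
  and nth_bpath: "i < k \<Longrightarrow> snd (bpath h k) ! i = (gammaS ^^ i) h"
  by (simp_all add: bpath_def)

lemma valid_bpath:
  assumes "h \<in> nonleaf"
  shows "B.valid (bpath h k) \<and> pend tB (bpath h k) = E ((gammaS ^^ k) h)"
proof (induction k)
  case 0
  then show ?case using assms by (simp add: E_in_V)
next
  case (Suc k)
  have "B.valid (E h, snd (bpath h k))" "pend tB (E h, snd (bpath h k)) = E ((gammaS ^^ k) h)"
    using Suc by simp_all
  then show ?case
    using gammaS_funpow_nonleaf[OF assms] gammaS_nonleaf by (simp add: bpath_Suc E_in_V)
qed

lemma gammaS_full_turn:
  assumes "h \<in> nonleaf"
  shows "(gammaS ^^ Suc (length (snd (fst h)))) h = h"
proof -
  obtain m j where h: "h = (m, j)" "j \<le> length (snd m)" using assms by (auto simp: nonleaf_def)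
  then have "(j + Suc (length (snd m))) mod Suc (length (snd m)) = j"
    unfolding mod_add_self2 by simp
  then show ?thesis using gammaS_funpow[OF h(2), of "Suc (length (snd m))"] h by (simp del: funpow.simps)
qed

lemma pend_full: "h \<in> nonleaf \<Longrightarrow> pend tB (full h) = E h"
  using valid_bpath gammaS_full_turn by metis

text \<open>With n the length of \<open>m\<close>, the cycle has n + 1 arrows, the closing one
  included. Up to position n the value is a segment. A walk that has passed the closing germ and
  stops at position l = j + k - (n + 1) has the form \<open>p m\<^sup>* q\<close> with
  \<open>p\<close> the end of \<open>m\<close> from \<open>j\<close> on and \<open>q\<close> its
  beginning up to l, so what remains is the dual of the segment from l to j.\<close>

lemma ev_bpath:
  assumes "(m, j) \<in> nonleaf" "k \<le> Suc (length (snd m))"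
  shows "ev (bpath (m, j) k) (if j + k \<le> length (snd m) then Inl (seg t m j (j + k))
            else Inr (seg t m (j + k - Suc (length (snd m))) j))"
  using assms(2)
proof (induction k)
  case 0
  then show ?case using assms(1) by (simp add: nonleaf_def gammaE_def)
next
  case (Suc k)
  let ?n = "length (snd m)"
  define \<xi> where "\<xi> = (if j + k \<le> ?n then Inl (seg t m j (j + k)) else Inr (seg t m (j + k - Suc ?n) j))"
  define \<zeta> where "\<zeta> = (if j + Suc k \<le> ?n then Inl (seg t m j (j + Suc k)) else Inr (seg t m (j + Suc k - Suc ?n) j))"
  have m: "m \<in> good" "j \<le> ?n" using assms(1) by (auto simp: nonleaf_def maxp_good)
  have nb: "(gammaS ^^ k) (m, j) \<in> nonleaf" using gammaS_funpow_nonleaf assms(1) by blast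
  have "M \<xi> (germ_val ((gammaS ^^ k) (m, j))) \<zeta>"
  proof -
    \<comment> \<open>The next germ lies before the closing one, is the closing one, or lies after
      it. In the last two cases the closing germ creates a dual, respectively a further arrow
      shortens it on the left.\<close>
    consider "j + k < ?n" | "j + k = ?n" | "j + k > ?n" by linarith
    then show ?thesis
    proof cases
      case 1
      then show ?thesis
        using m good_seg[of m j "Suc (j + k)"] pcomp_seg[of j "j + k" "Suc (j + k)" m t]
        by (simp add: \<xi>_def \<zeta>_def gammaS_funpow)
    next
      case 2
      then show ?thesis
        using m pcomp_seg[of 0 j ?n m t] by (simp add: \<xi>_def \<zeta>_def gammaS_funpow)
    next
      case 3
      define l where "l = j + k - Suc ?n"
      have l: "j + k = l + Suc ?n" "l < j" using 3 Suc.prems by (auto simp: l_def)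
      have "(j + k) mod Suc ?n = l" unfolding l(1) mod_add_self2 using l(2) m by simp
      moreover have "j + Suc k - Suc ?n = Suc l" using l by simp
      ultimately show ?thesis
        using 3 l m good_seg[of m l j] pcomp_seg[of l "Suc l" j m t]
        by (simp add: \<xi>_def \<zeta>_def gammaS_funpow l_def[symmetric])
    qed
  qed
  moreover have "evl (E (m, j)) (snd (bpath (m, j) k)) \<xi>" using Suc by (simp add: \<xi>_def)
  moreover have v: "B.valid (E (m, j), snd (bpath (m, j) k) @ [(gammaS ^^ k) (m, j)])"
    using valid_bpath[OF assms(1), of "Suc k"] by (simp add: bpath_Suc)
  ultimately have "evl (E (m, j)) (snd (bpath (m, j) k) @ [(gammaS ^^ k) (m, j)]) \<zeta>"
    unfolding evl_append[OF v] evl_single[OF nb] by blast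
  then show ?case by (simp add: bpath_Suc \<zeta>_def)
qed

lemma ev_bpath_eq:
  assumes "(m, j) \<in> nonleaf" "k \<le> Suc (length (snd m))" "ev (bpath (m, j) k) \<xi>"
  shows "\<xi> = (if j + k \<le> length (snd m) then Inl (seg t m j (j + k))
            else Inr (seg t m (j + k - Suc (length (snd m))) j))"
  using assms(3) ev_bpath[OF assms(1,2)] by (rule evl_unique)

lemma ev_full: "h \<in> nonleaf \<Longrightarrow> ev (full h) \<xi> \<longleftrightarrow> \<xi> = Inr (E h, [])"
proof -
  assume h: "h \<in> nonleaf"
  obtain m j where "h = (m, j)" by (cases h)
  then have "ev (full h) (Inr (E h, []))"
    using ev_bpath[of m j "Suc (length (snd m))"] h by (simp add: gammaE_def)
  then show ?thesis using evl_unique by blast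
qed

text \<open>The dual of a trivial path lies in the socle: it cannot be shortened further, and two
  duals multiply to zero.\<close>

lemma M_dual_trivial: "h \<in> nonleaf \<Longrightarrow> \<not> M (Inr (v, [])) (germ_val h) \<zeta>"
  by (cases h; cases \<zeta>) (auto simp: pcomp_def seg_def nonleaf_def)

lemma full_snoc_no_ev:
  assumes "h \<in> nonleaf" "g \<in> nonleaf" "B.valid (E h, snd (full h) @ [g])"
  shows "\<not> evl (E h) (snd (full h) @ [g]) \<zeta>"
proof
  assume "evl (E h) (snd (full h) @ [g]) \<zeta>"
  then obtain \<xi> where "evl (E h) (snd (full h)) \<xi>" "M \<xi> (germ_val g) \<zeta>"
    unfolding evl_append[OF assms(3)] evl_single[OF assms(2)] by blast
  moreover from this have "\<xi> = Inr (E h, [])" using ev_full[OF assms(1)] by simp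
  ultimately show False using M_dual_trivial[OF assms(2)] by blast
qed

text \<open>If neither germ is closing, the product is a nonzero path of length two and unique
  continuation applies. If the second one is closing, the arrow must be the last of its maximal
  path; if the first one is, the arrow must be the first. \<open>maxp_unique\<close> then locates
  the arrow. Two closing germs have no product.\<close>

lemma M_germs_successor:
  assumes "h \<in> nonleaf" "g \<in> nonleaf" "M (germ_val h) (germ_val g) \<zeta>"
  shows "g = gammaS h"
proof -
  obtain m j m' j' where hg: "h = (m, j)" "g = (m', j')" by (cases h, cases g)
  have mm: "maxp m" "maxp m'" "j \<le> length (snd m)" "j' \<le> length (snd m')"
    using assms hg by (auto simp: nonleaf_def)
  have gd: "m \<in> good" "m' \<in> good" using mm maxp_good by auto
  have ne: "snd m \<noteq> []" "snd m' \<noteq> []" using mm maxp_nonempty by auto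
  consider "j < length (snd m)" "j' < length (snd m')" | "j < length (snd m)" "j' = length (snd m')"
    | "j = length (snd m)" "j' < length (snd m')" | "j = length (snd m)" "j' = length (snd m')"
    using mm by linarith
  then show ?thesis
  proof cases
    case 1
    then obtain r where r: "r \<in> good" "pcomp t (seg t m j (Suc j)) (seg t m' j' (Suc j')) r"
      using assms(3) hg by (cases \<zeta>) auto
    then have "snd r = [snd m ! j, snd m' ! j']"
      using 1 gd by (simp add: seg_single pcomp_def) auto
    then have st: "step (snd m ! j) (snd m' ! j')" using good_nth_step[OF r(1), of 0] by simp
    have "Suc j < length (snd m)"
    proof (rule ccontr)
      assume "\<not> Suc j < length (snd m)"
      then have "length (snd m) = Suc j" using 1 by simp
      then have "last (snd m) = snd m ! j" using ne by (simp add: last_conv_nth)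
      then show False using st mm by (simp add: maxp_iff)
    qed
    moreover from this have "snd m' ! j' = snd m ! Suc j"
      using good_nth_step[OF gd(1)] st step_right_unique by blast
    ultimately show ?thesis
      using maxp_unique[OF mm(2,1), of j' "Suc j"] 1 hg by (simp add: gammaS_def)
  next
    case 2
    then obtain z where "pcomp t z (seg t m j (Suc j)) m'" using assms(3) hg by (cases \<zeta>) auto
    then have s: "snd m' = snd z @ [snd m ! j]" using 2 gd by (auto simp: seg_single pcomp_def)
    then have "snd m' ! length (snd z) = snd m ! j" by simp
    then have "m' = m \<and> length (snd z) = j"
      using maxp_unique[OF mm(2,1), of "length (snd z)" j] 2 s by simp
    moreover have "length (snd m') = Suc (length (snd z))" using s by simp
    ultimately have "m' = m" "j' = Suc j" using 2 by auto
    then show ?thesis using hg 2 by (simp add: gammaS_def)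
  next
    case 3
    then obtain z where "pcomp t (seg t m' j' (Suc j')) z m" using assms(3) hg by (cases \<zeta>) auto
    then have "snd m = snd m' ! j' # snd z" using 3 gd by (auto simp: seg_single pcomp_def)
    then have "snd m' ! j' = snd m ! 0" by (metis nth_Cons_0)
    then have "m' = m \<and> j' = 0" using maxp_unique[OF mm(2,1), of j' 0] 3 ne by simp
    then show ?thesis using hg 3 by (simp add: gammaS_def)
  next
    case 4
    then show ?thesis using assms(3) hg by (cases \<zeta>) auto
  qed
qed

lemma valid_full_snoc: "h \<in> nonleaf \<Longrightarrow> E g = E h \<Longrightarrow> g \<in> nonleaf \<Longrightarrow> B.valid (E h, snd (full h) @ [g])"
  using valid_bpath[of h "Suc (length (snd (fst h)))"] gammaS_full_turn[of h] gammaS_nonleaf[of g]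
  by (simp add: E_in_V del: funpow.simps)

lemma rels_carrier: "rels \<subseteq> acarrier B.kQ"
proof
  fix x assume "x \<in> rels"
  then consider h h' where "h \<in> nonleaf" "h' \<in> nonleaf" "x = (\<lambda>p. pelem (full h) p + - 1 * pelem (full h') p)"
    | h where "h \<in> nonleaf" "x = pelem (E h, snd (full h) @ [h])"
    | h g where "h \<in> nonleaf" "g \<in> nonleaf" "tB h = E g" "x = pelem (E h, [h, g])"
    unfolding rels_eq by blast
  then show "x \<in> acarrier B.kQ"
  proof cases
    case 1
    then show ?thesis
      using B.add_carrier[OF B.pelem_carrier B.smul_carrier[OF B.pelem_carrier]] valid_bpath by blast
  next
    case 2
    then show ?thesis using valid_full_snoc B.pelem_carrier by blast
  next
    case 3
    then show ?thesis using gammaS_nonleaf[of g] by (auto intro!: B.pelem_carrier simp: E_in_V)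
  qed
qed

section \<open>The Brauer ideal and the kernel of \<open>\<psi>\<close>\<close>

lemma ideal_J: "is_ideal B.kQ J"
  unfolding J_gen by (rule B.is_ideal_gen[OF rels_carrier])

lemma rels_in_J: "rels \<subseteq> J"
  unfolding J_gen ideal_gen_def by blast

text \<open>The kernel is an ideal, so only the generators are checked: full turns over one vertex
  share the value \<open>e\<^sub>i\<^sup>*\<close>, a full turn followed by an arrow has none by
  \<open>M_dual_trivial\<close>, and a pair of non-successive germs has none by
  \<open>M_germs_successor\<close>.\<close>

lemma J_in_kernel: "J \<subseteq> {x \<in> acarrier B.kQ. \<forall>\<xi>. \<psi> x \<xi> = 0}" (is "_ \<subseteq> ?K")
proof -
  have K: "is_ideal B.kQ ?K"
    unfolding is_ideal_def
  proof (intro conjI ballI allI)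
    show "?K \<subseteq> acarrier B.kQ" by blast
    show "azero B.kQ \<in> ?K" using B.zero_carrier by (simp add: \<psi>_def)
    show "aadd B.kQ x y \<in> ?K" if "x \<in> ?K" "y \<in> ?K" for x y
      using that by (simp add: B.add_carrier \<psi>_add)
    show "asmul B.kQ c x \<in> ?K" if "x \<in> ?K" for c x
      using that by (simp add: B.smul_carrier \<psi>_smul)
    fix a x :: "('v, ('v, 'a) path \<times> nat) path \<Rightarrow> 'k"
    assume a: "a \<in> acarrier B.kQ" and "x \<in> ?K"
    then have x: "x \<in> acarrier B.kQ" "\<psi> x = (\<lambda>_. 0)" by auto
    then show "amul B.kQ a x \<in> ?K" "amul B.kQ x a \<in> ?K"
      using a by (simp_all add: B.mul_carrier \<psi>_mul conv_alg_def cong: if_cong)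
  qed
  have "x \<in> ?K" if xr: "x \<in> rels" for x
  proof -
    have xc: "x \<in> acarrier B.kQ" using xr rels_carrier by blast
    consider h h' where "h \<in> nonleaf" "h' \<in> nonleaf" "E h = E h'" "x = (\<lambda>p. pelem (full h) p + - 1 * pelem (full h') p)"
      | h where "h \<in> nonleaf" "x = pelem (E h, snd (full h) @ [h])"
      | h g where "h \<in> nonleaf" "g \<in> nonleaf" "g \<noteq> gammaS h" "x = pelem (E h, [h, g])"
      using xr unfolding rels_eq by blast
    then have "\<psi> x \<xi> = 0" for \<xi>
    proof cases
      case 1
      have c: "pelem (full h) \<in> acarrier B.kQ" "pelem (full h') \<in> acarrier B.kQ"
        using 1 valid_bpath B.pelem_carrier by blast+
      show ?thesis
        unfolding 1(4) \<psi>_add[OF c(1) B.smul_carrier[OF c(2)]] \<psi>_smul[OF c(2)] \<psi>_pelem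
          ev_full[OF 1(1)] ev_full[OF 1(2)] 1(3) by simp
    next
      case 2
      then show ?thesis
        using full_snoc_no_ev[OF 2(1,1) valid_full_snoc] by (simp add: \<psi>_pelem)
    next
      case 3
      have "\<not> evl (E h) [h, g] \<xi>"
        using M_germs_successor[OF 3(1,2)] 3(3) evl_single[OF 3(2)] by auto
      then show ?thesis using 3 by (simp add: \<psi>_pelem)
    qed
    then show ?thesis using xc by simp
  qed
  then show ?thesis using K unfolding J_gen ideal_gen_def by blast
qed

lemma not_successive_in_J:
  "B.valid (v, hs) \<Longrightarrow> \<not> successively (\<lambda>h g. g = gammaS h) hs \<Longrightarrow> pelem (v, hs) \<in> J"
proof (induction hs arbitrary: v rule: induct_list012)
  case (3 h g hs)
  show ?case
  proof (cases "g = gammaS h")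
    case True
    then have "pelem (tB h, g # hs) \<in> J" using 3 by auto
    then show ?thesis
      using 3 by (intro B.ideal_pcomp[OF ideal_J, of "(v, [h])" "(tB h, g # hs)"]) auto
  next
    case False
    then have "h \<in> nonleaf \<and> g \<in> nonleaf \<and> tB h = E g \<and> g \<noteq> gammaS h" "v = E h" using 3 by auto
    then have "pelem (v, [h, g]) \<in> rels" unfolding rels_eq by blast
    then have "pelem (v, [h, g]) \<in> J" using rels_in_J by blast
    then show ?thesis
      using 3 by (intro B.ideal_pcomp[OF ideal_J, of "(v, [h, g])" "(tB g, hs)"]) auto
  qed
qed auto

text \<open>At an edge with a leaf this is a defining relation. Otherwise a second germ
  \<open>h'\<close> lies over the same vertex, and the commutativity relation exchanges the turn of
  \<open>h\<close> for the turn of \<open>h'\<close>. The arrow \<open>h\<close> does not follow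
  that turn around its own vertex, so the new path is in the ideal.\<close>

lemma full_snoc_in_J:
  assumes h: "h \<in> nonleaf"
  shows "pelem (E h, snd (full h) @ [h]) \<in> J"
proof (cases "(E h, []) \<in> Mbar V Arr s t I")
  case True
  then have "pelem (E h, snd (full h) @ [h]) \<in> rels" using h unfolding rels_eq by blast
  then show ?thesis using rels_in_J by blast
next
  case False
  then obtain h' where h': "h' \<in> nonleaf" "E h' = E h" "h' \<noteq> h"
    using trivial_Mbar_iff_unique_germ[OF E_in_V[OF h]] h by blast
  have v: "B.valid (E h, snd (full h) @ [h])" "B.valid (E h', snd (full h') @ [h])"
    using valid_full_snoc[OF h refl h] valid_full_snoc[OF h'(1) h'(2)[symmetric] h] by blast+
  have vh: "B.valid (E h, [h])" using h gammaS_nonleaf[of h] by (simp add: E_in_V)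
  have "(\<lambda>p. pelem (full h) p + - 1 * pelem (full h') p) \<in> J"
  proof (rule subsetD[OF rels_in_J])
    have "h \<in> nonleaf \<and> h' \<in> nonleaf \<and> h \<noteq> h' \<and> E h = E h'" using h h' by auto
    then show "(\<lambda>p. pelem (full h) p + - 1 * pelem (full h') p) \<in> rels" unfolding rels_eq by blast
  qed
  then have "amul B.kQ (\<lambda>p. pelem (full h) p + - 1 * pelem (full h') p) (pelem (E h, [h])) \<in> J"
    by (rule B.ideal_mul_right[OF ideal_J _ B.pelem_carrier[OF vh]])
  also have "amul B.kQ (\<lambda>p. pelem (full h) p + - 1 * pelem (full h') p) (pelem (E h, [h])) =
      (\<lambda>p. pelem (E h, snd (full h) @ [h]) p + - 1 * pelem (E h', snd (full h') @ [h]) p)"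
    using pend_full[OF h] pend_full[OF h'(1)] h'(2)
    by (intro B.pelem_diff_mul) (simp_all add: pcomp_def)
  finally have "(\<lambda>p. pelem (E h, snd (full h) @ [h]) p + - 1 * pelem (E h', snd (full h') @ [h]) p) \<in> J" .
  moreover have "pelem (E h', snd (full h') @ [h]) \<in> J"
  proof (rule not_successive_in_J[OF v(2)])
    \<comment> \<open>The last germ of the turn of \<open>h'\<close> is followed by
      \<open>h'\<close> itself, which differs from \<open>h\<close>.\<close>
    have "gammaS ((gammaS ^^ length (snd (fst h'))) h') \<noteq> h"
      using gammaS_full_turn[OF h'(1)] h'(3) by simp
    then show "\<not> successively (\<lambda>h g. g = gammaS h) (snd (full h') @ [h])"
      by (simp add: bpath_Suc successively_append_iff)
  qed
  ultimately have "(\<lambda>p. (pelem (E h, snd (full h) @ [h]) p + - 1 * pelem (E h', snd (full h') @ [h]) p)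
      + pelem (E h', snd (full h') @ [h]) p) \<in> J"
    by (rule B.ideal_add[OF ideal_J])
  then show ?thesis by simp
qed

lemma long_bpath_in_J:
  assumes h: "h \<in> nonleaf" and k: "Suc (length (snd (fst h))) < k"
  shows "pelem (bpath h k) \<in> J"
  using k
proof (induction k)
  case (Suc k)
  show ?case
  proof (cases "k = Suc (length (snd (fst h)))")
    case True
    then have "bpath h (Suc k) = (E h, snd (full h) @ [h])"
      using gammaS_full_turn[OF h] unfolding bpath_Suc[of h k] by (simp del: funpow.simps)
    then show ?thesis using full_snoc_in_J[OF h] by simp
  next
    case False
    then have "pelem (bpath h k) \<in> J" using Suc by simp
    then show ?thesis
      using valid_bpath[OF h, of k] valid_bpath[OF h, of "Suc k"]
      by (intro B.ideal_pcomp[OF ideal_J, of "bpath h k" "(E ((gammaS ^^ k) h), [(gammaS ^^ k) h])"])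
        (auto simp: pcomp_def bpath_Suc)
  qed
qed simp

text \<open>Normal forms modulo the ideal: a path that changes the vertex it turns around, or turns
  more than once, is already zero.\<close>

lemma path_cases:
  assumes "B.valid r"
  obtains v where "v \<in> V" "r = (v, [])" | "pelem r \<in> J"
  | h k where "h \<in> nonleaf" "0 < k" "k \<le> Suc (length (snd (fst h)))" "r = bpath h k"
proof -
  obtain v hs where r: "r = (v, hs)" by (cases r)
  show thesis
  proof (cases hs)
    case Nil
    then show ?thesis using that(1) assms r by simp
  next
    case (Cons h gs)
    have h: "h \<in> nonleaf" "v = E h" using assms r Cons by auto
    show ?thesis
    proof (cases "successively (\<lambda>h g. g = gammaS h) hs")
      case True
      have "hs ! i = (gammaS ^^ i) h" if "i < length hs" for i
        using that True by (induction i) (auto simp: Cons successively_conv_nth)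
      then have "hs = snd (bpath h (length hs))" by (intro nth_equalityI) (simp_all add: nth_bpath)
      then have "r = bpath h (length hs)" using h r by (metis pair_bpath)
      then show ?thesis
        using that(2) that(3)[OF h(1), of "length hs"] long_bpath_in_J[OF h(1), of "length hs"] Cons
        by (cases "length hs \<le> Suc (length (snd (fst h)))") auto
    next
      case False
      then show ?thesis using that(2) not_successive_in_J assms r by blast
    qed
  qed
qed

text \<open>Every normal form of \<open>path_cases\<close> has a value, so a path without value can
  only be of the kind known to lie in the ideal.\<close>

lemma pelem_in_J_iff:
  assumes "B.valid r"
  shows "pelem r \<in> J \<longleftrightarrow> (\<forall>\<xi>. \<not> ev r \<xi>)"
proof
  assume "pelem r \<in> J"
  then have "\<psi> (pelem r) \<xi> = 0" for \<xi> using J_in_kernel by blast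
  then show "\<forall>\<xi>. \<not> ev r \<xi>" by (metis \<psi>_pelem zero_neq_one)
next
  assume no: "\<forall>\<xi>. \<not> ev r \<xi>"
  show "pelem r \<in> J"
    using assms
  proof (cases rule: path_cases)
    case (1 v)
    then show ?thesis using no by simp
  next
    case (3 h k)
    obtain m j where "h = (m, j)" by (cases h)
    then show ?thesis using 3 no ev_bpath[of m j k] by auto
  qed
qed

text \<open>A nontrivial segment, or its dual, determines the maximal path and both positions by
  \<open>seg_unique\<close>, hence the walk. Only the duals of trivial paths are values of several
  paths; these are full turns, for which the difference is a defining relation.\<close>

lemma equal_ev_diff_in_J:
  assumes v: "B.valid r" "B.valid r'" and ev: "ev r \<xi>" "ev r' \<xi>" and ne: "r \<noteq> r'"
  shows "(\<lambda>p. pelem r p + - 1 * pelem r' p) \<in> J"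
proof -
  \<comment> \<open>The value of a trivial path is not dual, and a nonempty walk with such a value
    has a nontrivial segment as value.\<close>
  have triv: False if r: "B.valid p" "B.valid q" "ev p \<xi>" "ev q \<xi>" "p \<noteq> q" "snd p = []" for p q
    using r(2)
  proof (cases rule: path_cases)
    case (1 v)
    then show ?thesis using that by (cases p) auto
  next
    case 2
    then show ?thesis using that pelem_in_J_iff by blast
  next
    case (3 h k)
    obtain m j where h: "h = (m, j)" by (cases h)
    have "\<xi> = (if j + k \<le> length (snd m) then Inl (seg t m j (j + k))
            else Inr (seg t m (j + k - Suc (length (snd m))) j))"
      using 3 h r(4) by (intro ev_bpath_eq) auto
    moreover have "\<xi> = Inl (fst p, [])" using that by (cases p) simp
    ultimately have "j + k \<le> length (snd m)" "(fst p, []) = seg t m j (j + k)" by (auto split: if_splits)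
    then have "k = 0" using length_seg[of "j + k" m t j] by (metis add_diff_cancel_left' list.size(3) snd_conv)
    then show ?thesis using 3 that by simp
  qed
  have bp: "\<exists>h k. h \<in> nonleaf \<and> 0 < k \<and> k \<le> Suc (length (snd (fst h))) \<and> p = bpath h k"
    if "B.valid p" "ev p \<xi>" "snd p \<noteq> []" for p
    using that(1)
  proof (cases rule: path_cases)
    case 2
    then show ?thesis using that pelem_in_J_iff by blast
  next
    case 3
    then show ?thesis by blast
  qed (use that in simp)
  have "snd r \<noteq> []" "snd r' \<noteq> []"
    using triv[OF v ev ne] triv[OF v(2,1) ev(2,1) ne[symmetric]] by auto
  note bps = bp[OF v(1) ev(1) this(1)] bp[OF v(2) ev(2) this(2)]
  then obtain h k h' k' where hk: "h \<in> nonleaf" "0 < k" "k \<le> Suc (length (snd (fst h)))" "r = bpath h k"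
    and hk': "h' \<in> nonleaf" "0 < k'" "k' \<le> Suc (length (snd (fst h')))" "r' = bpath h' k'"
    by blast
  obtain m j where h: "h = (m, j)" by (cases h)
  obtain m' j' where h': "h' = (m', j')" by (cases h')
  let ?n = "length (snd m)" and ?n' = "length (snd m')"
  have mm: "maxp m" "maxp m'" and jn: "j \<le> ?n" "j' \<le> ?n'" using hk hk' h h' by (auto simp: nonleaf_def)
  have x: "\<xi> = (if j + k \<le> ?n then Inl (seg t m j (j + k)) else Inr (seg t m (j + k - Suc ?n) j))"
    using ev(1) hk h by (intro ev_bpath_eq) auto
  have x': "\<xi> = (if j' + k' \<le> ?n' then Inl (seg t m' j' (j' + k')) else Inr (seg t m' (j' + k' - Suc ?n') j'))"
    using ev(2) hk' h' by (intro ev_bpath_eq) auto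
  show ?thesis
  proof (cases "j + k \<le> ?n")
    case True
    then have "j' + k' \<le> ?n'" "seg t m j (j + k) = seg t m' j' (j' + k')"
      using x x' by (auto split: if_splits)
    then have "m = m' \<and> j = j' \<and> j + k = j' + k'" using mm hk True by (intro seg_unique) auto
    then have "h = h'" "k = k'" using h h' by auto
    then show ?thesis using ne hk hk' by simp
  next
    case False
    define l where "l = j + k - Suc ?n"
    define l' where "l' = j' + k' - Suc ?n'"
    have nle: "\<not> j' + k' \<le> ?n'" and eq: "seg t m l j = seg t m' l' j'"
      using x x' False by (auto simp: l_def l'_def split: if_splits)
    have l: "l \<le> j" "l' \<le> j'" "j + k = l + Suc ?n" "j' + k' = l' + Suc ?n'"
      using False nle hk hk' h h' by (auto simp: l_def l'_def)
    show ?thesis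
    \<comment> \<open>Equality means exactly a full turn; there the segment is trivial and
      \<open>seg_unique\<close> does not apply.\<close>
    proof (cases "l = j")
      case True
      have "length (snd (seg t m l j)) = length (snd (seg t m' l' j'))" using eq by simp
      then have "l' = j'" using True l jn by simp
      then have "k = Suc ?n" "k' = Suc ?n'" "E h = E h'"
        using True l eq h h' by (auto simp: gammaE_def)
      then have "r = full h" "r' = full h'" "h \<noteq> h'" "E h = E h'" using hk hk' h h' ne by auto
      then have "(\<lambda>p. pelem r p + - 1 * pelem r' p) \<in> rels"
        using hk(1) hk'(1) unfolding rels_eq by blast
      then show ?thesis using rels_in_J by blast
    next
      case False
      then have "m = m' \<and> l = l' \<and> j = j'" using mm l jn eq by (intro seg_unique) auto
      then have "h = h'" "k = k'" using l h h' by auto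
      then show ?thesis using ne hk hk' by simp
    qed
  qed
qed

text \<open>Induction on the size of the support. A suitable multiple of an element \<open>d\<close>
  of the ideal cancels the coefficient at \<open>r\<close>; since \<open>d\<close> is supported
  where \<open>x\<close> is, no new paths appear.\<close>

lemma kernel_in_J:
  assumes "x \<in> acarrier B.kQ" "\<And>\<xi>. \<psi> x \<xi> = 0"
  shows "x \<in> J"
  using assms
proof (induction "card {r. x r \<noteq> 0}" arbitrary: x rule: less_induct)
  case less
  have fin: "finite {r. x r \<noteq> 0}" using less.prems(1) by (simp add: B.carrier_iff)
  show ?case
  proof (cases "\<exists>r. x r \<noteq> 0")
    case False
    then have "x = azero B.kQ" by auto
    then show ?thesis using ideal_J by (simp add: is_ideal_def)
  next
    case True
    then obtain r where r: "x r \<noteq> 0" by blast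
    have vr: "B.valid r" using B.carrier_valid[OF less.prems(1) r] .
    obtain d where d: "d \<in> J" "d r = 1" "\<And>p. d p \<noteq> 0 \<Longrightarrow> x p \<noteq> 0"
    proof (cases "\<exists>\<xi>. ev r \<xi>")
      case False
      then have "pelem r \<in> J" using pelem_in_J_iff vr by blast
      then show ?thesis
      proof (rule that)
        show "x p \<noteq> 0" if "pelem r p \<noteq> (0::'k)" for p
          using that r by (auto simp: pelem_def split: if_splits)
      qed (simp add: pelem_def)
    next
      case True
      then obtain \<xi> where \<xi>: "ev r \<xi>" by blast
      \<comment> \<open>The coefficients of all paths with value \<open>\<xi>\<close> add up to
        zero, so \<open>r\<close> cannot be the only one in the support.\<close>
      have "\<exists>r'. r' \<noteq> r \<and> x r' \<noteq> 0 \<and> ev r' \<xi>"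
      proof (rule ccontr)
        assume "\<not> ?thesis"
        then have "x p \<noteq> 0 \<and> ev p \<xi> \<longleftrightarrow> p = r" for p using r \<xi> by blast
        then have "{p. x p \<noteq> 0 \<and> ev p \<xi>} = {r}" by simp
        then have "\<psi> x \<xi> = x r" by (simp add: \<psi>_def)
        then show False using less.prems r by simp
      qed
      then obtain r' where r': "r' \<noteq> r" "x r' \<noteq> 0" "ev r' \<xi>" by blast
      have "(\<lambda>p. pelem r p + - 1 * pelem r' p) \<in> J"
        using r' \<xi> vr B.carrier_valid[OF less.prems(1) r'(2)] by (intro equal_ev_diff_in_J[of r r' \<xi>]) auto
      then show ?thesis
      proof (rule that)
        show "x p \<noteq> 0" if "pelem r p + - 1 * pelem r' p \<noteq> (0::'k)" for p
          using that r r' by (auto simp: pelem_def split: if_splits)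
      qed (use r' in \<open>auto simp: pelem_def\<close>)
    qed
    define y where "y = (\<lambda>p. x p + (- x r) * d p)"
    have dc: "d \<in> acarrier B.kQ" "\<And>\<xi>. \<psi> d \<xi> = 0" using d(1) J_in_kernel by auto
    have yc: "y \<in> acarrier B.kQ"
      unfolding y_def using B.add_carrier[OF less.prems(1) B.smul_carrier[OF dc(1)]] .
    have sub: "{p. y p \<noteq> 0} \<subset> {p. x p \<noteq> 0}"
    proof
      show "{p. y p \<noteq> 0} \<subseteq> {p. x p \<noteq> 0}" using d(3) by (force simp: y_def)
      show "{p. y p \<noteq> 0} \<noteq> {p. x p \<noteq> 0}"
      proof
        assume eq: "{p. y p \<noteq> 0} = {p. x p \<noteq> 0}"
        have "r \<in> {p. y p \<noteq> 0}" unfolding eq using r by simp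
        then show False using d(2) by (simp add: y_def)
      qed
    qed
    have "\<psi> y \<xi> = 0" for \<xi>
      unfolding y_def \<psi>_add[OF less.prems(1) B.smul_carrier[OF dc(1)]] \<psi>_smul[OF dc(1)]
      using less.prems(2) dc(2) by simp
    then have "y \<in> J" using less.hyps[OF psubset_card_mono[OF fin sub] yc] by blast
    moreover have "(\<lambda>p. x r * d p) \<in> J" using B.ideal_smul[OF ideal_J d(1)] .
    ultimately have "(\<lambda>p. y p + x r * d p) \<in> J"
      by (rule B.ideal_add[OF ideal_J])
    then show ?thesis by (simp add: y_def)
  qed
qed

lemma J_iff: "x \<in> J \<longleftrightarrow> x \<in> acarrier B.kQ \<and> (\<forall>\<xi>. \<psi> x \<xi> = 0)"
  using J_in_kernel kernel_in_J by blast

text \<open>Every good path is a segment of a maximal path; for trivial paths this uses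
  \<open>incident\<close>. A segment is reached by walking along it, its dual by walking the rest of
  the cycle.\<close>

lemma ev_onto:
  assumes "\<xi> \<in> X"
  shows "\<exists>r. B.valid r \<and> ev r \<xi>"
proof -
  have seg: "\<exists>m l j. maxp m \<and> l \<le> j \<and> j \<le> length (snd m) \<and> y = seg t m l j" if y: "y \<in> good" for y
  proof (cases "snd y = []")
    case False
    then obtain m l where "maxp m" "l + length (snd y) \<le> length (snd m)" "seg t m l (l + length (snd y)) = y"
      using maxp_through[OF y] by blast
    then show ?thesis by (intro exI[of _ m] exI[of _ l] exI[of _ "l + length (snd y)"]) simp
  next
    case True
    obtain v where v: "y = (v, [])" using True by (cases y) auto
    then have "v \<in> V" using y by simp
    then obtain h where "h \<in> nonleaf" "E h = v"
      using incident germ_at_in_arrow germ_at_out_arrow by metis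
    then show ?thesis using v by (cases h) (force simp: nonleaf_def gammaE_def)
  qed
  show ?thesis
  proof (cases \<xi>)
    case (Inl y)
    have "y \<in> good" using assms Inl by (auto simp: X_def)
    then obtain m l j where m: "maxp m" "l \<le> j" "j \<le> length (snd m)" "y = seg t m l j"
      using seg by blast
    then have "(m, l) \<in> nonleaf" by (simp add: nonleaf_def)
    then show ?thesis
      using ev_bpath[of m l "j - l"] valid_bpath[of "(m, l)" "j - l"] m Inl by fastforce
  next
    case (Inr y)
    have "y \<in> good" using assms Inr by (auto simp: X_def)
    then obtain m l j where m: "maxp m" "l \<le> j" "j \<le> length (snd m)" "y = seg t m l j"
      using seg by blast
    then have nb: "(m, j) \<in> nonleaf" by (simp add: nonleaf_def)
    \<comment> \<open>From position \<open>j\<close> over the closing germ on to position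
      \<open>l\<close>: the full turn minus the \<open>j - l\<close> arrows of the segment.\<close>
    define k where "k = Suc (length (snd m)) + l - j"
    have "k \<le> Suc (length (snd m))" "j + k = Suc (length (snd m)) + l" using m by (auto simp: k_def)
    then have "ev (bpath (m, j) k) (Inr y)" using ev_bpath[OF nb, of k] m by simp
    then show ?thesis using valid_bpath[OF nb] Inr by blast
  qed
qed

lemma \<psi>_onto: "\<psi> ` acarrier B.kQ = acarrier TX"
proof (intro equalityI subsetI)
  fix c assume "c \<in> \<psi> ` acarrier B.kQ"
  then show "c \<in> acarrier TX" using \<psi>_carrier by blast
next
  fix c assume c: "c \<in> acarrier TX"
  \<comment> \<open>One chosen path for each basis element; uniqueness of values makes the choice
    injective.\<close>
  obtain r where r: "\<And>\<xi>. \<xi> \<in> X \<Longrightarrow> B.valid (r \<xi>) \<and> ev (r \<xi>) \<xi>" using ev_onto by metis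
  have inj: "inj_on r X" by (rule inj_onI) (metis r evl_unique)
  define x where "x p = (if p \<in> r ` X then c (inv_into X r p) else 0)" for p
  have xr: "x (r \<xi>) = c \<xi>" if "\<xi> \<in> X" for \<xi> using that inj by (simp add: x_def)
  have sub: "{p. x p \<noteq> 0} \<subseteq> r ` X" by (auto simp: x_def)
  have xc: "x \<in> acarrier B.kQ"
    unfolding B.carrier_iff using finite_subset[OF sub] finite_X sub r by blast
  have "\<psi> x \<zeta> = c \<zeta>" for \<zeta>
  proof -
    have "\<psi> x \<zeta> = (\<Sum>p\<in>r ` X. if ev p \<zeta> then x p else 0)"
      using finite_X sub by (intro \<psi>_superset) auto
    also have "\<dots> = (\<Sum>\<xi>\<in>X. if ev (r \<xi>) \<zeta> then x (r \<xi>) else 0)"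
      by (simp add: sum.reindex[OF inj])
    also have "\<dots> = (\<Sum>\<xi>\<in>X. if \<zeta> = \<xi> then c \<xi> else 0)"
      by (intro sum.cong refl) (use r xr evl_unique in \<open>metis\<close>)
    also have "\<dots> = c \<zeta>" using finite_X c by (simp add: conv_alg_def)
    finally show ?thesis .
  qed
  then have "\<psi> x = c" by blast
  then show "c \<in> \<psi> ` acarrier B.kQ" using xc by blast
qed

lemma TX_iso_brauer:
  "kalg_iso TX (brauer_alg V H fst (gammaE t) gammaS (\<lambda>_. 1))"
proof -
  have "kalg_iso TX (quot_alg B.kQ J)"
  proof (rule kalg_iso_quot_kernel[where \<psi> = \<psi>])
    fix x y :: "('v, ('v, 'a) path \<times> nat) path \<Rightarrow> 'k"
    assume xy: "x \<in> acarrier B.kQ" "y \<in> acarrier B.kQ"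
    have "aadd B.kQ y (asmul B.kQ (-1) x) \<in> acarrier B.kQ"
      using B.add_carrier[OF xy(2) B.smul_carrier[OF xy(1), of "-1"]] by simp
    moreover have "\<psi> (aadd B.kQ y (asmul B.kQ (-1) x)) \<xi> = \<psi> y \<xi> + - 1 * \<psi> x \<xi>" for \<xi>
      unfolding B.aadd_kQ B.asmul_kQ \<psi>_add[OF xy(2) B.smul_carrier[OF xy(1)]] \<psi>_smul[OF xy(1)] ..
    ultimately show "aadd B.kQ y (asmul B.kQ (-1) x) \<in> J \<longleftrightarrow> \<psi> y = \<psi> x"
      unfolding J_iff by (simp add: fun_eq_iff)
  next
    fix x y :: "('v, ('v, 'a) path \<times> nat) path \<Rightarrow> 'k"
    assume xy: "x \<in> acarrier B.kQ" "y \<in> acarrier B.kQ"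
    show "\<psi> (aadd B.kQ x y) = aadd TX (\<psi> x) (\<psi> y)"
      using \<psi>_add[OF xy] by (simp add: conv_alg_def fun_eq_iff)
  next
    fix c and x :: "('v, ('v, 'a) path \<times> nat) path \<Rightarrow> 'k"
    assume "x \<in> acarrier B.kQ"
    then show "\<psi> (asmul B.kQ c x) = asmul TX c (\<psi> x)"
      using \<psi>_smul by (simp add: conv_alg_def fun_eq_iff)
  qed (use \<psi>_onto \<psi>_one \<psi>_mul B.one_carrier B.add_carrier B.mul_carrier B.smul_carrier in simp_all)
  then show ?thesis
    unfolding brauer_alg_def brauer_pathalg_def brauer_arrows_eq .
qed

end

section \<open>The ribbon graph\<close>

context gentle_conn
begin

lemma full_Cons:
  "full h = (E h, h # map (\<lambda>i. (gammaS ^^ Suc i) h) [0..<length (snd (fst h))])"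
  unfolding bpath_def
  by (subst upt_conv_Cons) (simp_all del: funpow.simps upt_Suc add: map_Suc_upt[symmetric] o_def)

lemma hd_full [simp]: "hd (snd (full h)) = h"
  and full_nonempty [simp]: "snd (full h) \<noteq> []"
  by (simp_all add: full_Cons del: funpow.simps)

lemma full_inject [simp]: "full h = full h' \<longleftrightarrow> h = h'"
  by (metis hd_full)

lemma fst_gammaS [simp]: "fst (gammaS h) = fst h"
  by (simp add: gammaS_def)

lemma fst_gammaS_funpow [simp]: "fst ((gammaS ^^ k) h) = fst h"
  by (induction k) simp_all

lemma rotp_full:
  assumes "h \<in> nonleaf"
  shows "rotp tB (full h) = full (gammaS h)"
proof -
  let ?n = "length (snd (fst h))"
  have "rotp tB (full h) = (tB h, map (\<lambda>i. (gammaS ^^ Suc i) h) [0..<?n] @ [h])"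
    by (simp add: full_Cons del: funpow.simps)
  also have "\<dots> = (tB h, map (\<lambda>i. (gammaS ^^ Suc i) h) [0..<Suc ?n])"
    using gammaS_full_turn[OF assms] by (simp del: funpow.simps)
  also have "\<dots> = full (gammaS h)"
    unfolding bpath_def by (simp add: funpow_swap1 del: upt_Suc)
  finally show ?thesis .
qed

text \<open>Rotating a full turn moves its starting germ to the successor, and the successor
  permutes the germs on one maximal path in a single cycle. Rotation classes thus correspond to
  maximal paths.\<close>

lemma rotclass_full:
  assumes "h \<in> nonleaf"
  shows "rotclass tB (full h) = {full g | g. g \<in> nonleaf \<and> fst g = fst h}"
proof -
  have pow: "(rotp tB ^^ k) (full h) = full ((gammaS ^^ k) h)" for k
  proof (induction k)
    case (Suc k)
    then show ?case using rotp_full[OF gammaS_funpow_nonleaf[OF assms, of k]] by simp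
  qed simp
  have orbit: "\<exists>k. g = (gammaS ^^ k) h" if g: "g \<in> nonleaf" "fst g = fst h" for g
  proof -
    obtain m j l where h: "h = (m, j)" "g = (m, l)" using g(2) by (cases h, cases g) auto
    let ?n = "length (snd m)"
    have le: "j \<le> ?n" "l \<le> ?n" using assms g h by (auto simp: nonleaf_def)
    \<comment> \<open>The number of steps from \<open>j\<close> to \<open>l\<close>; adding a whole
      turn keeps the subtraction of natural numbers exact.\<close>
    then have "j + (l + Suc ?n - j) = l + Suc ?n" by simp
    then have "(j + (l + Suc ?n - j)) mod Suc ?n = l" using le(2) by (simp only: mod_add_self2) simp
    then show ?thesis using gammaS_funpow[OF le(1)] h by metis
  qed
  show ?thesis
    unfolding rotclass_def pow
  proof (intro equalityI subsetI)
    fix x assume "x \<in> range (\<lambda>k. full ((gammaS ^^ k) h))"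
    then obtain k where "x = full ((gammaS ^^ k) h)" by blast
    then show "x \<in> {full g | g. g \<in> nonleaf \<and> fst g = fst h}"
      using gammaS_funpow_nonleaf[OF assms, of k] fst_gammaS_funpow by blast
  next
    fix x assume "x \<in> {full g | g. g \<in> nonleaf \<and> fst g = fst h}"
    then obtain g where "x = full g" "g \<in> nonleaf" "fst g = fst h" by blast
    then show "x \<in> range (\<lambda>k. full ((gammaS ^^ k) h))" using orbit[of g] by blast
  qed
qed

lemma rotclass_trivial: "rotclass tB (i, []) = {(i, [])}"
proof -
  have "(rotp tB ^^ k) (i, []) = (i, [])" for k by (induction k) simp_all
  then show ?thesis by (simp add: rotclass_def)
qed

text \<open>A walk shorter than a full turn still has a value after one more step along the cycle,
  so it is not maximal. After a full turn no arrow leads to a value any more.\<close>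

lemma maxfrom_eq: "maxfrom V nonleaf (gammaE t) tB J i = full ` {h \<in> nonleaf. E h = i}"
proof (intro equalityI subsetI)
  fix p assume "p \<in> maxfrom V nonleaf (gammaE t) tB J i"
  then have p: "B.valid p" "fst p = i" "snd p \<noteq> []" "pelem p \<notin> J"
    and mx: "\<And>a. a \<in> nonleaf \<Longrightarrow> E a = pend tB p \<Longrightarrow> pelem (fst p, snd p @ [a]) \<in> J"
    by (auto simp: maxfrom_def)
  obtain h k where hk: "h \<in> nonleaf" "k \<le> Suc (length (snd (fst h)))" "p = bpath h k"
    using p(1) by (cases rule: path_cases) (use p in auto)
  have "k = Suc (length (snd (fst h)))"
  proof (rule ccontr)
    assume "k \<noteq> Suc (length (snd (fst h)))"
    then have "Suc k \<le> Suc (length (snd (fst h)))" using hk by simp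
    moreover obtain m j where "h = (m, j)" by (cases h)
    ultimately have "pelem (bpath h (Suc k)) \<notin> J"
      using ev_bpath[of m j "Suc k"] hk(1) valid_bpath[OF hk(1)] pelem_in_J_iff by auto
    then show False
      using mx[of "(gammaS ^^ k) h"] valid_bpath[OF hk(1), of k] gammaS_funpow_nonleaf[OF hk(1)] hk
      by (simp add: bpath_Suc)
  qed
  then show "p \<in> full ` {h \<in> nonleaf. E h = i}" using hk p by auto
next
  fix p assume "p \<in> full ` {h \<in> nonleaf. E h = i}"
  then obtain h where h: "h \<in> nonleaf" "E h = i" "p = full h" by blast
  have v: "B.valid (full h)" "pend tB (full h) = E h"
    using valid_bpath[OF h(1)] gammaS_full_turn[OF h(1)] by (simp_all del: funpow.simps)
  have "pelem (full h) \<notin> J"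
    using pelem_in_J_iff[OF v(1)] ev_full[OF h(1)] by blast
  moreover have "pelem (E h, snd (full h) @ [a]) \<in> J" if "a \<in> nonleaf" "E a = E h" for a
    using full_snoc_no_ev[OF h(1) that(1)] valid_full_snoc[OF h(1) that(2,1)] pelem_in_J_iff by auto
  ultimately show "p \<in> maxfrom V nonleaf (gammaE t) tB J i"
    using v h by (simp add: maxfrom_def)
qed

text \<open>The case of a single maximal path at \<open>i\<close> is the case of a single nontrivial
  germ over \<open>i\<close>. So the trivial path is added exactly where the other graph has a
  leaf.\<close>

lemma cpaths_eq:
  assumes "i \<in> V"
  shows "cpaths V nonleaf (gammaE t) tB J i = full ` {h \<in> nonleaf. E h = i} \<union>
    (if (i, []) \<in> Mbar V Arr s t I then {(i, [])} else {})"
proof -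
  have "card S = 1 \<longleftrightarrow> (\<exists>!x. x \<in> S)" for S :: "(('v, 'a) path \<times> nat) set"
    unfolding is_singleton_altdef[symmetric] by (rule is_singleton_iff_ex1)
  from this[of "{h \<in> nonleaf. E h = i}"]
  have card: "card {h \<in> nonleaf. E h = i} = 1 \<longleftrightarrow> (i, []) \<in> Mbar V Arr s t I"
    unfolding trivial_Mbar_iff_unique_germ[OF assms] mem_Collect_eq .
  have "inj_on full {h \<in> nonleaf. E h = i}" by (rule inj_onI) (simp only: full_inject)
  then have "card (full ` {h \<in> nonleaf. E h = i}) = 1 \<longleftrightarrow> (i, []) \<in> Mbar V Arr s t I"
    unfolding card[symmetric] by (simp only: card_image)
  then show ?thesis unfolding cpaths_def maxfrom_eq by (cases "(i, []) \<in> Mbar V Arr s t I") simp_all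
qed

definition cyc_germ :: "('v, 'a) path \<times> nat \<Rightarrow> 'v \<times> ('v, ('v, 'a) path \<times> nat) path" where
  "cyc_germ h = (E h, if snd (fst h) = [] then (E h, []) else full h)"

text \<open>The inverse of \<open>cyc_germ\<close> on \<open>H\<close>: arrows of the Brauer quiver
  are germs, so a full turn records its starting germ as its first arrow.\<close>

definition germ_of :: "'v \<times> ('v, ('v, 'a) path \<times> nat) path \<Rightarrow> ('v, 'a) path \<times> nat" where
  "germ_of g = (if snd (snd g) = [] then ((fst g, []), 0) else hd (snd (snd g)))"

section \<open>Comparison of the germs of the two graphs\<close>

lemma H_cases:
  assumes "h \<in> H"
  obtains "h \<in> nonleaf" "snd (fst h) \<noteq> []" "cyc_germ h = (E h, full h)"
  | i where "h = ((i, []), 0)" "(i, []) \<in> Mbar V Arr s t I" "E h = i" "cyc_germ h = (i, (i, []))" "gammaS h = h"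
proof (cases "snd (fst h) = []")
  case True
  then obtain i j where h: "h = ((i, []), j)" by (metis prod.collapse)
  then have "(i, []) \<in> Mbar V Arr s t I" "j = 0" using assms by (auto simp: gammaH_def)
  then show ?thesis using that(2)[of i] h by (simp add: cyc_germ_def gammaE_def pverts_def gammaS_def)
next
  case False
  then show ?thesis using that(1) assms by (simp add: nonleaf_iff cyc_germ_def)
qed

lemma gammaS_H: "h \<in> H \<Longrightarrow> gammaS h \<in> H"
  by (auto simp: gammaH_def gammaS_def less_Suc_eq_le[symmetric])

lemma germ_of_cyc_germ: "h \<in> H \<Longrightarrow> germ_of (cyc_germ h) = h"
  by (erule H_cases) (simp_all add: germ_of_def)

lemma fst_cyc_germ [simp]: "fst (cyc_germ h) = E h"
  by (simp add: cyc_germ_def)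

lemma GH_eq: "GH V nonleaf (gammaE t) tB J = cyc_germ ` H"
proof (intro equalityI subsetI)
  fix g assume "g \<in> GH V nonleaf (gammaE t) tB J"
  then obtain i p where g: "g = (i, p)" "i \<in> V" "p \<in> cpaths V nonleaf (gammaE t) tB J i" by (auto simp: GH_def)
  then consider h where "h \<in> nonleaf" "E h = i" "p = full h" | "(i, []) \<in> Mbar V Arr s t I" "p = (i, [])"
    unfolding cpaths_eq[OF g(2)] by (auto split: if_splits)
  then show "g \<in> cyc_germ ` H"
  proof cases
    case 1
    then have "g = cyc_germ h" "h \<in> H" using g by (simp_all add: cyc_germ_def nonleaf_iff)
    then show ?thesis by blast
  next
    case 2
    then have "g = cyc_germ ((i, []), 0)" "((i, []), 0) \<in> H"
      using g by (simp_all add: cyc_germ_def gammaE_def pverts_def gammaH_def)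
    then show ?thesis by blast
  qed
next
  fix g assume "g \<in> cyc_germ ` H"
  then obtain h where h: "h \<in> H" "g = cyc_germ h" by blast
  from h(1) show "g \<in> GH V nonleaf (gammaE t) tB J"
  proof (cases rule: H_cases)
    case 1
    then have V: "E h \<in> V" using E_in_V by blast
    then have "full h \<in> cpaths V nonleaf (gammaE t) tB J (E h)" unfolding cpaths_eq[OF V] using 1 by blast
    then show ?thesis using h 1 V unfolding GH_def by simp
  next
    case (2 i)
    then have V: "i \<in> V" by (simp add: trivial_Mbar_iff)
    then have "(i, []) \<in> cpaths V nonleaf (gammaE t) tB J i" unfolding cpaths_eq[OF V] using 2 by simp
    then show ?thesis using h 2 V unfolding GH_def by simp
  qed
qed

lemma Gsucc_cyc_germ: "h \<in> H \<Longrightarrow> Gsucc tB (cyc_germ h) = cyc_germ (gammaS h)"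
  by (erule H_cases) (simp_all add: Gsucc_def rotp_full cyc_germ_def)

lemma Gvert_eq_iff:
  assumes "h \<in> H" "h' \<in> H"
  shows "Gvert tB (cyc_germ h) = Gvert tB (cyc_germ h') \<longleftrightarrow> fst h = fst h'"
proof -
  have mem: "snd (cyc_germ h) \<in> Gvert tB (cyc_germ h)" for h
    unfolding Gvert_def rotclass_def by (rule range_eqI[of _ _ 0]) simp
  from assms(1) show ?thesis
  proof (cases rule: H_cases)
    case 1
    note h = 1
    from assms(2) show ?thesis
    proof (cases rule: H_cases)
      case 1
      show ?thesis
      proof
        assume "Gvert tB (cyc_germ h) = Gvert tB (cyc_germ h')"
        then have "full h \<in> rotclass tB (full h')" using mem[of h] h 1 by (simp add: Gvert_def)
        then obtain g where "full h = full g" "fst g = fst h'" unfolding rotclass_full[OF 1(1)] by blast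
        then show "fst h = fst h'" by (metis full_inject)
      next
        assume eq: "fst h = fst h'"
        have "rotclass tB (full h) = rotclass tB (full h')"
          using rotclass_full[OF h(1)] rotclass_full[OF 1(1)] by (simp only: eq)
        then show "Gvert tB (cyc_germ h) = Gvert tB (cyc_germ h')" using h 1 by (simp add: Gvert_def)
      qed
    next
      case (2 i)
      have "full h \<notin> {(i, [])}" by (metis full_nonempty singletonD snd_conv)
      then show ?thesis using h 2 mem[of h] by (auto simp: Gvert_def rotclass_trivial)
    qed
  next
    case (2 i)
    note h = 2
    from assms(2) show ?thesis
    proof (cases rule: H_cases)
      case 1
      have "full h' \<notin> {(i, [])}" by (metis full_nonempty singletonD snd_conv)
      then have "Gvert tB (cyc_germ h) \<noteq> Gvert tB (cyc_germ h')"
        using h(4) 1(3) mem[of h'] by (auto simp: Gvert_def rotclass_trivial)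
      moreover have "fst h \<noteq> fst h'" using h(1) 1(2) by (metis fst_conv snd_conv)
      ultimately show ?thesis by blast
    next
      case (2 i')
      then show ?thesis using h by (simp add: Gvert_def rotclass_trivial)
    qed
  qed
qed

text \<open>Needed for the multiplicities: a proper power of a nonempty path would repeat an
  arrow.\<close>

lemma distinct_full:
  assumes "h \<in> nonleaf"
  shows "distinct (snd (full h))"
proof -
  obtain m j where h: "h = (m, j)" "j \<le> length (snd m)" using assms by (auto simp: nonleaf_def)
  let ?n = "Suc (length (snd m))"
  have lt: False if "a < b" "b < ?n" "(j + a) mod ?n = (j + b) mod ?n" for a b
  proof -
    have "?n dvd (j + b) - (j + a)" using that mod_eq_dvd_iff_nat[of "j + a" "j + b" ?n] by simp
    then have "?n dvd b - a" by simp
    then show False using that by (auto dest: dvd_imp_le)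
  qed
  have "inj_on (\<lambda>i. (gammaS ^^ i) h) {0..<?n}"
  proof (rule inj_onI)
    fix a b assume "a \<in> {0..<?n}" "b \<in> {0..<?n}" "(gammaS ^^ a) h = (gammaS ^^ b) h"
    then have "a < ?n" "b < ?n" "(j + a) mod ?n = (j + b) mod ?n"
      using h by (auto simp: gammaS_funpow)
    then show "a = b" using lt[of a b] lt[of b a] by (metis linorder_neqE_nat)
  qed
  then show ?thesis using h by (simp add: bpath_def distinct_map del: upt_Suc)
qed

lemma Gmult_cyc_germ:
  assumes "h \<in> H"
  shows "Gmult (Gvert tB (cyc_germ h)) = 1"
  using assms
proof (cases rule: H_cases)
  case (2 i)
  then show ?thesis by (simp add: Gmult_def Gvert_def rotclass_trivial)
next
  case 1
  let ?\<nu> = "Gvert tB (cyc_germ h)"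
  have \<nu>: "?\<nu> = {full g | g. g \<in> nonleaf \<and> fst g = fst h}" using 1 by (simp add: Gvert_def rotclass_full)
  have "(GREATEST m. \<exists>p\<in>?\<nu>. \<exists>q. q \<noteq> [] \<and> snd p = concat (replicate m q)) = 1"
  proof (rule Greatest_equality)
    show "\<exists>p\<in>?\<nu>. \<exists>q. q \<noteq> [] \<and> snd p = concat (replicate 1 q)"
    proof (intro bexI exI conjI)
      show "full h \<in> ?\<nu>" unfolding \<nu> using 1 by blast
      show "snd (full h) = concat (replicate 1 (snd (full h)))" by simp
    qed simp
  next
    fix m assume "\<exists>p\<in>?\<nu>. \<exists>q. q \<noteq> [] \<and> snd p = concat (replicate m q)"
    then obtain g q where gq: "g \<in> nonleaf" "q \<noteq> []" "snd (full g) = concat (replicate m q)"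
      unfolding \<nu> by blast
    show "m \<le> 1"
    proof (rule ccontr)
      assume "\<not> m \<le> 1"
      then obtain k where "m = Suc (Suc k)" by (metis One_nat_def Suc_le_mono le0 not0_implies_Suc)
      then have "\<not> distinct (snd (full g))" using gq by (cases q) auto
      then show False using distinct_full[OF gq(1)] by simp
    qed
  qed
  moreover have "\<not> (\<exists>p\<in>?\<nu>. snd p = [])"
  proof
    assume "\<exists>p\<in>?\<nu>. snd p = []"
    then obtain g where "snd (full g) = []" unfolding \<nu> by blast
    then show False using full_nonempty[of g] by blast
  qed
  ultimately show ?thesis unfolding Gmult_def by (simp only: if_False)
qed

lemma ribbon_iso_gamma:
  "ribbon_iso (GH V (brauer_arrows H fst (\<lambda>_. 1)) (gammaE t) tB J) (Gvert tB) fst (Gsucc tB) Gmult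
     H fst (gammaE t) gammaS (\<lambda>_. 1)"
  unfolding ribbon_iso_def brauer_arrows_eq GH_eq
proof (intro exI[of _ germ_of] conjI ballI)
  show "bij_betw germ_of (cyc_germ ` H) H"
    by (rule bij_betw_byWitness[where f' = cyc_germ]) (auto simp: germ_of_cyc_germ)
  fix g assume "g \<in> cyc_germ ` H"
  then obtain h where h: "h \<in> H" "g = cyc_germ h" by blast
  show "gammaE t (germ_of g) = fst g"
    using h by (simp add: germ_of_cyc_germ)
  show "germ_of (Gsucc tB g) = gammaS (germ_of g)"
    using h by (simp add: Gsucc_cyc_germ germ_of_cyc_germ gammaS_H)
  show "1 = Gmult (Gvert tB g)" using h by (simp add: Gmult_cyc_germ)
  fix g' assume "g' \<in> cyc_germ ` H"
  then obtain h' where h': "h' \<in> H" "g' = cyc_germ h'" by blast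
  show "Gvert tB g = Gvert tB g' \<longleftrightarrow> fst (germ_of g) = fst (germ_of g')"
    using Gvert_eq_iff[OF h(1) h'(1)] h h' by (simp add: germ_of_cyc_germ)
qed

end

theorem theorem1p2:
  fixes V :: "'v set" and Arr :: "'a set" and s t :: "'a \<Rightarrow> 'v"
    and I :: "(('v, 'a) path \<Rightarrow> 'k::field) set"
  assumes "alg_closed TYPE('k)"
    and "gentle V Arr s t I"
    and "quiver_connected V Arr s t"
    and "Arr \<noteq> {}"
  shows "kalg_iso (triv_ext (quot_alg (path_alg V Arr s t) I))
           (brauer_alg V (gammaH V Arr s t I) fst (gammaE t) gammaS (\<lambda>_. 1) :: (_, 'k) kalg)
       \<and> ribbon_iso
           (GH V (brauer_arrows (gammaH V Arr s t I) fst (\<lambda>_. 1)) (gammaE t) (\<lambda>h. gammaE t (gammaS h))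
              (brauer_ideal V (gammaH V Arr s t I) fst (gammaE t) gammaS (\<lambda>_. 1) :: (_ \<Rightarrow> 'k) set))
           (Gvert (\<lambda>h. gammaE t (gammaS h))) fst (Gsucc (\<lambda>h. gammaE t (gammaS h))) Gmult
           (gammaH V Arr s t I) fst (gammaE t) gammaS (\<lambda>_. 1)"
proof -
  have q: "quiver V Arr s t" using assms(2) by (simp add: gentle_def)
  interpret gentle_conn V Arr s t I
  proof unfold_locales
    fix i assume i: "i \<in> V"
    obtain a where a: "a \<in> Arr" using assms(4) by blast
    let ?R = "{(s a, t a) | a. a \<in> Arr} \<union> {(t a, s a) | a. a \<in> Arr}"
    have "s a \<in> V" using q a by (simp add: quiver_def)
    then have "(i, s a) \<in> ?R\<^sup>*" using assms(3) i unfolding quiver_connected_def by blast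
    \<comment> \<open>Either the connecting walk is empty and \<open>i\<close> is the source of
      \<open>a\<close>, or its first edge is an arrow at \<open>i\<close>.\<close>
    then show "\<exists>a\<in>Arr. s a = i \<or> t a = i"
      by (cases rule: converse_rtranclE) (use a in auto)
  qed (fact q assms(2))+
  show ?thesis
    using kalg_iso_trans[OF triv_ext_iso TX_iso_brauer] ribbon_iso_gamma by blast
qed

end
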